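(* The nowhere vanishing global holomorphic section $\Omega_{\mathbb{O}}$ of the canonical line bundle of $\mathbb{X}_{\mathbb{O}}$ is $F_4$-invariant: $\alpha^*(\Omega_{\mathbb{O}})=\Omega_{\mathbb{O}}$ for every $\alpha\in F_4$.
   Context: $\mathbb{O}=\mathbb{H}\oplus\mathbb{H}\mathbf e_4$ is the octonions with basis $\mathbf e_0=1,\mathbf e_1=\mathbf i,\mathbf e_2=\mathbf j,\mathbf e_3=\mathbf k$, $\mathbf e_{i+4}=\mathbf e_i\mathbf e_4$, product $(a+b\mathbf e_4)(c+d\mathbf e_4)=ac-\theta(d)b+(da+b\theta(c))\mathbf e_4$ and conjugation $\theta(\sum h_i\mathbf e_i)=h_0\mathbf e_0-\sum_{i\ge1}h_i\mathbf e_i$, extended complex-linearly to $\mathbb{C}\otimes\mathbb{O}$. $\mathcal{J}(3)$ is the real space of matrices $A=\begin{pmatrix}\xi_1&z&\theta(y)\\ \theta(z)&\xi_2&x\\ y&\theta(x)&\xi_3\end{pmatrix}$, $\xi_i\in\mathbb{R}$, $x,y,z\in\mathbb{O}$, with Jordan product $A\circ B=\frac12(AB+BA)$; $\mathcal{J}(3)^{\mathbb{C}}$ is its complexification. $F_4=\{g\in GL(\mathcal{J}(3)):g(A\circ B)=g(A)\circ g(B),\ g(Id)=Id\}$, acting complex-linearly on $\mathcal{J}(3)^{\mathbb{C}}$. $\mathbb{X}_{\mathbb{O}}=\{A\in\mathcal{J}(3)^{\mathbb{C}}:A\ne0,\ A^2=0\}$ is a complex manifold of dimension $16$, invariant under $F_4$.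 Identify $\mathbb{C}\otimes\mathbb{H}$ with $2\times2$ complex matrices via $h_0+h_1\mathbf i+h_2\mathbf j+h_3\mathbf k\mapsto\begin{pmatrix}h_0+\sqrt{-1}h_1&h_2+\sqrt{-1}h_3\\ -h_2+\sqrt{-1}h_3&h_0-\sqrt{-1}h_1\end{pmatrix}$ and write $z=Z+W\mathbf e_4$, $y=Y+V\mathbf e_4$, $x=X+U\mathbf e_4$ with $Z=\begin{pmatrix}z_1&z_2\\ z_3&z_4\end{pmatrix}$ and similarly $W=(w_i),Y=(y_i),V=(v_i),X=(x_i),U=(u_i)$. $\Omega_{\mathbb{O}}$ is the nowhere vanishing global holomorphic $16$-form on $\mathbb{X}_{\mathbb{O}}$ which on the dense open set $\{z_1\neq0\}$, where $(\xi_2,z_1,z_2,z_3,w_1,\dots,w_4,y_2,y_4,v_1,v_3,x_3,x_4,u_2,u_4)$ are holomorphic coordinates, equals $z_1^{-5}d\xi_2\wedge dz_1\wedge dz_2\wedge dz_3\wedge dw_1\wedge\cdots\wedge dw_4\wedge dy_2\wedge dy_4\wedge dv_1\wedge dv_3\wedge dx_3\wedge dx_4\wedge du_2\wedge du_4$. *)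

theory Defs
  imports "HOL-Analysis.Analysis"
begin

section \<open>Complex vector spaces and holomorphic maps in several variables\<close>

class complex_vector = real_vector +
  fixes scaleC :: "complex \<Rightarrow> 'a \<Rightarrow> 'a" (infixr \<open>*\<^sub>C\<close> 75)
  assumes scaleC_add_right: "c *\<^sub>C (x + y) = c *\<^sub>C x + c *\<^sub>C y"
    and scaleC_add_left: "(c + d) *\<^sub>C x = c *\<^sub>C x + d *\<^sub>C x"
    and scaleC_scaleC: "c *\<^sub>C d *\<^sub>C x = (c * d) *\<^sub>C x"
    and scaleC_one: "1 *\<^sub>C x = x"
    and scaleR_scaleC: "r *\<^sub>R x = complex_of_real r *\<^sub>C x"

instantiation complex :: complex_vector
begin
definition scaleC_complex :: "complex \<Rightarrow> complex \<Rightarrow> complex"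
  where "scaleC_complex c x = c * x"
instance
  by standard (auto simp: scaleC_complex_def algebra_simps scaleR_conv_of_real)
end

instantiation prod :: (complex_vector, complex_vector) complex_vector
begin
definition scaleC_prod :: "complex \<Rightarrow> 'a \<times> 'b \<Rightarrow> 'a \<times> 'b"
  where "scaleC_prod c x = (c *\<^sub>C fst x, c *\<^sub>C snd x)"
instance
  by standard
    (auto simp: scaleC_prod_def prod_eq_iff scaleC_add_right scaleC_add_left
      scaleC_scaleC scaleC_one scaleR_scaleC)
end

instantiation vec :: (complex_vector, finite) complex_vector
begin
definition scaleC_vec :: "complex \<Rightarrow> 'a ^ 'b \<Rightarrow> 'a ^ 'b"
  where "scaleC_vec c x = (\<chi> i. c *\<^sub>C (x $ i))"
instance
  by standard
    (auto simp: scaleC_vec_def vec_eq_iff scaleC_add_right scaleC_add_left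
      scaleC_scaleC scaleC_one scaleR_scaleC)
end

definition clinear :: "('a::complex_vector \<Rightarrow> 'b::complex_vector) \<Rightarrow> bool"
  where "clinear f \<longleftrightarrow> (\<forall>x y. f (x + y) = f x + f y) \<and> (\<forall>c x. f (c *\<^sub>C x) = c *\<^sub>C f x)"

definition cholomorphic_on ::
    "('a::{complex_vector,real_normed_vector} \<Rightarrow> 'b::{complex_vector,real_normed_vector}) \<Rightarrow> 'a set \<Rightarrow> bool"
    (infixl \<open>cholomorphic'_on\<close> 50)
  where "f cholomorphic_on U \<longleftrightarrow>
    open U \<and> (\<forall>u\<in>U. \<exists>D. clinear D \<and> (f has_derivative D) (at u))"


section \<open>Holomorphic top-degree forms on an embedded complex submanifold\<close>

text \<open>Throughout, \<open>M\<close> is a subset of a complex vector space which is meant to be an embedded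
  complex submanifold of dimension \<open>CARD('k)\<close>.\<close>

definition holomorphic_curve ::
    "'e::{complex_vector,real_normed_vector} set \<Rightarrow> (complex \<Rightarrow> 'e) \<Rightarrow> 'e \<Rightarrow> 'e \<Rightarrow> bool"
  where "holomorphic_curve M \<gamma> p v \<longleftrightarrow>
    (\<exists>r>0. \<gamma> cholomorphic_on ball 0 r \<and> \<gamma> ` ball 0 r \<subseteq> M) \<and>
    \<gamma> 0 = p \<and> (\<gamma> has_derivative (\<lambda>t. t *\<^sub>C v)) (at 0)"

definition tangent_space :: "'e::{complex_vector,real_normed_vector} set \<Rightarrow> 'e \<Rightarrow> 'e set"
  where "tangent_space M p = {v. \<exists>\<gamma>. holomorphic_curve M \<gamma> p v}"

definition holomorphic_chart ::
    "'e::{complex_vector,real_normed_vector} set \<Rightarrow> (complex ^ 'k) set \<Rightarrow> (complex ^ 'k \<Rightarrow> 'e) \<Rightarrow> bool"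
  where "holomorphic_chart M U \<phi> \<longleftrightarrow>
    \<phi> cholomorphic_on U \<and>
    (\<forall>u\<in>U. inj (frechet_derivative \<phi> (at u))) \<and>
    openin (top_of_set M) (\<phi> ` U) \<and>
    (\<exists>\<psi>. homeomorphism U (\<phi> ` U) \<phi> \<psi>)"

text \<open>A form assigns to a point \<open>p\<close> and to tangent vectors \<open>v i\<close> at \<open>p\<close> a complex number; its
  values on other arguments carry no meaning.\<close>

type_synonym ('e, 'k) form = "'e \<Rightarrow> ('k \<Rightarrow> 'e) \<Rightarrow> complex"

definition alternating_multilinear_on ::
    "'e::complex_vector set \<Rightarrow> (('k \<Rightarrow> 'e) \<Rightarrow> complex) \<Rightarrow> bool"
  where "alternating_multilinear_on T f \<longleftrightarrow>
    (\<forall>v i x y a b. (\<forall>j. v j \<in> T) \<longrightarrow> x \<in> T \<longrightarrow> y \<in> T \<longrightarrow>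
       f (v(i := a *\<^sub>C x + b *\<^sub>C y)) = a * f (v(i := x)) + b * f (v(i := y))) \<and>
    (\<forall>v i j. (\<forall>l. v l \<in> T) \<longrightarrow> i \<noteq> j \<longrightarrow> v i = v j \<longrightarrow> f v = 0)"

text \<open>The holomorphy condition says that in every chart the coefficient of
  \<open>du\<^sub>1 \<and> \<dots> \<and> du\<^sub>k\<close> is a holomorphic function.\<close>

definition holomorphic_top_form ::
    "'e::{complex_vector,real_normed_vector} set \<Rightarrow> ('e, 'k::finite) form \<Rightarrow> bool"
  where "holomorphic_top_form M \<omega> \<longleftrightarrow>
    (\<forall>p\<in>M. alternating_multilinear_on (tangent_space M p) (\<omega> p)) \<and>
    (\<forall>U (\<phi> :: complex ^ 'k \<Rightarrow> 'e). holomorphic_chart M U \<phi> \<longrightarrow>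
       (\<lambda>u. \<omega> (\<phi> u) (\<lambda>i. frechet_derivative \<phi> (at u) (axis i 1))) cholomorphic_on U)"

definition nowhere_vanishing ::
    "'e::{complex_vector,real_normed_vector} set \<Rightarrow> ('e, 'k) form \<Rightarrow> bool"
  where "nowhere_vanishing M \<omega> \<longleftrightarrow>
    (\<forall>p\<in>M. \<exists>v. (\<forall>i. v i \<in> tangent_space M p) \<and> \<omega> p v \<noteq> 0)"

definition form_eq_on ::
    "'e::{complex_vector,real_normed_vector} set \<Rightarrow> 'e set \<Rightarrow> ('e, 'k) form \<Rightarrow> ('e, 'k) form \<Rightarrow> bool"
  where "form_eq_on M S \<omega> \<eta> \<longleftrightarrow>
    (\<forall>p\<in>S. \<forall>v. (\<forall>i. v i \<in> tangent_space M p) \<longrightarrow> \<omega> p v = \<eta> p v)"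

text \<open>The differential at \<open>p\<close> of a map \<open>f\<close> defined on \<open>M\<close>, computed along curves since \<open>f\<close> need
  not be differentiable (or meaningful) off \<open>M\<close>.\<close>

definition pushforward ::
    "'e::{complex_vector,real_normed_vector} set \<Rightarrow> ('e \<Rightarrow> 'e) \<Rightarrow> 'e \<Rightarrow> 'e \<Rightarrow> 'e"
  where "pushforward M f p v =
    (THE w. \<exists>\<gamma>. holomorphic_curve M \<gamma> p v \<and> ((f \<circ> \<gamma>) has_derivative (\<lambda>t. t *\<^sub>C w)) (at 0))"

definition pullback ::
    "'e::{complex_vector,real_normed_vector} set \<Rightarrow> ('e \<Rightarrow> 'e) \<Rightarrow> ('e, 'k) form \<Rightarrow> ('e, 'k) form"
  where "pullback M f \<omega> = (\<lambda>p v. \<omega> (f p) (\<lambda>i. pushforward M f p (v i)))"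


section \<open>Quaternions and octonions over a commutative ring\<close>

text \<open>The scalars will be \<open>real\<close> for \<open>\<bbbH>\<close>, \<open>\<bbbO>\<close> and \<open>complex\<close> for their complexifications.
  A pair \<open>(a, b)\<close> of quaternions stands for the octonion \<open>a + b e\<^sub>4\<close>.\<close>

type_synonym 'a quat = "'a \<times> 'a \<times> 'a \<times> 'a"
type_synonym 'a oct = "'a quat \<times> 'a quat"

fun quat_mult :: "'a::comm_ring_1 quat \<Rightarrow> 'a quat \<Rightarrow> 'a quat"
  where "quat_mult (a0, a1, a2, a3) (b0, b1, b2, b3) =
    (a0 * b0 - a1 * b1 - a2 * b2 - a3 * b3,
     a0 * b1 + a1 * b0 + a2 * b3 - a3 * b2,
     a0 * b2 - a1 * b3 + a2 * b0 + a3 * b1,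
     a0 * b3 + a1 * b2 - a2 * b1 + a3 * b0)"

fun quat_conj :: "'a::comm_ring_1 quat \<Rightarrow> 'a quat"
  where "quat_conj (a0, a1, a2, a3) = (a0, - a1, - a2, - a3)"

fun oct_mult :: "'a::comm_ring_1 oct \<Rightarrow> 'a oct \<Rightarrow> 'a oct"
  where "oct_mult (a, b) (c, d) =
    (quat_mult a c - quat_mult (quat_conj d) b, quat_mult d a + quat_mult b (quat_conj c))"

fun oct_conj :: "'a::comm_ring_1 oct \<Rightarrow> 'a oct"
  where "oct_conj (a, b) = (quat_conj a, - b)"

definition oct_scalar :: "'a::comm_ring_1 \<Rightarrow> 'a oct"
  where "oct_scalar r = ((r, 0, 0, 0), 0)"

definition oct_re :: "'a oct \<Rightarrow> 'a"
  where "oct_re q = fst (fst q)"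

fun oct_map :: "('a \<Rightarrow> 'b) \<Rightarrow> 'a oct \<Rightarrow> 'b oct"
  where "oct_map f ((a0, a1, a2, a3), (b0, b1, b2, b3)) =
    ((f a0, f a1, f a2, f a3), (f b0, f b1, f b2, f b3))"


section \<open>The Jordan algebra of Hermitian octonionic matrices and \<open>F\<^sub>4\<close>\<close>

type_synonym 'a omat = "'a oct ^ 3 ^ 3"

definition omat_mult :: "'a::comm_ring_1 omat \<Rightarrow> 'a omat \<Rightarrow> 'a omat"
  where "omat_mult A B = (\<chi> i j. \<Sum>k\<in>UNIV. oct_mult (A $ i $ k) (B $ k $ j))"

definition omat_id :: "'a::comm_ring_1 omat"
  where "omat_id = (\<chi> i j. if i = j then oct_scalar 1 else 0)"

definition omat_map :: "('a \<Rightarrow> 'b) \<Rightarrow> 'a omat \<Rightarrow> 'b omat"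
  where "omat_map f A = (\<chi> i j. oct_map f (A $ i $ j))"

definition herm_omat ::
    "'a::comm_ring_1 \<Rightarrow> 'a \<Rightarrow> 'a \<Rightarrow> 'a oct \<Rightarrow> 'a oct \<Rightarrow> 'a oct \<Rightarrow> 'a omat"
  where "herm_omat \<xi>1 \<xi>2 \<xi>3 x y z = vector
    [vector [oct_scalar \<xi>1, z, oct_conj y],
     vector [oct_conj z, oct_scalar \<xi>2, x],
     vector [y, oct_conj x, oct_scalar \<xi>3]]"

text \<open>\<open>jordan3 :: real omat set\<close> is \<open>\<J>(3)\<close> and \<open>jordan3 :: complex omat set\<close> is its
  complexification.\<close>

definition jordan3 :: "'a::comm_ring_1 omat set"
  where "jordan3 = {herm_omat \<xi>1 \<xi>2 \<xi>3 x y z | \<xi>1 \<xi>2 \<xi>3 x y z. True}"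

definition jordan_prod :: "real omat \<Rightarrow> real omat \<Rightarrow> real omat"
  where "jordan_prod A B = (1/2) *\<^sub>R (omat_mult A B + omat_mult B A)"

definition GL_jordan3 :: "(real omat \<Rightarrow> real omat) set"
  where "GL_jordan3 = {g. bij_betw g jordan3 jordan3 \<and>
    (\<forall>A\<in>jordan3. \<forall>B\<in>jordan3. g (A + B) = g A + g B) \<and>
    (\<forall>r. \<forall>A\<in>jordan3. g (r *\<^sub>R A) = r *\<^sub>R g A)}"

definition F4 :: "(real omat \<Rightarrow> real omat) set"
  where "F4 = {g \<in> GL_jordan3.
    (\<forall>A\<in>jordan3. \<forall>B\<in>jordan3. g (jordan_prod A B) = jordan_prod (g A) (g B)) \<and>
    g omat_id = omat_id}"

text \<open>The complex-linear extension \<open>A + \<i> B \<mapsto> g A + \<i> g B\<close>.\<close>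

definition complexify :: "(real omat \<Rightarrow> real omat) \<Rightarrow> complex omat \<Rightarrow> complex omat"
  where "complexify g A =
    omat_map complex_of_real (g (omat_map Re A)) +
    \<i> *\<^sub>C omat_map complex_of_real (g (omat_map Im A))"


section \<open>The manifold \<open>\<bbbX>\<^sub>\<bbbO>\<close> and the form \<open>\<Omega>\<^sub>\<bbbO>\<close>\<close>

definition X_O :: "complex omat set"
  where "X_O = {A \<in> jordan3. A \<noteq> 0 \<and> omat_mult A A = 0}"

fun quat_matrix :: "complex quat \<Rightarrow> complex ^ 2 ^ 2"
  where "quat_matrix (h0, h1, h2, h3) = vector
    [vector [h0 + \<i> * h1, h2 + \<i> * h3],
     vector [- h2 + \<i> * h3, h0 - \<i> * h1]]"

text \<open>Entries of the \<open>2 \<times> 2\<close> matrices are numbered row by row. Here \<open>vector\<close> numbers its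
  entries from 1, so the last one has index \<open>16 = 0\<close> in the index type.\<close>

definition coord :: "complex omat \<Rightarrow> complex ^ 16"
  where "coord A =
    (let x = A $ 2 $ 3; y = A $ 3 $ 1; z = A $ 1 $ 2;
         X = quat_matrix (fst x); U = quat_matrix (snd x);
         Y = quat_matrix (fst y); V = quat_matrix (snd y);
         Z = quat_matrix (fst z); W = quat_matrix (snd z)
     in vector
       [oct_re (A $ 2 $ 2),
        Z $ 1 $ 1, Z $ 1 $ 2, Z $ 2 $ 1,
        W $ 1 $ 1, W $ 1 $ 2, W $ 2 $ 1, W $ 2 $ 2,
        Y $ 1 $ 2, Y $ 2 $ 2,
        V $ 1 $ 1, V $ 2 $ 1,
        X $ 2 $ 1, X $ 2 $ 2,
        U $ 1 $ 2, U $ 2 $ 2])"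

definition z1 :: "complex omat \<Rightarrow> complex"
  where "z1 A = quat_matrix (fst (A $ 1 $ 2)) $ 1 $ 1"

text \<open>\<open>(df\<^sub>1 \<and> \<dots> \<and> df\<^sub>k)(v\<^sub>1, \<dots>, v\<^sub>k) = det (df\<^sub>i(v\<^sub>j))\<close> for the components \<open>f\<^sub>i\<close> of \<open>f\<close>.\<close>

definition wedge_differentials ::
    "('e::real_normed_vector \<Rightarrow> complex ^ 'k) \<Rightarrow> ('e, 'k::finite) form"
  where "wedge_differentials f =
    (\<lambda>p v. det (\<chi> i j. frechet_derivative (\<lambda>q. f q $ i) (at p) (v j)))"

definition is_Omega_O :: "(complex omat, 16) form \<Rightarrow> bool"
  where "is_Omega_O \<Omega> \<longleftrightarrow>
    holomorphic_top_form X_O \<Omega> \<and>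
    nowhere_vanishing X_O \<Omega> \<and>
    form_eq_on X_O {A \<in> X_O. z1 A \<noteq> 0} \<Omega>
      (\<lambda>A v. z1 A powi (- 5) * wedge_differentials coord A v)"

end

theory Submission
  imports Defs "HOL-Complex_Analysis.Conformal_Mappings"
begin

text \<open>The pullback of \<open>\<Omega>\<close> along \<open>\<alpha> \<in> F\<^sub>4\<close> is \<open>\<Omega>\<close> times a nowhere vanishing factor. Since \<open>\<Omega>\<close> is
  homogeneous under scaling, the factor is homogeneous of degree 0, hence bounded, because \<open>\<bbbX>\<^sub>\<bbbO>\<close>
  meets the unit sphere in a compact set. In the chart \<open>z\<^sub>1 \<noteq> 0\<close> it is an entire function on
  every line on which \<open>z\<^sub>1\<close> is constant, so by Liouville's theorem and homogeneity it is a
  constant \<open>c \<alpha>\<close>, and \<open>c\<close> is a character.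

  Every character of \<open>F\<^sub>4\<close> is trivial. The group is generated by the conjugations with plane
  rotations and with a cyclic permutation matrix and by the maps
  \<open>(x, y, z) \<mapsto> (a x a, a\<^sup>* y, z a\<^sup>*)\<close> for unit octonions \<open>a\<close>, where \<open>a\<^sup>* = \<theta> a\<close>. Each generator
  is conjugate to its inverse, so \<open>c\<^sup>2 = 1\<close> on it; it is also a square or has order 3, so
  \<open>c = 1\<close>. For the generation, an element is first multiplied into the stabilizer of the three
  diagonal idempotents, and then into the kernel of the action on the entry \<open>x\<close>, where the maps
  \<open>x \<mapsto> a x a\<close> give all products of two reflections.\<close>

section \<open>Octonion identities\<close>

text \<open>A general element of \<open>F4\<close> has no formula, so its Jacobian in the chart is
  out of reach and the factor has to be controlled by soft arguments. The chart makes this possible: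
  its inverse is the restriction of a linear map, and its domain in C^16 is cut out by z_1 \<noteq>
  0 alone, so it is filled by complete affine hyperplanes. The prescribed formula for \<Omega>
  enters only for scaling by c, which multiplies \<Omega> by a constant independent of the point;
  F_4 commutes with scaling, so this constant cancels. Two facts about z_1 carry the rest: F_4 moves
  every point to one with z_1 \<noteq> 0, so the translates of the one explicit chart cover
  \<open>X_O\<close>; and the set z_1 \<noteq> 0 is dense, so constancy extends from it. Elements of
  \<open>F4\<close> are functions on all real matrices but are constrained only on
  \<open>jordan3\<close>. Symmetries are therefore compared and inverted only on \<open>X_O\<close>,
  and equality of their derivatives is deduced from curves inside \<open>X_O\<close>.\<close>

lemma oct_cases:
  obtains a0 a1 a2 a3 a4 a5 a6 a7 where "x = ((a0, a1, a2, a3), (a4, a5, a6, a7))"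
  by (metis surj_pair)

text \<open>Over the complex numbers this is the bilinear norm form, not a Hermitian one, so nonzero
  octonions can have norm 0.\<close>

fun oct_norm2 :: "'a::comm_ring_1 oct \<Rightarrow> 'a"
  where "oct_norm2 ((a0, a1, a2, a3), (a4, a5, a6, a7)) =
    a0 * a0 + a1 * a1 + a2 * a2 + a3 * a3 + a4 * a4 + a5 * a5 + a6 * a6 + a7 * a7"

fun oct_smult :: "'a::comm_ring_1 \<Rightarrow> 'a oct \<Rightarrow> 'a oct"
  where "oct_smult r ((a0, a1, a2, a3), (a4, a5, a6, a7)) =
    ((r * a0, r * a1, r * a2, r * a3), (r * a4, r * a5, r * a6, r * a7))"

lemma oct_scalar_eq: "oct_scalar r = ((r, 0, 0, 0), (0, 0, 0, 0))"
  by (simp add: oct_scalar_def zero_prod_def)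

lemma oct_re_eq: "oct_re ((a0, a1, a2, a3), b) = a0"
  by (simp add: oct_re_def)

lemmas oct_expand = oct_mult.simps quat_mult.simps quat_conj.simps oct_conj.simps oct_norm2.simps
  oct_smult.simps oct_scalar_eq oct_re_eq zero_prod_def add_Pair diff_Pair uminus_Pair prod.inject

lemma oct_conj_0 [simp]: "oct_conj (0 :: 'a::comm_ring_1 oct) = 0"
  and oct_norm2_0 [simp]: "oct_norm2 (0 :: 'a::comm_ring_1 oct) = 0"
  and oct_smult_0 [simp]: "oct_smult r (0 :: 'a::comm_ring_1 oct) = 0"
  and oct_scalar_0 [simp]: "oct_scalar (0 :: 'a::comm_ring_1) = 0"
  and oct_re_0 [simp]: "oct_re (0 :: 'a::comm_ring_1 oct) = 0"
  by (simp_all only: oct_expand) simp_all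

lemma oct_re_scalar [simp]: "oct_re (oct_scalar r) = r"
  by (simp add: oct_scalar_eq oct_re_eq)

lemma oct_mult_0_left [simp]: "oct_mult 0 (x :: 'a::comm_ring_1 oct) = 0"
  and oct_mult_0_right [simp]: "oct_mult x (0 :: 'a::comm_ring_1 oct) = 0"
  and oct_smult_zero_left [simp]: "oct_smult 0 x = 0"
  and oct_smult_1 [simp]: "oct_smult 1 x = x"
  by (cases x rule: oct_cases, (simp add: oct_expand; fail))+

lemma oct_mult_scalar_left [simp]: "oct_mult (oct_scalar r) x = oct_smult r x"
  and oct_mult_scalar_right [simp]: "oct_mult x (oct_scalar r) = oct_smult r x"
  by (cases x rule: oct_cases, simp add: oct_expand mult.commute)+

lemma oct_scalar_add: "oct_scalar (r + s) = oct_scalar r + oct_scalar s"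
  and oct_conj_scalar [simp]: "oct_conj (oct_scalar r) = oct_scalar r"
  by (simp_all add: oct_expand)

lemma oct_conj_conj [simp]: "oct_conj (oct_conj x) = x"
  and oct_norm2_conj [simp]: "oct_norm2 (oct_conj x) = oct_norm2 x"
  and oct_norm2_smult [simp]: "oct_norm2 (oct_smult r x) = r * r * oct_norm2 x"
  and oct_conj_smult [simp]: "oct_conj (oct_smult r x) = oct_smult r (oct_conj x)"
  and oct_smult_smult [simp]: "oct_smult r (oct_smult s x) = oct_smult (r * s) x"
  by (cases x rule: oct_cases, (simp add: algebra_simps; fail))+

lemma oct_conj_inject [simp]: "oct_conj x = oct_conj y \<longleftrightarrow> x = y"
  by (metis oct_conj_conj)

lemma oct_conj_eq_0 [simp]: "oct_conj x = 0 \<longleftrightarrow> x = 0"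
  by (metis oct_conj_conj oct_conj_0)

lemma oct_mult_conj_right [simp]: "oct_mult x (oct_conj x) = oct_scalar (oct_norm2 x)"
  and oct_mult_conj_left [simp]: "oct_mult (oct_conj x) x = oct_scalar (oct_norm2 x)"
  by (cases x rule: oct_cases, (simp add: oct_expand algebra_simps; fail))+

lemma oct_conj_add: "oct_conj (x + y) = oct_conj x + oct_conj y"
  and oct_conj_minus: "oct_conj (- y) = - oct_conj y"
  and oct_re_add: "oct_re (x + y) = oct_re x + oct_re y"
  and oct_smult_add_right: "oct_smult r (x + y) = oct_smult r x + oct_smult r y"
  and oct_smult_add_left: "oct_smult (r + s) x = oct_smult r x + oct_smult s x"
  and oct_conj_mult: "oct_conj (oct_mult x y) = oct_mult (oct_conj y) (oct_conj x)"
  and oct_mult_smult_left: "oct_mult (oct_smult r x) y = oct_smult r (oct_mult x y)"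
  and oct_mult_smult_right: "oct_mult x (oct_smult r y) = oct_smult r (oct_mult x y)"
  and oct_mult_minus_left: "oct_mult (- x) y = - oct_mult x y"
  and oct_mult_minus_right: "oct_mult x (- y) = - oct_mult x y"
  by (cases x rule: oct_cases, cases y rule: oct_cases, (simp add: oct_expand algebra_simps; fail))+

lemma oct_mult_add_left: "oct_mult (x + x') y = oct_mult x y + oct_mult x' y"
  and oct_mult_add_right: "oct_mult y (x + x') = oct_mult y x + oct_mult y x'"
  by (cases x rule: oct_cases, cases x' rule: oct_cases, cases y rule: oct_cases, (simp add:
      oct_expand algebra_simps; fail))+

text \<open>Alternativity and multiplicativity of the norm are polynomial identities in the
  coordinates, so they serve the real octonions and their complexification alike.\<close>

lemma oct_mult_conj_cancel_right:
    "oct_mult (oct_mult x y) (oct_conj y) = oct_smult (oct_norm2 y) (x :: 'a::idom oct)"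
  and oct_mult_conj_cancel_right':
    "oct_mult (oct_mult x (oct_conj y)) y = oct_smult (oct_norm2 y) x"
  and oct_mult_conj_cancel_left:
    "oct_mult (oct_conj y) (oct_mult y x) = oct_smult (oct_norm2 y) x"
  and oct_mult_conj_cancel_left':
    "oct_mult y (oct_mult (oct_conj y) x) = oct_smult (oct_norm2 y) x"
  and oct_norm2_mult: "oct_norm2 (oct_mult x y) = oct_norm2 x * oct_norm2 y"
  and oct_flexible: "oct_mult y (oct_mult x y) = oct_mult (oct_mult y x) y"
  by (cases x rule: oct_cases, cases y rule: oct_cases, hypsubst_thin, simp only: oct_expand,
      (intro conjI)?; algebra)+

text \<open>The Moufang identities replace associativity; they are what makes a unit octonion act on
  the Jordan algebra by automorphisms.\<close>

lemma oct_moufang_left: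
    "oct_mult (oct_mult (oct_mult a x) a) y = oct_mult a (oct_mult x (oct_mult a y))"
  and oct_moufang_middle:
    "oct_mult (oct_mult a x) (oct_mult y a) = oct_mult (oct_mult a (oct_mult x y)) (a :: 'a::idom
        oct)"
  by (cases x rule: oct_cases, cases y rule: oct_cases, cases a rule: oct_cases, hypsubst_thin,
      simp only: oct_expand, intro conjI; algebra)+

section \<open>Hermitian matrices\<close>

lemma herm_omat_nth [simp]:
  "herm_omat a b c x y z $ 1 $ 1 = oct_scalar a"
  "herm_omat a b c x y z $ 1 $ 2 = z"
  "herm_omat a b c x y z $ 1 $ 3 = oct_conj y"
  "herm_omat a b c x y z $ 2 $ 1 = oct_conj z"
  "herm_omat a b c x y z $ 2 $ 2 = oct_scalar b"
  "herm_omat a b c x y z $ 2 $ 3 = x"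
  "herm_omat a b c x y z $ 3 $ 1 = y"
  "herm_omat a b c x y z $ 3 $ 2 = oct_conj x"
  "herm_omat a b c x y z $ 3 $ 3 = oct_scalar c"
  by (simp_all add: herm_omat_def vector_3)

lemma omat_eq_iff:
  "A = B \<longleftrightarrow> A $ 1 $ 1 = B $ 1 $ 1 \<and> A $ 1 $ 2 = B $ 1 $ 2 \<and> A $ 1 $ 3 = B $ 1 $ 3 \<and>
    A $ 2 $ 1 = B $ 2 $ 1 \<and> A $ 2 $ 2 = B $ 2 $ 2 \<and> A $ 2 $ 3 = B $ 2 $ 3 \<and>
    A $ 3 $ 1 = B $ 3 $ 1 \<and> A $ 3 $ 2 = B $ 3 $ 2 \<and> A $ 3 $ 3 = (B :: 'a omat) $ 3 $ 3"
  by (auto simp: vec_eq_iff forall_3)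

lemma oct_scalar_inject [simp]: "oct_scalar r = oct_scalar s \<longleftrightarrow> r = s"
  by (auto simp: oct_scalar_eq)

lemma herm_omat_inject [simp]:
  "herm_omat a b c x y z = herm_omat a' b' c' x' y' z' \<longleftrightarrow>
    a = a' \<and> b = b' \<and> c = c' \<and> x = x' \<and> y = y' \<and> z = z'"
  by (auto simp: omat_eq_iff)

lemma herm_omat_in_jordan3 [simp]: "herm_omat a b c x y z \<in> jordan3"
  unfolding jordan3_def by blast

lemma jordan3_cases:
  assumes "A \<in> jordan3"
  obtains a b c x y z where "A = herm_omat a b c x y z"
  using assms by (auto simp: jordan3_def)

lemma herm_omat_add:
  "herm_omat a b c x y z + herm_omat a' b' c' x' y' z' =
    herm_omat (a + a') (b + b') (c + c') (x + x') (y + y') (z + z')"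
  by (simp add: omat_eq_iff oct_scalar_add oct_conj_add)

lemma herm_omat_0: "herm_omat 0 0 0 0 0 0 = 0"
  by (simp add: omat_eq_iff)

lemma herm_omat_eq_0_iff:
  "herm_omat a b c x y z = 0 \<longleftrightarrow> a = 0 \<and> b = 0 \<and> c = 0 \<and> x = 0 \<and> y = 0 \<and> z = 0"
  by (subst herm_omat_0 [symmetric]) (simp only: herm_omat_inject)

lemma omat_id_eq: "omat_id = herm_omat 1 1 1 0 0 0"
  by (simp add: omat_eq_iff omat_id_def)

text \<open>Only squares are expanded: the product of two different Hermitian matrices need not be
  Hermitian, and the Jordan product is recovered from squares by polarization.\<close>

lemma omat_mult_herm_square:
  "omat_mult (herm_omat a b c x y z) (herm_omat a b c x y z) =
    herm_omat (a * a + oct_norm2 z + oct_norm2 y) (b * b + oct_norm2 z + oct_norm2 x)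
      (c * c + oct_norm2 x + oct_norm2 y)
      (oct_smult (b + c) x + oct_conj (oct_mult y z))
      (oct_smult (a + c) y + oct_conj (oct_mult z x))
      (oct_smult (a + b) z + oct_conj (oct_mult x y))"
  by (simp add: omat_eq_iff omat_mult_def sum_3 oct_scalar_add oct_conj_add oct_smult_add_left
      oct_conj_mult ac_simps) (simp add: oct_scalar_eq)

text \<open>A linear retraction onto \<open>jordan3\<close>. It turns membership into the linear
  equation \<open>herm_proj A = A\<close> and extends maps from \<open>jordan3\<close> to all
  matrices.\<close>

definition herm_proj :: "'a::comm_ring_1 omat \<Rightarrow> 'a omat"
  where "herm_proj A = herm_omat (oct_re (A $ 1 $ 1)) (oct_re (A $ 2 $ 2)) (oct_re (A $ 3 $ 3))
    (A $ 2 $ 3) (A $ 3 $ 1) (A $ 1 $ 2)"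

lemma herm_proj_in [simp]: "herm_proj A \<in> jordan3"
  by (simp add: herm_proj_def)

lemma herm_proj_id: "A \<in> jordan3 \<Longrightarrow> herm_proj A = A"
  by (auto simp: jordan3_def herm_proj_def)

section \<open>Elements of \<open>F\<^sub>4\<close>\<close>

lemma oct_scaleR: "r *\<^sub>R x = oct_smult r (x :: real oct)"
  by (cases x rule: oct_cases) simp

lemma oct_re_scaleR: "oct_re (r *\<^sub>R x) = r * oct_re x"
  by (simp add: oct_re_def)

lemma oct_mult_scaleR_left: "oct_mult (r *\<^sub>R x) y = r *\<^sub>R oct_mult x (y :: real oct)"
  and oct_mult_scaleR_right: "oct_mult x (r *\<^sub>R y) = r *\<^sub>R oct_mult x (y :: real oct)"
  by (simp_all add: oct_scaleR oct_mult_smult_left oct_mult_smult_right)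

lemma herm_omat_scaleR:
  "r *\<^sub>R herm_omat a b c x y z =
    herm_omat (r * a) (r * b) (r * c) (oct_smult r x) (oct_smult r y) (oct_smult r (z :: real oct))"
  by (simp add: omat_eq_iff oct_scaleR) (simp add: oct_scalar_eq)

lemma jordan3_add: "A \<in> jordan3 \<Longrightarrow> B \<in> jordan3 \<Longrightarrow> A + B \<in> jordan3"
  by (elim jordan3_cases) (simp add: herm_omat_add)

lemma jordan3_scaleR: "A \<in> jordan3 \<Longrightarrow> r *\<^sub>R (A :: real omat) \<in> jordan3"
  by (elim jordan3_cases) (simp add: herm_omat_scaleR)

lemma jordan3_diff: "A \<in> jordan3 \<Longrightarrow> B \<in> jordan3 \<Longrightarrow> A - (B :: real omat) \<in> jordan3"
  using jordan3_add[of A "(-1) *\<^sub>R B"] jordan3_scaleR[of B "-1"] by simp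

lemma jordan3_0 [simp]: "0 \<in> jordan3"
  by (metis herm_omat_0 herm_omat_in_jordan3)

lemma omat_id_in_jordan3 [simp]: "omat_id \<in> jordan3"
  by (simp add: omat_id_eq)

lemma omat_mult_square_in_jordan3: "A \<in> jordan3 \<Longrightarrow> omat_mult A A \<in> jordan3"
  by (elim jordan3_cases) (simp add: omat_mult_herm_square)

lemma omat_mult_add_left: "omat_mult (A + B) C = omat_mult A C + omat_mult B C"
  and omat_mult_add_right: "omat_mult C (A + B) = omat_mult C A + omat_mult C B"
  by (simp_all add: omat_mult_def vec_eq_iff oct_mult_add_left oct_mult_add_right sum.distrib)

lemma jordan_prod_self: "jordan_prod A A = omat_mult A A"
  by (simp add: jordan_prod_def scaleR_add_right flip: scaleR_add_left)

lemma jordan_prod_polarize: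
  "jordan_prod A B = (1/2) *\<^sub>R (omat_mult (A + B) (A + B) - omat_mult A A - omat_mult B B)"
  by (simp add: jordan_prod_def omat_mult_add_left omat_mult_add_right)

lemma jordan_prod_in_jordan3: "A \<in> jordan3 \<Longrightarrow> B \<in> jordan3 \<Longrightarrow> jordan_prod A B \<in> jordan3"
  unfolding jordan_prod_polarize
  by (intro jordan3_scaleR jordan3_diff omat_mult_square_in_jordan3 jordan3_add)

text \<open>By polarization, a linear map that preserves squares preserves the Jordan
  product.\<close>

lemma F4I:
  assumes lin: "linear g"
    and into: "\<And>A. A \<in> jordan3 \<Longrightarrow> g A \<in> jordan3"
    and h: "\<And>A. A \<in> jordan3 \<Longrightarrow> h A \<in> jordan3"
      "\<And>A. A \<in> jordan3 \<Longrightarrow> h (g A) = A" "\<And>A. A \<in> jordan3 \<Longrightarrow> g (h A) = A"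
    and sq: "\<And>A. A \<in> jordan3 \<Longrightarrow> g (omat_mult A A) = omat_mult (g A) (g A)"
    and "g omat_id = omat_id"
  shows "g \<in> F4"
proof -
  have "bij_betw g jordan3 jordan3"
    by (rule bij_betw_byWitness[of _ h]) (use into h in auto)
  moreover have "g (jordan_prod A B) = jordan_prod (g A) (g B)" if "A \<in> jordan3" "B \<in> jordan3"
      for A B
    using that sq[OF jordan3_add[OF that]] by (simp add: jordan_prod_polarize linear_add[OF lin]
        linear_diff[OF lin] linear_cmul[OF lin] sq)
  ultimately show ?thesis
    using assms by (simp add: F4_def GL_jordan3_def linear_add linear_cmul)
qed

context
  fixes g
  assumes g: "g \<in> F4"
begin

lemma F4_in: "A \<in> jordan3 \<Longrightarrow> g A \<in> jordan3"
  using g by (auto simp: F4_def GL_jordan3_def bij_betw_def)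
lemma F4_add: "A \<in> jordan3 \<Longrightarrow> B \<in> jordan3 \<Longrightarrow> g (A + B) = g A + g B"
  using g by (auto simp: F4_def GL_jordan3_def)
lemma F4_scaleR: "A \<in> jordan3 \<Longrightarrow> g (r *\<^sub>R A) = r *\<^sub>R g A"
  using g by (auto simp: F4_def GL_jordan3_def)
lemma F4_jordan_prod:
  "A \<in> jordan3 \<Longrightarrow> B \<in> jordan3 \<Longrightarrow> g (jordan_prod A B) = jordan_prod (g A) (g B)"
  using g by (auto simp: F4_def)
lemma F4_id: "g omat_id = omat_id"
  using g by (auto simp: F4_def)
lemma F4_inj: "A \<in> jordan3 \<Longrightarrow> B \<in> jordan3 \<Longrightarrow> g A = g B \<longleftrightarrow> A = B"
  using g by (auto simp: F4_def GL_jordan3_def bij_betw_def inj_on_def)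
lemma F4_0: "g 0 = 0"
  using F4_scaleR[of 0 0] by simp
lemma F4_diff: "A \<in> jordan3 \<Longrightarrow> B \<in> jordan3 \<Longrightarrow> g (A - B) = g A - g B"
  using F4_add[of A "(-1) *\<^sub>R B"] F4_scaleR[of B "-1"] jordan3_scaleR[of B "-1"] by simp
lemma F4_eq_0_iff: "A \<in> jordan3 \<Longrightarrow> g A = 0 \<longleftrightarrow> A = 0"
  using F4_inj[of A 0] F4_0 by simp

end

lemma F4_comp:
  assumes "g \<in> F4" "h \<in> F4"
  shows "g \<circ> h \<in> F4"
proof -
  have "bij_betw (g \<circ> h) jordan3 jordan3"
    using assms by (auto simp: F4_def GL_jordan3_def intro: bij_betw_trans)
  then show ?thesis
    unfolding F4_def[unfolded GL_jordan3_def]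
    by (simp add: F4_in[OF assms(2)] F4_add[OF assms(1)] F4_scaleR[OF assms(1)] F4_jordan_prod[OF
        assms(1)] F4_id[OF assms(1)]
      F4_add[OF assms(2)] F4_scaleR[OF assms(2)] F4_jordan_prod[OF assms(2)] F4_id[OF assms(2)])
qed

lemma id_in_F4: "id \<in> F4"
  by (rule F4I[where h = id]) (auto simp: linear_id)

lemma F4_inverse:
  assumes g: "g \<in> F4"
  shows "\<exists>h\<in>F4. \<forall>A\<in>jordan3. h (g A) = A \<and> g (h A) = A"
proof -
  define h where "h = inv_into jordan3 g"
  have bij: "bij_betw g jordan3 jordan3"
    using g by (auto simp: F4_def GL_jordan3_def)
  have bij': "bij_betw h jordan3 jordan3"
    unfolding h_def by (rule bij_betw_inv_into[OF bij])
  have hg: "h (g A) = A" if "A \<in> jordan3" for A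
    using bij that by (simp add: h_def bij_betw_inv_into_left)
  have gh: "g (h A) = A" if "A \<in> jordan3" for A
    using bij that by (simp add: h_def bij_betw_inv_into_right)
  have inn: "h A \<in> jordan3" if "A \<in> jordan3" for A
    using bij' that by (auto simp: bij_betw_def)
  have "h (A + B) = h A + h B" if "A \<in> jordan3" "B \<in> jordan3" for A B
    using hg[of "h A + h B"] that by (simp add: F4_add[OF g] inn gh jordan3_add)
  moreover have "h (r *\<^sub>R A) = r *\<^sub>R h A" if "A \<in> jordan3" for A r
    using hg[of "r *\<^sub>R h A"] that by (simp add: F4_scaleR[OF g] inn gh jordan3_scaleR)
  moreover have "h (jordan_prod A B) = jordan_prod (h A) (h B)"
    if "A \<in> jordan3" "B \<in> jordan3" for A B
    using hg[of "jordan_prod (h A) (h B)"] that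
    by (simp add: F4_jordan_prod[OF g] inn gh jordan_prod_in_jordan3)
  moreover have "h omat_id = omat_id"
    using hg[of omat_id] by (simp add: F4_id[OF g])
  ultimately have "h \<in> F4"
    using bij' by (simp add: F4_def GL_jordan3_def)
  with hg gh show ?thesis by blast
qed

text \<open>An element of the copy of Spin(8) in F_4 that fixes the diagonal: triality couples x |->
  a x a with a left multiplication on y and a right multiplication on z.\<close>

definition unit_oct_action :: "real oct \<Rightarrow> real omat \<Rightarrow> real omat"
  where "unit_oct_action a A = herm_omat (oct_re (A $ 1 $ 1)) (oct_re (A $ 2 $ 2)) (oct_re
      (A $ 3 $ 3))
    (oct_mult (oct_mult a (A $ 2 $ 3)) a) (oct_mult (oct_conj a) (A $ 3 $ 1))
    (oct_mult (A $ 1 $ 2) (oct_conj a))"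

lemma unit_oct_action_herm: "unit_oct_action a (herm_omat r s t x y z) =
    herm_omat r s t (oct_mult (oct_mult a x) a) (oct_mult (oct_conj a) y) (oct_mult z (oct_conj a))"
  by (simp add: unit_oct_action_def)

lemma unit_oct_action_inverse:
  assumes "oct_norm2 a = 1" "A \<in> jordan3"
  shows "unit_oct_action (oct_conj a) (unit_oct_action a A) = A"
proof -
  have "oct_mult (oct_mult (oct_conj a) (oct_mult (oct_mult a x) a)) (oct_conj a) = x" for x
  proof -
    have "oct_mult (oct_conj a) (oct_mult (oct_mult a x) a) = oct_mult x a"
      using assms(1) by (simp add: oct_mult_conj_cancel_left flip: oct_flexible)
    then show ?thesis using assms(1) by (simp add: oct_mult_conj_cancel_right)
  qed
  with assms show ?thesis
    by (elim jordan3_cases) (simp add: unit_oct_action_herm oct_mult_conj_cancel_left'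
        oct_mult_conj_cancel_right')
qed

lemma unit_oct_action_in_F4:
  assumes a: "oct_norm2 a = 1"
  shows "unit_oct_action a \<in> F4"
proof (rule F4I[where h = "unit_oct_action (oct_conj a)"])
  show "linear (unit_oct_action a)"
    by (rule linearI) (simp_all add: unit_oct_action_def herm_omat_add herm_omat_scaleR oct_re_add
        oct_mult_add_left oct_mult_add_right oct_re_scaleR oct_mult_scaleR_left
        oct_mult_scaleR_right flip: oct_scaleR)
next
  fix A :: "real omat"
  assume "A \<in> jordan3"
  then obtain r s t x y z where A: "A = herm_omat r s t x y z" by (elim jordan3_cases)
  have ca: "oct_norm2 (oct_conj a) = 1" using a by simp
  \<comment> \<open>The products y z, x y and z x must transform like the conjugates of x, z and y.
    These are the middle, left and right Moufang identities; the right one is obtained from the left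
    one by conjugation.\<close>
  have 1: "oct_mult (oct_mult (oct_conj a) y) (oct_mult z (oct_conj a)) =
      oct_mult (oct_mult (oct_conj a) (oct_mult y z)) (oct_conj a)"
    by (rule oct_moufang_middle)
  have 2: "oct_mult (oct_mult (oct_mult a x) a) (oct_mult (oct_conj a) y) =
      oct_mult a (oct_mult x y)" for x y
    using a by (simp add: oct_moufang_left oct_mult_conj_cancel_left')
  have 3: "oct_mult (oct_mult z (oct_conj a)) (oct_mult (oct_mult a x) a) =
      oct_mult (oct_mult z x) a" for x z
  proof -
    have "oct_conj (oct_mult (oct_mult z (oct_conj a)) (oct_mult (oct_mult a x) a)) =
        oct_conj (oct_mult (oct_mult z x) a)"
      using ca by (simp add: oct_conj_mult oct_flexible oct_moufang_left oct_mult_conj_cancel_left)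
    then show ?thesis by simp
  qed
  show "unit_oct_action a (omat_mult A A) = omat_mult (unit_oct_action a A) (unit_oct_action a A)"
    using a by (simp add: A unit_oct_action_herm omat_mult_herm_square oct_norm2_mult 1 2 3
        oct_mult_add_left
        oct_mult_add_right oct_mult_smult_left oct_mult_smult_right oct_conj_mult oct_flexible)
qed (use a unit_oct_action_inverse[of a] unit_oct_action_inverse[of "oct_conj a"] in
    \<open>auto simp: omat_id_eq unit_oct_action_herm, simp_all add: unit_oct_action_def\<close>)

text \<open>This is M A M^T. Real scalars commute and associate with octonions, so the double sum
  avoids any question of bracketing.\<close>

definition ortho_conj :: "real ^ 3 ^ 3 \<Rightarrow> real omat \<Rightarrow> real omat"
  where "ortho_conj M A = (\<chi> i j. \<Sum>k\<in>UNIV. \<Sum>l\<in>UNIV. (M $ i $ k * M $ j $ l) *\<^sub>R A $ k $ l)"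

lemma ortho_conj_herm:
  "ortho_conj M (herm_omat a b c x y z) = herm_proj (ortho_conj M (herm_omat a b c x y z))"
proof -
  have *: "oct_scalar (oct_re x) = ((1/2) *\<^sub>R (x + oct_conj x) :: real oct)" for x
    by (cases x rule: oct_cases) (simp add: oct_expand)
  have c: "oct_conj (r *\<^sub>R x) = r *\<^sub>R oct_conj x" for x :: "real oct" and r
    by (simp add: oct_scaleR)
  show ?thesis
    by (simp add: omat_eq_iff herm_proj_def * ortho_conj_def sum_3 c oct_conj_add scaleR_add_right)
      (simp add: algebra_simps flip: scaleR_add_left)
qed

lemma ortho_conj_linear: "linear (ortho_conj M)"
  by (rule linearI) (simp_all add: ortho_conj_def vec_eq_iff scaleR_add_right sum.distrib
      scaleR_sum_right mult_ac)

lemma ortho_conj_in: "A \<in> jordan3 \<Longrightarrow> ortho_conj M A \<in> jordan3"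
  by (elim jordan3_cases) (metis ortho_conj_herm herm_proj_in)

lemma ortho_conj_mult: "ortho_conj M (ortho_conj N A) = ortho_conj (M ** N) A"
proof -
  have "(\<Sum>k\<in>UNIV. \<Sum>l\<in>UNIV. (M $ i $ k * M $ j $ l) *\<^sub>R (\<Sum>p\<in>UNIV. \<Sum>q\<in>UNIV. (N $ k $ p * N $ l $ q)
      *\<^sub>R A $ p $ q))
    = (\<Sum>p\<in>UNIV. \<Sum>q\<in>UNIV. ((\<Sum>k\<in>UNIV. M $ i $ k * N $ k $ p) * (\<Sum>l\<in>UNIV. M $ j $ l * N $ l $ q)) *\<^sub>R
        A $ p $ q)"
    for i j
    by (simp add: sum_3 algebra_simps)
  then show ?thesis
    by (simp add: ortho_conj_def matrix_matrix_mult_def vec_eq_iff)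
qed

lemma ortho_conj_id: "ortho_conj (mat 1) A = A"
  by (simp add: ortho_conj_def mat_def vec_eq_iff forall_3 sum_3)

lemma ortho_conj_in_F4:
  assumes M: "orthogonal_matrix M"
  shows "ortho_conj M \<in> F4"
proof (rule F4I[where h = "ortho_conj (transpose M)"])
  have MM: "M ** transpose M = mat 1" "transpose M ** M = mat 1"
    using M by (auto simp: orthogonal_matrix_def)
  have o: "(\<Sum>k\<in>UNIV. M $ k $ i * M $ k $ j) = (if i = j then 1 else 0)" for i j
    using MM(2) by (simp add: vec_eq_iff matrix_matrix_mult_def transpose_def mat_def)
  have o': "(\<Sum>k\<in>UNIV. M $ i $ k * M $ j $ k) = (if i = j then 1 else 0)" for i j
    using MM(1) by (simp add: vec_eq_iff matrix_matrix_mult_def transpose_def mat_def)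
  have "ortho_conj M omat_id $ i $ j = (\<Sum>k\<in>UNIV. M $ i $ k * M $ j $ k) *\<^sub>R oct_scalar 1" for i j
    by (simp add: ortho_conj_def omat_id_def sum_3 scaleR_add_left)
  then show "ortho_conj M omat_id = omat_id"
    unfolding o' by (simp add: vec_eq_iff omat_id_def)
  fix A :: "real omat"
  assume "A \<in> jordan3"
  show "ortho_conj (transpose M) (ortho_conj M A) = A" "ortho_conj M (ortho_conj (transpose M) A) =
      A"
    by (simp_all add: ortho_conj_mult MM ortho_conj_id)
  show "ortho_conj M (omat_mult A A) = omat_mult (ortho_conj M A) (ortho_conj M A)"
  proof -
    \<comment> \<open>Collecting terms isolates the sum over m, an entry of M^T M, which
      orthogonality reduces to a Kronecker delta.\<close>
    have 1: "(\<Sum>m\<in>UNIV. oct_mult (\<Sum>k\<in>UNIV. \<Sum>l\<in>UNIV. (M $ i $ k * M $ m $ l) *\<^sub>R A $ k $ l)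
        (\<Sum>k\<in>UNIV. \<Sum>l\<in>UNIV. (M $ m $ k * M $ j $ l) *\<^sub>R A $ k $ l))
      = (\<Sum>k\<in>UNIV. \<Sum>q\<in>UNIV. \<Sum>l\<in>UNIV. \<Sum>p\<in>UNIV. (M $ i $ k * M $ j $ q * (\<Sum>m\<in>UNIV. M $ m $ l *
          M $ m $ p)) *\<^sub>R
         oct_mult (A $ k $ l) (A $ p $ q))" for i j
      by (simp add: sum_3 oct_mult_add_left oct_mult_add_right oct_mult_scaleR_left
          oct_mult_scaleR_right) (simp add: algebra_simps)
    have 2: "(\<Sum>k\<in>UNIV. \<Sum>q\<in>UNIV. \<Sum>l\<in>UNIV. \<Sum>p\<in>UNIV. (M $ i $ k * M $ j $ q * (\<Sum>m\<in>UNIV. M $ m $ l *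
        M $ m $ p)) *\<^sub>R
         oct_mult (A $ k $ l) (A $ p $ q)) = (\<Sum>k\<in>UNIV. \<Sum>q\<in>UNIV. (M $ i $ k * M $ j $ q) *\<^sub>R
        (\<Sum>l\<in>UNIV. oct_mult (A $ k $ l) (A $ l $ q)))" for i j
      unfolding o by (simp add: sum_3 scaleR_add_right)
    show ?thesis unfolding ortho_conj_def omat_mult_def by (simp add: vec_eq_iff 1 2)
  qed
qed (use M in \<open>auto simp: ortho_conj_linear ortho_conj_in\<close>)

section \<open>Characters of \<open>F\<^sub>4\<close> are trivial\<close>

definition rot12 :: "real \<Rightarrow> real ^ 3 ^ 3"
  where "rot12 t = vector [vector [cos t, - sin t, 0], vector [sin t, cos t, 0], vector [0, 0, 1]]"
text \<open>The two swaps only serve to conjugate generators to their inverses: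
  \<open>swap12\<close> the rotations, \<open>swap23\<close> the cyclic permutation and the unit
  octonion actions.\<close>

definition swap12 :: "real ^ 3 ^ 3"
  where "swap12 = vector [vector [0, 1, 0], vector [1, 0, 0], vector [0, 0, 1]]"
definition swap23 :: "real ^ 3 ^ 3"
  where "swap23 = vector [vector [1, 0, 0], vector [0, 0, 1], vector [0, 1, 0]]"
definition cycle3 :: "real ^ 3 ^ 3"
  where "cycle3 = vector [vector [0, 1, 0], vector [0, 0, 1], vector [1, 0, 0]]"

lemmas matrix3_simps = vec_eq_iff forall_3 matrix_matrix_mult_def sum_3 vector_3 mat_def
  transpose_def orthogonal_matrix_def

lemma orthogonal_swap12: "orthogonal_matrix swap12"
  and orthogonal_swap23: "orthogonal_matrix swap23"
  and orthogonal_cycle3: "orthogonal_matrix cycle3"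
  by (simp_all add: matrix3_simps swap12_def swap23_def cycle3_def)

lemma orthogonal_rot12: "orthogonal_matrix (rot12 t)"
  by (simp add: matrix3_simps rot12_def flip: power2_eq_square)

lemma ortho_conj_cycle3:
  "ortho_conj cycle3 (herm_omat r s t x y z) = herm_omat s t r y z x"
  by (simp add: omat_eq_iff ortho_conj_def sum_3 cycle3_def vector_3)

lemma ortho_conj_swap23:
  "ortho_conj swap23 (herm_omat r s t x y z) = herm_omat r t s (oct_conj x) (oct_conj z) (oct_conj
      y)"
  by (simp add: omat_eq_iff ortho_conj_def sum_3 swap23_def vector_3)

lemma ortho_conj_rot12:
  "ortho_conj (rot12 u) (herm_omat r s t x y z) =
    herm_omat (cos u * cos u * r - 2 * cos u * sin u * oct_re z + sin u * sin u * s)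
     (sin u * sin u * r + 2 * cos u * sin u * oct_re z + cos u * cos u * s) t
     (sin u *\<^sub>R oct_conj y + cos u *\<^sub>R x) (cos u *\<^sub>R y - sin u *\<^sub>R oct_conj x)
     ((cos u * cos u) *\<^sub>R z - (sin u * sin u) *\<^sub>R oct_conj z + oct_scalar (cos u * sin u * (r -
         s)))"
  by (cases x rule: oct_cases, cases y rule: oct_cases, cases z rule: oct_cases)
    (simp add: omat_eq_iff ortho_conj_def sum_3 rot12_def vector_3 oct_expand algebra_simps)

lemma rot12_add: "rot12 t ** rot12 u = rot12 (t + u)"
  by (simp add: rot12_def matrix3_simps cos_add sin_add algebra_simps)

lemma rot12_0: "rot12 0 = mat 1"
  by (simp add: rot12_def matrix3_simps)

text \<open>Nonassociativity keeps \<open>unit_oct_action\<close> from being a homomorphism in a,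
  but it respects squares, which is enough to write each of these generators as a square.\<close>

lemma unit_oct_action_dil:
  assumes "A \<in> jordan3"
  shows "unit_oct_action a (unit_oct_action a A) = unit_oct_action (oct_mult a a) A"
proof -
  have alt: "oct_mult (oct_mult a a) x = oct_mult a (oct_mult a x)"
    and "oct_mult (oct_mult x a) a = oct_mult x (oct_mult a a)" for a x :: "real oct"
    by (cases x rule: oct_cases, cases a rule: oct_cases, hypsubst_thin,
      simp only: oct_expand, intro conjI; algebra)+
  moreover have "oct_mult (oct_mult (oct_mult a a) x) (oct_mult a a) =
      oct_mult (oct_mult a (oct_mult (oct_mult a x) a)) a" for a x :: "real oct"
    unfolding alt by (rule oct_moufang_middle)
  ultimately show ?thesis
    using assms by (elim jordan3_cases) (simp add: unit_oct_action_herm oct_conj_mult)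
qed

text \<open>The root bisects the angle: (1 + a)^2 = (2 + 2 Re a) a for a unit octonion a. At a = -1
  this degenerates and the unit i is taken instead.\<close>

lemma unit_oct_sqrt:
  assumes a: "oct_norm2 (a :: real oct) = 1"
  obtains b where "oct_norm2 b = 1" "oct_mult b b = a"
proof -
  obtain a0 a1 a2 a3 a4 a5 a6 a7 where A: "a = ((a0, a1, a2, a3), (a4, a5, a6, a7))"
    by (rule oct_cases)
  have n: "a0 * a0 + a1 * a1 + a2 * a2 + a3 * a3 + a4 * a4 + a5 * a5 + a6 * a6 + a7 * a7 = 1"
    using a by (simp add: A)
  show thesis
  proof (cases "a0 = -1")
    case True
    then have "a1 * a1 + a2 * a2 + a3 * a3 + a4 * a4 + a5 * a5 + a6 * a6 + a7 * a7 = 0"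
      using n by simp
    then have "a1 = 0" "a2 = 0" "a3 = 0" "a4 = 0" "a5 = 0" "a6 = 0" "a7 = 0"
      using zero_le_square[of a1] zero_le_square[of a2] zero_le_square[of a3] zero_le_square[of a4]
        zero_le_square[of a5] zero_le_square[of a6] zero_le_square[of a7]
      by (smt (verit) mult_eq_0_iff)+
    then show ?thesis
      using True by (intro that[of "((0,1,0,0),(0,0,0,0))"]) (simp_all add: A oct_expand)
  next
    case False
    \<comment> \<open>The squared norm of 1 + a is 2 + 2 Re a, so s normalizes it.\<close>
    define s where "s = 1 / sqrt (2 + 2 * a0)"
    have "a0 * a0 \<le> 1"
      using n zero_le_square[of a1] zero_le_square[of a2] zero_le_square[of a3] zero_le_square[of
          a4]
        zero_le_square[of a5] zero_le_square[of a6] zero_le_square[of a7] by linarith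
    then have "\<bar>a0\<bar> \<le> 1" by (metis abs_square_le_1 power2_eq_square)
    then have pos: "2 + 2 * a0 > 0" using False by linarith
    then have s: "s * s * (2 + 2 * a0) = 1"
      by (simp add: s_def field_simps)
    show ?thesis
    proof (rule that[of "oct_smult s (((1 + a0, a1, a2, a3), (a4, a5, a6, a7)))"])
      show "oct_norm2 (oct_smult s ((1 + a0, a1, a2, a3), a4, a5, a6, a7)) = 1"
        unfolding oct_expand using n s by algebra
      show "oct_mult (oct_smult s ((1 + a0, a1, a2, a3), a4, a5, a6, a7))
          (oct_smult s ((1 + a0, a1, a2, a3), a4, a5, a6, a7)) = a"
        unfolding A oct_expand using n s by (intro conjI; algebra)
    qed
  qed
qed

section \<open>Reflections in the Euclidean space of octonions\<close>

lemma oct_norm2_inner: "oct_norm2 x = x \<bullet> x"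
  by (cases x rule: oct_cases) (simp add: inner_prod_def)

lemma oct_norm2_eq_0_iff: "oct_norm2 (x :: real oct) = 0 \<longleftrightarrow> x = 0"
  by (simp add: oct_norm2_inner)

lemma oct_reflect:
  fixes v x :: "real oct"
  assumes "oct_norm2 v = 1"
  shows "oct_mult (oct_mult v (oct_conj x)) v = (2 * (x \<bullet> v)) *\<^sub>R v - x"
proof -
  have "oct_mult (oct_mult v (oct_conj x)) v + oct_smult (oct_norm2 v) x = oct_smult (2 * (x \<bullet> v))
      v"
    by (cases x rule: oct_cases, cases v rule: oct_cases, hypsubst_thin,
      simp only: oct_expand inner_prod_def fst_conv snd_conv inner_real_def, intro conjI; algebra)
  with assms show ?thesis by (simp add: oct_scaleR eq_diff_eq)
qed

text \<open>By \<open>oct_reflect\<close>, x |-> theta(v) x theta(v) is minus the reflection in v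
  followed by conjugation; the second factor w cancels both the sign and the conjugation.\<close>

lemma oct_double_reflect:
  fixes v w x :: "real oct"
  assumes "oct_norm2 v = 1" "oct_norm2 w = 1"
  defines "x' \<equiv> x - (2 * (x \<bullet> v)) *\<^sub>R v"
  shows "oct_mult (oct_mult w (oct_mult (oct_mult (oct_conj v) x) (oct_conj v))) w =
    x' - (2 * (x' \<bullet> w)) *\<^sub>R w"
proof -
  have "oct_mult (oct_mult (oct_conj v) x) (oct_conj v) = oct_conj (oct_mult (oct_mult v (oct_conj
      x)) v)"
    by (simp add: oct_conj_mult oct_flexible)
  also have "\<dots> = - oct_conj x'"
    by (simp add: oct_reflect[OF assms(1)] x'_def flip: oct_conj_minus)
  finally show ?thesis
    using oct_reflect[OF assms(2), of x'] by (simp add: oct_mult_minus_left oct_mult_minus_right)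
qed

section \<open>The Jordan product in components and the Peirce spaces\<close>

lemma jordan_prod_herm:
  "jordan_prod (herm_omat r s t x y z) (herm_omat r' s' t' x' y' z') =
    herm_omat (r * r' + z \<bullet> z' + y \<bullet> y') (s * s' + z \<bullet> z' + x \<bullet> x') (t * t' + x \<bullet> x' + y \<bullet> y')
     ((1/2) *\<^sub>R ((s + t) *\<^sub>R x' + (s' + t') *\<^sub>R x + oct_conj (oct_mult y z' + oct_mult y' z)))
     ((1/2) *\<^sub>R ((r + t) *\<^sub>R y' + (r' + t') *\<^sub>R y + oct_conj (oct_mult z x' + oct_mult z' x)))
     ((1/2) *\<^sub>R ((r + s) *\<^sub>R z' + (r' + s') *\<^sub>R z + oct_conj (oct_mult x y' + oct_mult x' y)))"
proof -
  have d: "herm_omat r s t x y z - herm_omat r' s' t' x' y' z' =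
      herm_omat (r - r') (s - s') (t - t') (x - x') (y - y') (z - (z' :: real oct))"
    for r s t x y z r' s' t' x' y' z'
    by (simp add: diff_eq_eq herm_omat_add)
  show ?thesis
    unfolding jordan_prod_polarize herm_omat_add omat_mult_herm_square d herm_omat_scaleR
    by (simp add: oct_norm2_inner inner_add_left inner_add_right inner_commute oct_scaleR[symmetric]
        oct_mult_add_left oct_mult_add_right oct_conj_add scaleR_add_left scaleR_add_right
            algebra_simps)
qed

text \<open>The three off-diagonal entries are joint eigenspaces, with eigenvalues 0 and 1/2, of
  Jordan multiplication by the diagonal idempotents; g preserves them because it fixes the
  idempotents. The last relation is the triality condition, the image under g of the product of the
  x-space with the y-space.\<close>

lemma F4_peirce:
  assumes g: "g \<in> F4"
    and g2: "g (herm_omat 0 1 0 0 0 0) = herm_omat 0 1 0 0 0 0"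
    and g3: "g (herm_omat 0 0 1 0 0 0) = herm_omat 0 0 1 0 0 0"
  obtains a b c where
    "\<And>r s t x y z. g (herm_omat r s t x y z) = herm_omat r s t (a x) (b y) (c z)"
    "linear a" "linear b" "linear c" "\<And>x. a x \<bullet> a x = x \<bullet> x"
    "\<And>x y. oct_mult (a x) (b y) = oct_conj (c (oct_conj (oct_mult x y)))"
proof -
  note in3 = herm_omat_in_jordan3
  have "herm_omat 1 0 0 0 0 0 + (herm_omat 0 1 0 0 0 0 + herm_omat 0 0 1 0 0 0) =
      (omat_id :: real omat)"
    by (simp add: herm_omat_add omat_id_eq)
  then have "g (herm_omat 1 0 0 0 0 0) + (herm_omat 0 1 0 0 0 0 + herm_omat 0 0 1 0 0 0) = omat_id"
    using F4_id[OF g] F4_add[OF g] g2 g3 by (metis in3 jordan3_add)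
  then have g1: "g (herm_omat 1 0 0 0 0 0) = herm_omat 1 0 0 0 0 0"
    by (simp add: omat_id_eq herm_omat_add eq_diff_eq[symmetric])
      (simp add: diff_eq_eq herm_omat_add)
  note gi = g1 g2 g3
  have lin: "linear (\<lambda>w. g (f w) $ i $ j)" if "linear f" "\<And>w. f w \<in> jordan3" for f ::
      "real oct \<Rightarrow> real omat" and i j
    using that by (intro linearI) (simp_all add: linear_add linear_cmul F4_add[OF g] F4_scaleR[OF
        g])
  have eq: "jordan_prod (herm_omat p q u 0 0 0) (g B) = v *\<^sub>R g B"
    if "jordan_prod (herm_omat p q u 0 0 0) B = v *\<^sub>R B" "B \<in> jordan3"
      "(p, q, u) = (1, 0, 0) \<or> (p, q, u) = (0, 1, 0) \<or> (p, q, u) = (0, 0, 1)" for p q u v B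
    using F4_jordan_prod[OF g in3 that(2), of p q u 0 0 0] that gi F4_scaleR[OF g that(2)] by auto
  have X: "\<exists>w. g (herm_omat 0 0 0 x 0 0) = herm_omat 0 0 0 w 0 0" for x
    using eq[of 1 0 0 "herm_omat 0 0 0 x 0 0" 0] eq[of 0 1 0 "herm_omat 0 0 0 x 0 0" "1/2"]
      F4_in[OF g in3, of 0 0 0 x 0 0]
    by (elim jordan3_cases)
      (auto simp: jordan_prod_herm herm_omat_scaleR herm_omat_eq_0_iff simp del: split_paired_Ex
        simp flip: oct_scaleR)
  have Y: "\<exists>w. g (herm_omat 0 0 0 0 x 0) = herm_omat 0 0 0 0 w 0" for x
    using eq[of 0 1 0 "herm_omat 0 0 0 0 x 0" 0] eq[of 0 0 1 "herm_omat 0 0 0 0 x 0" "1/2"]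
      F4_in[OF g in3, of 0 0 0 0 x 0]
    by (elim jordan3_cases)
      (auto simp: jordan_prod_herm herm_omat_scaleR herm_omat_eq_0_iff simp del: split_paired_Ex
        simp flip: oct_scaleR)
  have Z: "\<exists>w. g (herm_omat 0 0 0 0 0 x) = herm_omat 0 0 0 0 0 w" for x
    using eq[of 0 0 1 "herm_omat 0 0 0 0 0 x" 0] eq[of 0 1 0 "herm_omat 0 0 0 0 0 x" "1/2"]
      F4_in[OF g in3, of 0 0 0 0 0 x]
    by (elim jordan3_cases)
      (auto simp: jordan_prod_herm herm_omat_scaleR herm_omat_eq_0_iff simp del: split_paired_Ex
        simp flip: oct_scaleR)
  define a where "a = (\<lambda>w. g (herm_omat 0 0 0 w 0 0) $ 2 $ 3)"
  define b where "b = (\<lambda>w. g (herm_omat 0 0 0 0 w 0) $ 3 $ 1)"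
  define c where "c = (\<lambda>w. g (herm_omat 0 0 0 0 0 w) $ 1 $ 2)"
  have ga: "g (herm_omat 0 0 0 x 0 0) = herm_omat 0 0 0 (a x) 0 0" for x
    unfolding a_def using X[of x] by auto
  have gb: "g (herm_omat 0 0 0 0 x 0) = herm_omat 0 0 0 0 (b x) 0" for x
    unfolding b_def using Y[of x] by auto
  have gc: "g (herm_omat 0 0 0 0 0 x) = herm_omat 0 0 0 0 0 (c x)" for x
    unfolding c_def using Z[of x] by auto
  show thesis
  proof
    show la: "linear a" unfolding a_def
      by (rule lin) (auto intro!: linearI simp: herm_omat_add herm_omat_scaleR oct_scaleR)
    show lb: "linear b" unfolding b_def
      by (rule lin) (auto intro!: linearI simp: herm_omat_add herm_omat_scaleR oct_scaleR)
    show lc: "linear c" unfolding c_def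
      by (rule lin) (auto intro!: linearI simp: herm_omat_add herm_omat_scaleR oct_scaleR)
    show "g (herm_omat r s t x y z) = herm_omat r s t (a x) (b y) (c z)" for r s t x y z
    proof -
      have "herm_omat r s t x y z = r *\<^sub>R herm_omat 1 0 0 0 0 0 + (s *\<^sub>R herm_omat 0 1 0 0 0 0 +
          (t *\<^sub>R herm_omat 0 0 1 0 0 0 + (herm_omat 0 0 0 x 0 0 + (herm_omat 0 0 0 0 y 0 +
           herm_omat 0 0 0 0 0 z))))"
        by (simp add: herm_omat_scaleR herm_omat_add)
      then show ?thesis
        by (simp add: F4_add[OF g] F4_scaleR[OF g] jordan3_add jordan3_scaleR gi ga gb gc)
          (simp add: herm_omat_scaleR herm_omat_add)
    qed
    show "a x \<bullet> a x = x \<bullet> x" for x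
    proof -
      have "jordan_prod (herm_omat 0 0 0 x 0 0) (herm_omat 0 0 0 x 0 0) =
          (x \<bullet> x) *\<^sub>R (herm_omat 0 1 0 0 0 0 + herm_omat 0 0 1 0 0 0)"
        by (simp add: jordan_prod_herm herm_omat_add herm_omat_scaleR)
      from arg_cong[OF this, of g] show ?thesis
        by (simp add: F4_jordan_prod[OF g] F4_scaleR[OF g] F4_add[OF g] jordan3_add gi ga)
          (simp add: jordan_prod_herm herm_omat_add herm_omat_scaleR)
    qed
    show "oct_mult (a x) (b y) = oct_conj (c (oct_conj (oct_mult x y)))" for x y
    proof -
      have "jordan_prod (herm_omat 0 0 0 x 0 0) (herm_omat 0 0 0 0 y 0) =
          (1/2) *\<^sub>R herm_omat 0 0 0 0 0 (oct_conj (oct_mult x y))"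
        by (simp add: jordan_prod_herm herm_omat_add herm_omat_scaleR oct_scaleR)
      from arg_cong[OF this, of g]
      have "oct_smult (1/2) (oct_conj (oct_mult (a x) (b y))) = oct_smult (1/2) (c (oct_conj
          (oct_mult x y)))"
        by (simp add: F4_jordan_prod[OF g] F4_scaleR[OF g] gc gb ga)
          (simp add: jordan_prod_herm herm_omat_scaleR oct_scaleR)
      then show ?thesis
        by (metis oct_conj_conj oct_scaleR scaleR_cancel_left zero_neq_numeral divide_eq_0_iff
            zero_neq_one)
    qed
  qed
qed

text \<open>Elements of \<open>F4\<close> that agree on \<open>jordan3\<close> may differ elsewhere
  as functions; \<open>cong\<close> makes c a character of the actual group of
  automorphisms.\<close>

locale F4_character =
  fixes c :: "(real omat \<Rightarrow> real omat) \<Rightarrow> 'b::field"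
  assumes mult: "g \<in> F4 \<Longrightarrow> h \<in> F4 \<Longrightarrow> c (g \<circ> h) = c g * c h"
    and cong: "g \<in> F4 \<Longrightarrow> h \<in> F4 \<Longrightarrow> (\<And>A. A \<in> jordan3 \<Longrightarrow> g A = h A) \<Longrightarrow> c g = c h"
    and nonzero: "g \<in> F4 \<Longrightarrow> c g \<noteq> 0"
begin

lemma id_eq_1: "c id = 1"
  using mult[OF id_in_F4 id_in_F4] nonzero[OF id_in_F4] by simp

lemma inverse_pair:
  assumes "g \<in> F4" "h \<in> F4" "\<And>A. A \<in> jordan3 \<Longrightarrow> g (h A) = A"
  shows "c g * c h = 1"
  using cong[OF F4_comp[OF assms(1,2)] id_in_F4] assms by (simp add: mult id_eq_1)

text \<open>The target is commutative, so conjugate elements have equal values; here h conjugates g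
  to its inverse g'.\<close>

lemma conj_inverse:
  assumes "g \<in> F4" "g' \<in> F4" "h \<in> F4" "\<And>A. A \<in> jordan3 \<Longrightarrow> g (g' A) = A"
    and "\<And>A. A \<in> jordan3 \<Longrightarrow> h (g A) = g' (h A)"
  shows "c g * c g = 1"
proof -
  have "c h * c g = c g' * c h"
    using cong[OF F4_comp[of h g] F4_comp[of g' h]] assms by (simp add: mult)
  then have "c g = c g'"
    using nonzero[of h] assms by simp
  then show ?thesis
    using inverse_pair[of g g'] assms by simp
qed

lemma rot12_eq_1: "c (ortho_conj (rot12 t)) = 1"
proof -
  have F: "ortho_conj (rot12 u) \<in> F4" for u
    by (rule ortho_conj_in_F4[OF orthogonal_rot12])
  have "swap12 ** rot12 u = rot12 (- u) ** swap12" for u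
    by (simp add: matrix3_simps swap12_def rot12_def)
  then have "c (ortho_conj (rot12 u)) * c (ortho_conj (rot12 u)) = 1" for u
    using F by (intro conj_inverse[where g' = "ortho_conj (rot12 (- u))" and h =
        "ortho_conj swap12"])
      (simp_all add: ortho_conj_in_F4 orthogonal_swap12 ortho_conj_mult rot12_add rot12_0
          ortho_conj_id)
  moreover have "c (ortho_conj (rot12 t)) = c (ortho_conj (rot12 (t/2))) * c (ortho_conj (rot12
      (t/2)))"
    using cong[OF F F4_comp[OF F F], of t "t/2" "t/2"] F by (simp add: mult ortho_conj_mult
        rot12_add)
  ultimately show ?thesis by simp
qed

lemma cycle3_eq_1: "c (ortho_conj cycle3) = 1"
proof -
  have F: "ortho_conj cycle3 \<in> F4"
    by (rule ortho_conj_in_F4[OF orthogonal_cycle3])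
  have "c (ortho_conj cycle3) * c (ortho_conj cycle3) = 1"
    by (rule conj_inverse[where g' = "ortho_conj cycle3 \<circ> ortho_conj cycle3" and h =
        "ortho_conj swap23"])
      (auto simp: F F4_comp ortho_conj_in_F4 orthogonal_swap23 ortho_conj_cycle3 ortho_conj_swap23
        elim!: jordan3_cases)
  moreover have "c (ortho_conj cycle3) * c (ortho_conj cycle3 \<circ> ortho_conj cycle3) = 1"
    by (rule inverse_pair) (auto simp: F F4_comp ortho_conj_cycle3 elim!: jordan3_cases)
  ultimately show ?thesis by (simp add: mult F)
qed

lemma unit_oct_action_eq_1:
  assumes a: "oct_norm2 a = 1"
  shows "c (unit_oct_action a) = 1"
proof -
  have sq: "c (unit_oct_action b) * c (unit_oct_action b) = 1" if "oct_norm2 b = 1" for b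
    using that unit_oct_action_inverse[of "oct_conj b"]
    by (intro conj_inverse[where g' = "unit_oct_action (oct_conj b)" and h = "ortho_conj swap23"])
      (auto simp: unit_oct_action_in_F4 ortho_conj_in_F4 orthogonal_swap23 ortho_conj_swap23
          unit_oct_action_herm
        oct_conj_mult oct_flexible elim!: jordan3_cases)
  obtain b where b: "oct_norm2 b = 1" "oct_mult b b = a"
    using unit_oct_sqrt[OF a] .
  have F: "unit_oct_action b \<in> F4" by (rule unit_oct_action_in_F4[OF b(1)])
  have "c (unit_oct_action a) = c (unit_oct_action b) * c (unit_oct_action b)"
    using cong[OF unit_oct_action_in_F4[OF a] F4_comp[OF F F]] F b
        by (simp add: mult unit_oct_action_dil)
  with sq[OF b(1)] show ?thesis by simp
qed

text \<open>The reductions below multiply an element of \<open>F4\<close> by elements of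
  \<open>ker\<close>, which does not change its value under c.\<close>

definition ker where "ker = {g \<in> F4. c g = 1}"

lemma ker_comp: "g \<in> ker \<Longrightarrow> h \<in> ker \<Longrightarrow> g \<circ> h \<in> ker"
  by (simp add: ker_def F4_comp mult)

lemma ker_F4: "g \<in> ker \<Longrightarrow> g \<in> F4"
  by (simp add: ker_def)

lemma ker_comp_iff: "g \<in> ker \<Longrightarrow> h \<in> F4 \<Longrightarrow> c (g \<circ> h) = c h"
  by (simp add: ker_def mult)

lemma rot_ker: "ortho_conj (rot12 t) \<in> ker"
  and cycle_ker: "ortho_conj cycle3 \<in> ker"
  by (simp_all add: ker_def rot12_eq_1 cycle3_eq_1 ortho_conj_in_F4 orthogonal_rot12
      orthogonal_cycle3)

lemma unit_oct_action_ker: "oct_norm2 a = 1 \<Longrightarrow> unit_oct_action a \<in> ker"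
  by (simp add: ker_def unit_oct_action_eq_1 unit_oct_action_in_F4)

lemma id_ker: "id \<in> ker"
  by (simp add: ker_def id_in_F4 id_eq_1)

text \<open>One step of the Jacobi eigenvalue method: a unit octonion makes z real, then a plane
  rotation removes it. The last two clauses allow the step to be repeated without spoiling zeros
  already present or the third idempotent.\<close>

lemma kill_z:
  obtains g r' s' x' y' where "g \<in> ker"
    "g (herm_omat r s t x y z) = herm_omat r' s' t x' y' 0"
    "x = 0 \<Longrightarrow> y = 0 \<Longrightarrow> x' = 0 \<and> y' = 0"
    "\<And>v. g (herm_omat 0 0 v 0 0 0) = herm_omat 0 0 v 0 0 0"
proof -
  obtain a where a: "oct_norm2 a = 1" "oct_mult z (oct_conj a) = oct_scalar (norm z)"
  proof (cases "z = 0")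
    case True
    then show ?thesis by (intro that[of "oct_scalar 1"]) (auto simp: oct_expand)
  next
    case False
    show ?thesis
    proof (rule that[of "oct_smult (1 / norm z) z"])
      show "oct_norm2 (oct_smult (1 / norm z) z) = 1"
        unfolding oct_norm2_smult using False
        by (simp add: oct_norm2_inner dot_square_norm power2_eq_square)
      show "oct_mult z (oct_conj (oct_smult (1 / norm z) z)) = oct_scalar (norm z)"
        using False
        by (simp add: oct_mult_smult_right) (simp add: oct_norm2_inner dot_square_norm oct_scalar_eq
            power2_eq_square)
    qed
  qed
  define \<rho> where "\<rho> = sqrt ((r - s)\<^sup>2 + (2 * norm z)\<^sup>2)"
  \<comment> \<open>This is the vanishing of the rotated entry, that is, tan(2u) = -2 |z| / (r - s)
    when r \<noteq> s; a suitable 2u is the polar angle of (r - s, -2 |z|).\<close>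
  obtain u where u: "cos (2 * u) * norm z + sin (2 * u) * ((r - s) / 2) = 0"
  proof (cases "\<rho> = 0")
    case True
    then have "r - s = 0 \<and> 2 * norm z = 0"
      unfolding \<rho>_def by (simp only: real_sqrt_eq_0_iff sum_power2_eq_zero_iff)
    then show ?thesis by (intro that[of 0]) simp
  next
    case False
    have "((r - s) / \<rho>)\<^sup>2 + (- (2 * norm z) / \<rho>)\<^sup>2 = 1"
    proof -
      have "\<rho>\<^sup>2 = (r - s)\<^sup>2 + (2 * norm z)\<^sup>2"
        unfolding \<rho>_def by (rule real_sqrt_pow2) simp
      moreover have "\<rho>\<^sup>2 \<noteq> 0" using False by simp
      ultimately show ?thesis
        unfolding power_divide power2_minus by (metis add_divide_distrib divide_self)
    qed
    then obtain t where "(r - s) / \<rho> = cos t" "- (2 * norm z) / \<rho> = sin t"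
      using sincos_total_2pi by metis
    then have "r - s = \<rho> * cos t" "norm z = - (\<rho> * sin t) / 2"
      using False by (auto simp: field_simps)
    then show ?thesis by (intro that[of "t / 2"]) (simp add: mult.left_commute)
  qed
  define A where "A = ortho_conj (rot12 u) (unit_oct_action a (herm_omat r s t x y z))"
  have "A $ 1 $ 2 = oct_scalar (cos (2 * u) * norm z + sin (2 * u) * ((r - s) / 2))"
    unfolding A_def unit_oct_action_herm ortho_conj_rot12 a(2) cos_double sin_double
        power2_eq_square
    by (simp add: oct_expand field_simps)
  then have A12: "A $ 1 $ 2 = 0" using u by simp
  show thesis
  proof (rule that[of "ortho_conj (rot12 u) \<circ> unit_oct_action a"])
    show "ortho_conj (rot12 u) \<circ> unit_oct_action a \<in> ker"
      by (intro ker_comp rot_ker unit_oct_action_ker a)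
    show "(ortho_conj (rot12 u) \<circ> unit_oct_action a) (herm_omat r s t x y z) =
        herm_omat (oct_re (A $ 1 $ 1)) (oct_re (A $ 2 $ 2)) t (A $ 2 $ 3) (A $ 3 $ 1) 0"
      using A12 unfolding A_def o_def unit_oct_action_herm ortho_conj_rot12 by simp
    show "A $ 2 $ 3 = 0 \<and> A $ 3 $ 1 = 0" if "x = 0" "y = 0"
      using that unfolding A_def unit_oct_action_herm ortho_conj_rot12 by simp
    show "(ortho_conj (rot12 u) \<circ> unit_oct_action a) (herm_omat 0 0 v 0 0 0) =
        herm_omat 0 0 v 0 0 0" for v
      by (simp add: unit_oct_action_herm ortho_conj_rot12)
  qed
qed

text \<open>For an idempotent the Jacobi method stops after two steps: once z = 0, another
  off-diagonal entry vanishes automatically, and a cyclic permutation moves the last one into the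
  place of z.\<close>

lemma diagonalize_idempotent:
  assumes "B \<in> jordan3" "jordan_prod B B = B"
  obtains g r s t where "g \<in> ker" "g B = herm_omat r s t 0 0 0"
    "r = 0 \<or> r = 1" "s = 0 \<or> s = 1" "t = 0 \<or> t = 1"
proof -
  have idem: "jordan_prod (g B) (g B) = g B" if "g \<in> ker" for g
    using assms F4_jordan_prod[OF ker_F4[OF that], of B B] by simp
  obtain r s t x y z where B: "B = herm_omat r s t x y z"
    using assms(1) by (elim jordan3_cases)
  obtain g r' s' x' y' where g: "g \<in> ker" "g B = herm_omat r' s' t x' y' 0"
    unfolding B by (rule kill_z)
  have "x' = 0 \<or> y' = 0"
  proof -
    \<comment> \<open>The z-entry of the square is the conjugate of x' y', and it must equal the
      z-entry 0. Multiplicativity of the norm then makes one factor vanish.\<close>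
    have "oct_mult x' y' = 0"
      using idem[OF g(1)] by (simp add: g jordan_prod_herm flip: scaleR_2)
    then have "oct_norm2 x' * oct_norm2 y' = 0"
      by (metis oct_norm2_mult oct_norm2_0)
    then show ?thesis by (simp add: oct_norm2_eq_0_iff)
  qed
  then obtain h p q v z' where h: "h \<in> ker" "h B = herm_omat p q v 0 0 z'"
  proof
    assume "x' = 0"
    then have "(ortho_conj cycle3 \<circ> (ortho_conj cycle3 \<circ> g)) B = herm_omat t r' s' 0 0 y'"
      by (simp add: g ortho_conj_cycle3)
    then show thesis by (rule that[rotated]) (intro ker_comp cycle_ker g)
  next
    assume "y' = 0"
    then have "(ortho_conj cycle3 \<circ> g) B = herm_omat s' t r' 0 0 x'"
      by (simp add: g ortho_conj_cycle3)
    then show thesis by (rule that[rotated]) (intro ker_comp cycle_ker g)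
  qed
  obtain k p' q' where k: "k \<in> ker" "k (h B) = herm_omat p' q' v 0 0 0"
    unfolding h by (rule kill_z[of p q v 0 0 z']) auto
  have "k \<circ> h \<in> ker" by (intro ker_comp k h)
  from idem[OF this] k that[OF this, of p' q' v] show thesis
    by (auto simp: jordan_prod_herm)
qed

end

text \<open>The nucleus of the octonions is the real line, and since e_1, e_2 and e_4 generate the
  algebra, testing these three pairs is enough.\<close>

lemma oct_real_of_associating:
  fixes u :: "real oct"
  defines "e1 \<equiv> ((0,1,0,0),(0,0,0,0))" and "e2 \<equiv> ((0,0,1,0),(0,0,0,0))" and
      "e4 \<equiv> ((0,0,0,0),(1,0,0,0))"
  assumes "oct_mult e1 (oct_mult e2 u) = oct_mult (oct_mult e1 e2) u"
    and "oct_mult e1 (oct_mult e4 u) = oct_mult (oct_mult e1 e4) u"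
    and "oct_mult e2 (oct_mult e4 u) = oct_mult (oct_mult e2 e4) u"
  shows "u = oct_scalar (oct_re u)"
  using assms by (cases u rule: oct_cases) (auto simp: oct_expand)

lemma scaleR_half_eq_self_iff: "(1/2) *\<^sub>R x = x \<longleftrightarrow> x = (0 :: 'a::real_vector)"
  using scaleR_cancel_right[of "1/2" x 1] by simp

context F4_character
begin

text \<open>The image of E_3 is an idempotent, so it can be diagonalized with entries 0 and 1.
  Injectivity excludes 0 and the identity, and primitivity of E_3 excludes two entries 1; a cyclic
  permutation does the rest.\<close>

lemma F4_fixing_E3:
  assumes \<alpha>: "\<alpha> \<in> F4"
  obtains g where "g \<in> ker" "g (\<alpha> (herm_omat 0 0 1 0 0 0)) = herm_omat 0 0 1 0 0 0"
proof -
  note in3 = herm_omat_in_jordan3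
  have "jordan_prod (\<alpha> (herm_omat 0 0 1 0 0 0)) (\<alpha> (herm_omat 0 0 1 0 0 0)) = \<alpha> (herm_omat 0 0 1 0 0
      0)"
    using F4_jordan_prod[OF \<alpha> in3 in3, of 0 0 1 0 0 0 0 0 1 0 0 0] by (simp add: jordan_prod_herm)
  then obtain h r s t where h: "h \<in> ker" "h (\<alpha> (herm_omat 0 0 1 0 0 0)) = herm_omat r s t 0 0 0"
      "r = 0 \<or> r = 1" "s = 0 \<or> s = 1" "t = 0 \<or> t = 1"
    by (rule diagonalize_idempotent[OF F4_in[OF \<alpha> in3]])
  have ne0: "herm_omat r s t 0 0 0 \<noteq> 0"
    using F4_eq_0_iff[OF F4_comp[OF ker_F4[OF h(1)] \<alpha>], of "herm_omat 0 0 1 0 0 0"]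
    by (simp add: h herm_omat_eq_0_iff)
  have ne1: "herm_omat r s t 0 0 0 \<noteq> omat_id"
    using F4_inj[OF F4_comp[OF ker_F4[OF h(1)] \<alpha>], of "herm_omat 0 0 1 0 0 0" omat_id]
      F4_id[OF F4_comp[OF ker_F4[OF h(1)] \<alpha>]]
    by (simp add: h omat_id_eq)
  \<comment> \<open>If E_3 went to E_1 + E_2, its complement E_1 + E_2 would go to E_3, which would
    split into the nonzero idempotents P and Q. But the Peirce 1-space of E_3 consists of its real
    multiples, whose only idempotents are 0 and E_3.\<close>
  have no: False if g: "g \<in> F4" "g (herm_omat 0 0 1 0 0 0) = herm_omat 1 1 0 0 0 0" for g
  proof -
    define P where "P = g (herm_omat 1 0 0 0 0 0)"
    define Q where "Q = g (herm_omat 0 1 0 0 0 0)"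
    have "herm_omat 1 1 0 0 0 0 = (omat_id - herm_omat 0 0 1 0 0 0 :: real omat)"
      by (simp add: omat_id_eq eq_diff_eq herm_omat_add)
    then have "g (herm_omat 1 1 0 0 0 0) = omat_id - herm_omat 1 1 0 0 0 0"
      by (simp add: F4_diff[OF g(1)] F4_id[OF g(1)] g(2))
    also have "\<dots> = herm_omat 0 0 1 0 0 0"
      by (simp add: omat_id_eq diff_eq_eq herm_omat_add)
    finally have g11: "g (herm_omat 1 1 0 0 0 0) = herm_omat 0 0 1 0 0 0" .
    have "herm_omat 1 1 0 0 0 0 = (herm_omat 1 0 0 0 0 0 + herm_omat 0 1 0 0 0 0 :: real omat)"
      by (simp add: herm_omat_add)
    then have PQ: "P + Q = herm_omat 0 0 1 0 0 0"
      using g11 by (simp add: P_def Q_def F4_add[OF g(1)])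
    have PE: "jordan_prod P (herm_omat 0 0 1 0 0 0) = P"
      unfolding P_def g11[symmetric] F4_jordan_prod[OF g(1) in3 in3, symmetric]
      by (simp add: jordan_prod_herm)
    have PP: "jordan_prod P P = P"
      unfolding P_def F4_jordan_prod[OF g(1) in3 in3, symmetric]
      by (simp add: jordan_prod_herm)
    obtain p q v x y z where P: "P = herm_omat p q v x y z"
      using F4_in[OF g(1) in3] unfolding P_def by (metis jordan3_cases)
    have "p = 0 \<and> q = 0 \<and> x = 0 \<and> y = 0 \<and> z = 0"
      using PE unfolding P by (simp add: jordan_prod_herm scaleR_half_eq_self_iff)
    moreover from this have "v = 0 \<or> v = 1"
      using PP unfolding P by (simp add: jordan_prod_herm)
    ultimately have "P = 0 \<or> P = herm_omat 0 0 1 0 0 0"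
      unfolding P by (auto simp: herm_omat_0)
    then have "P = 0 \<or> Q = 0" using PQ by auto
    then show False
      unfolding P_def Q_def using F4_eq_0_iff[OF g(1) in3]
      by (auto simp: herm_omat_eq_0_iff)
  qed
  obtain k r s t where k: "k \<in> ker" "k (\<alpha> (herm_omat 0 0 1 0 0 0)) = herm_omat r s t 0 0 0"
      "(r, s, t) = (0, 0, 1) \<or> (r, s, t) = (1, 1, 0)"
  proof -
    have c1: "(ortho_conj cycle3 \<circ> h) (\<alpha> (herm_omat 0 0 1 0 0 0)) = herm_omat s t r 0 0 0"
      and c2: "(ortho_conj cycle3 \<circ> (ortho_conj cycle3 \<circ> h)) (\<alpha> (herm_omat 0 0 1 0 0 0)) =
          herm_omat t r s 0 0 0"
      by (simp_all add: h ortho_conj_cycle3)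
    have k1: "ortho_conj cycle3 \<circ> h \<in> ker" and k2: "ortho_conj cycle3 \<circ> (ortho_conj cycle3 \<circ> h) \<in>
        ker"
      by (intro ker_comp cycle_ker h)+
    have "(r, s, t) \<in> {(0,0,1), (1,1,0)} \<or> (s, t, r) \<in> {(0,0,1), (1,1,0)} \<or> (t, r, s) \<in> {(0,0,1),
        (1,1,0)}"
      using h(3-5) ne0 ne1 by (auto simp: herm_omat_0 omat_id_eq)
    then show thesis
      using that[OF h(1,2)] that[OF k1 c1] that[OF k2 c2] by blast
  qed
  have "(r, s, t) \<noteq> (1, 1, 0)"
    using no[OF F4_comp[OF ker_F4[OF k(1)] \<alpha>]] k(2) by auto
  with k that show thesis by auto
qed

text \<open>The image of E_2 is orthogonal to E_3, hence lies in the upper left 2 x 2 block, where a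
  single Jacobi step fixing E_3 diagonalizes it.\<close>

lemma F4_fixing_E2:
  assumes \<alpha>: "\<alpha> \<in> F4" and \<alpha>3: "\<alpha> (herm_omat 0 0 1 0 0 0) = herm_omat 0 0 1 0 0 0"
  obtains g where "g \<in> ker" "g (\<alpha> (herm_omat 0 1 0 0 0 0)) = herm_omat 0 1 0 0 0 0"
    "g (herm_omat 0 0 1 0 0 0) = herm_omat 0 0 1 0 0 0"
proof -
  note in3 = herm_omat_in_jordan3
  obtain r s t x y z where B: "\<alpha> (herm_omat 0 1 0 0 0 0) = herm_omat r s t x y z"
    using F4_in[OF \<alpha> in3] by (metis jordan3_cases)
  have "jordan_prod (herm_omat r s t x y z) (herm_omat 0 0 1 0 0 0) = 0"
    unfolding B[symmetric] using F4_jordan_prod[OF \<alpha> in3 in3, of 0 1 0 0 0 0 0 0 1 0 0 0]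
    by (simp add: \<alpha>3 jordan_prod_herm herm_omat_0 F4_0[OF \<alpha>])
  then have 0: "t = 0" "x = 0" "y = 0"
    by (auto simp: jordan_prod_herm herm_omat_eq_0_iff)
  obtain h r' s' x' y' where h: "h \<in> ker" "h (herm_omat r s 0 0 0 z) = herm_omat r' s' 0 x' y' 0"
    "x' = 0 \<and> y' = 0" "\<And>v. h (herm_omat 0 0 v 0 0 0) = herm_omat 0 0 v 0 0 0"
    by (rule kill_z[of r s 0 0 0 z]) simp
  define \<beta> where "\<beta> = h \<circ> \<alpha>"
  have \<beta>: "\<beta> \<in> F4" unfolding \<beta>_def by (rule F4_comp[OF ker_F4[OF h(1)] \<alpha>])
  have \<beta>2: "\<beta> (herm_omat 0 1 0 0 0 0) = herm_omat r' s' 0 0 0 0"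
    and \<beta>3: "\<beta> (herm_omat 0 0 1 0 0 0) = herm_omat 0 0 1 0 0 0"
    using h by (simp_all add: \<beta>_def B 0 \<alpha>3)
  have "jordan_prod (\<beta> (herm_omat 0 1 0 0 0 0)) (\<beta> (herm_omat 0 1 0 0 0 0)) = \<beta> (herm_omat 0 1 0 0 0
      0)"
    using F4_jordan_prod[OF \<beta> in3 in3, of 0 1 0 0 0 0 0 1 0 0 0 0] by (simp add: jordan_prod_herm)
  then have rs: "r' = 0 \<or> r' = 1" "s' = 0 \<or> s' = 1"
    by (auto simp: \<beta>2 jordan_prod_herm)
  have "\<not> (r' = 0 \<and> s' = 0)"
    using F4_eq_0_iff[OF \<beta> in3, of 0 1 0 0 0 0] by (auto simp: \<beta>2 herm_omat_eq_0_iff)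
  moreover have "\<not> (r' = 1 \<and> s' = 1)"
  proof
    assume "r' = 1 \<and> s' = 1"
    then have "\<beta> (herm_omat 0 1 1 0 0 0) = omat_id"
      using F4_add[OF \<beta> in3 in3, of 0 1 0 0 0 0 0 0 1 0 0 0]
      by (simp add: \<beta>2 \<beta>3 herm_omat_add omat_id_eq)
    with F4_inj[OF \<beta> in3 omat_id_in_jordan3, of 0 1 1 0 0 0] F4_id[OF \<beta>]
    show False by (simp add: omat_id_eq)
  qed
  ultimately have "(r', s') = (0, 1) \<or> (r', s') = (1, 0)"
    using rs by auto
  then show thesis
  proof
    assume "(r', s') = (0, 1)"
    then show thesis using h \<beta>2 by (intro that[of h]) (auto simp: \<beta>_def)
  next
    assume *: "(r', s') = (1, 0)"
    show thesis
    \<comment> \<open>A quarter turn exchanges the first two diagonal idempotents.\<close>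
    proof (rule that[of "ortho_conj (rot12 (pi/2)) \<circ> h"])
      show "ortho_conj (rot12 (pi/2)) \<circ> h \<in> ker" by (intro ker_comp rot_ker h)
    qed (use * h \<beta>2 in \<open>auto simp: \<beta>_def ortho_conj_rot12\<close>)
  qed
qed

text \<open>Only the effect on x is recorded; y and z are dealt with at the end, by
  \<open>trivial_of_fixing\<close>.\<close>

lemma double_reflection:
  fixes v w :: "real oct"
  assumes "oct_norm2 v = 1" "oct_norm2 w = 1"
  obtains g where "g \<in> ker"
    "\<And>r s t x y z. \<exists>y' z'. g (herm_omat r s t x y z) =
      herm_omat r s t (x - (2 * (x \<bullet> v)) *\<^sub>R v - (2 * ((x - (2 * (x \<bullet> v)) *\<^sub>R v) \<bullet> w)) *\<^sub>R w) y' z'"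
    "g (herm_omat 0 1 0 0 0 0) = herm_omat 0 1 0 0 0 0"
    "g (herm_omat 0 0 1 0 0 0) = herm_omat 0 0 1 0 0 0"
proof (rule that[of "unit_oct_action w \<circ> unit_oct_action (oct_conj v)"])
  show "unit_oct_action w \<circ> unit_oct_action (oct_conj v) \<in> ker"
    using assms by (intro ker_comp unit_oct_action_ker) auto
qed (use oct_double_reflect[OF assms] in \<open>auto simp: unit_oct_action_herm simp del:
    split_paired_Ex\<close>)

definition e7 :: "real oct" where "e7 = ((0,0,0,0),(0,0,0,1))"

lemma e7_Basis: "e7 \<in> Basis"
  by (simp add: e7_def Basis_prod_def image_iff zero_prod_def)

text \<open>Each basis vector is moved back by a reflection. Only products of two reflections are
  available, so each of them is paired with the reflection in \<open>e7\<close>, which is why \<open>e7\<close> itself is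
  left out.\<close>

lemma peirce_fix:
  assumes \<alpha>: "\<alpha> \<in> F4" "\<alpha> (herm_omat 0 1 0 0 0 0) = herm_omat 0 1 0 0 0 0"
    "\<alpha> (herm_omat 0 0 1 0 0 0) = herm_omat 0 0 1 0 0 0"
    and S: "S \<subseteq> Basis - {e7}"
  obtains g where "g \<in> ker" "g (\<alpha> (herm_omat 0 1 0 0 0 0)) = herm_omat 0 1 0 0 0 0"
    "g (\<alpha> (herm_omat 0 0 1 0 0 0)) = herm_omat 0 0 1 0 0 0"
    "\<And>x. x \<in> S \<Longrightarrow> g (\<alpha> (herm_omat 0 0 0 x 0 0)) = herm_omat 0 0 0 x 0 0"
proof -
  have "finite S" by (rule finite_subset[OF S]) simp
  then have "\<exists>g\<in>ker. g (\<alpha> (herm_omat 0 1 0 0 0 0)) = herm_omat 0 1 0 0 0 0 \<and>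
    g (\<alpha> (herm_omat 0 0 1 0 0 0)) = herm_omat 0 0 1 0 0 0 \<and>
    (\<forall>x\<in>S. g (\<alpha> (herm_omat 0 0 0 x 0 0)) = herm_omat 0 0 0 x 0 0)"
    using S
  proof (induction S)
    case empty
    show ?case using \<alpha> id_ker by (intro bexI[of _ id]) auto
  next
    case (insert e S)
    then obtain g where g: "g \<in> ker" "g (\<alpha> (herm_omat 0 1 0 0 0 0)) = herm_omat 0 1 0 0 0 0"
      "g (\<alpha> (herm_omat 0 0 1 0 0 0)) = herm_omat 0 0 1 0 0 0"
      "\<And>x. x \<in> S \<Longrightarrow> g (\<alpha> (herm_omat 0 0 0 x 0 0)) = herm_omat 0 0 0 x 0 0"
      by auto
    define \<beta> where "\<beta> = g \<circ> \<alpha>"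
    have \<beta>: "\<beta> \<in> F4" unfolding \<beta>_def by (rule F4_comp[OF ker_F4[OF g(1)] \<alpha>(1)])
    obtain a b c' where abc: "\<And>r s t x y z. \<beta> (herm_omat r s t x y z) = herm_omat r s t (a x) (b y)
        (c' z)"
      "linear a" "linear b" "linear c'" "\<And>x. a x \<bullet> a x = x \<bullet> x"
      by (rule F4_peirce[OF \<beta>]) (use g in \<open>auto simp: \<beta>_def\<close>)
    have aS: "a x = x" if "x \<in> S" for x
      using g(4)[OF that] abc(1)[of 0 0 0 x 0 0] by (simp add: \<beta>_def)
    have ai: "a x \<bullet> a y = x \<bullet> y" for x y
      using abc(5)[of "x + y"] abc(5)[of x] abc(5)[of y]
      by (simp add: linear_add[OF abc(2)] inner_add_left inner_add_right inner_commute)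
    show ?case
    proof (cases "a e = e")
      case True
      then show ?thesis using g abc(1)[of 0 0 0 e 0 0] linear_0[OF abc(3)] linear_0[OF abc(4)]
        by (intro bexI[of _ g]) (auto simp: \<beta>_def)
    next
      case False
      \<comment> \<open>The normal of the mirror that exchanges \<open>a e\<close> and
        \<open>e\<close>. Since a is an isometry fixing S pointwise, v is orthogonal to S, so the
        vectors already fixed stay fixed.\<close>
      define v where "v = (1 / norm (a e - e)) *\<^sub>R (a e - e)"
      have nv: "norm v = 1" using False by (simp add: v_def)
      have ee: "e \<bullet> e = 1" using insert.prems by (auto simp: inner_Basis)
      have vS: "x \<bullet> v = 0" if "x \<in> S" for x
      proof -
        have "x \<bullet> a e = x \<bullet> e" using ai[of x e] aS[OF that] by simp
        then show ?thesis by (simp add: v_def inner_diff_right)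
      qed
      have ve: "a e - (2 * (a e \<bullet> v)) *\<^sub>R v = e"
      proof -
        have n2: "(norm (a e - e))\<^sup>2 = 2 * (1 - a e \<bullet> e)"
          by (simp add: power2_norm_eq_inner inner_diff_left inner_diff_right abc(5) ee
              inner_commute)
        have nz: "(norm (a e - e))\<^sup>2 \<noteq> 0" using False by simp
        have "2 * (a e \<bullet> v) / norm (a e - e) = 2 * (1 - a e \<bullet> e) / (norm (a e - e))\<^sup>2"
          by (simp add: v_def inner_diff_right abc(5) ee power2_eq_square)
        also have "\<dots> = 1" using n2 nz by simp
        finally have *: "2 * (a e \<bullet> v) / norm (a e - e) = 1" .
        have "(2 * (a e \<bullet> v)) *\<^sub>R v = (2 * (a e \<bullet> v) / norm (a e - e)) *\<^sub>R (a e - e)"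
          by (simp add: v_def)
        then show ?thesis unfolding * by simp
      qed
      have e7: "x \<bullet> e7 = 0" if "x \<in> insert e S" for x
      proof -
        have "x \<in> Basis" "x \<noteq> e7" using insert.prems that by auto
        then show ?thesis using e7_Basis by (simp add: inner_Basis)
      qed
      have "oct_norm2 v = 1" "oct_norm2 e7 = 1"
        using nv e7_Basis by (simp_all add: oct_norm2_inner inner_Basis norm_eq_1)
      then obtain h where h: "h \<in> ker"
        "\<And>r s t x y z. \<exists>y' z'. h (herm_omat r s t x y z) =
          herm_omat r s t (x - (2 * (x \<bullet> v)) *\<^sub>R v - (2 * ((x - (2 * (x \<bullet> v)) *\<^sub>R v) \<bullet> e7)) *\<^sub>R e7)
              y' z'"
        "h (herm_omat 0 1 0 0 0 0) = herm_omat 0 1 0 0 0 0"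
        "h (herm_omat 0 0 1 0 0 0) = herm_omat 0 0 1 0 0 0"
        by (rule double_reflection) blast
      have hk: "h \<circ> g \<in> ker" by (rule ker_comp[OF h(1) g(1)])
      have h\<beta>: "h \<circ> \<beta> \<in> F4" by (rule F4_comp[OF ker_F4[OF h(1)] \<beta>])
      have h2: "(h \<circ> \<beta>) (herm_omat 0 1 0 0 0 0) = herm_omat 0 1 0 0 0 0"
        and h3: "(h \<circ> \<beta>) (herm_omat 0 0 1 0 0 0) = herm_omat 0 0 1 0 0 0"
        using g h by (simp_all add: \<beta>_def)
      obtain a' b' c'' where abc': "\<And>r s t x y z. (h \<circ> \<beta>) (herm_omat r s t x y z) =
          herm_omat r s t (a' x) (b' y) (c'' z)"
        and lin': "linear a'" "linear b'" "linear c''"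
        using F4_peirce[OF h\<beta> h2 h3] by metis
      have fixed: "(h \<circ> \<beta>) (herm_omat 0 0 0 x 0 0) = herm_omat 0 0 0 x 0 0" if "x \<in> insert e S"
          for x
      proof -
        have "a x - (2 * (a x \<bullet> v)) *\<^sub>R v = x"
          using that ve vS[of x] aS[of x] by auto
        with h(2)[of 0 0 0 "a x" 0 0] e7[OF that] have "(h \<circ> \<beta>) (herm_omat 0 0 0 x 0 0) $ 2 $ 3 = x"
          using linear_0[OF abc(3)] linear_0[OF abc(4)] by (auto simp: abc(1))
        then show ?thesis by (simp add: abc' linear_0 lin' del: o_apply)
      qed
      show ?thesis
        using hk h2 h3 fixed by (intro bexI[of _ "h \<circ> g"]) (auto simp: \<beta>_def)
    qed
  qed
  with that show thesis by blast
qed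

text \<open>The action on the entries is \<open>(x, y, z) \<mapsto> (a x, b y, c' z)\<close> with \<open>b x = (a x) u\<close> and
  \<open>(a x) ((a y) u) = (a (x y)) u\<close>. This makes \<open>u\<close> associate with enough basis vectors to be
  real, and then rules out that \<open>a\<close> is the reflection in \<open>e7\<close>.\<close>

lemma trivial_of_fixing:
  assumes \<alpha>: "\<alpha> \<in> F4" and \<alpha>2: "\<alpha> (herm_omat 0 1 0 0 0 0) = herm_omat 0 1 0 0 0 0"
    and \<alpha>3: "\<alpha> (herm_omat 0 0 1 0 0 0) = herm_omat 0 0 1 0 0 0"
    and fixed: "\<And>x. x \<in> Basis - {e7} \<Longrightarrow> \<alpha> (herm_omat 0 0 0 x 0 0) = herm_omat 0 0 0 x 0 0"
  shows "c \<alpha> = 1"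
proof -
  obtain a b c' where abc: "\<And>r s t x y z. \<alpha> (herm_omat r s t x y z) = herm_omat r s t (a x) (b y)
      (c' z)"
    and lin: "linear a" "linear b" "linear c'" and iso: "\<And>x. a x \<bullet> a x = x \<bullet> x"
    and prod: "\<And>x y. oct_mult (a x) (b y) = oct_conj (c' (oct_conj (oct_mult x y)))"
    using F4_peirce[OF \<alpha> \<alpha>2 \<alpha>3] by metis
  have ai: "a x \<bullet> a y = x \<bullet> y" for x y
    using iso[of "x + y"] iso[of x] iso[of y]
    by (simp add: linear_add[OF lin(1)] inner_add_left inner_add_right inner_commute)
  have a_Basis: "a x = x" if "x \<in> Basis - {e7}" for x
    using fixed[OF that] abc[of 0 0 0 x 0 0] by simp
  \<comment> \<open>An isometry fixing the orthogonal complement of \<open>e7\<close> pointwise can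
    only multiply \<open>e7\<close> by a sign.\<close>
  define \<epsilon> where "\<epsilon> = a e7 \<bullet> e7"
  have a7: "a e7 = \<epsilon> *\<^sub>R e7"
  proof (rule euclidean_eqI)
    fix x :: "real oct" assume x: "x \<in> Basis"
    show "a e7 \<bullet> x = \<epsilon> *\<^sub>R e7 \<bullet> x"
      using x e7_Basis a_Basis[of x] ai[of e7 x] by (cases "x = e7") (auto simp: \<epsilon>_def inner_Basis)
  qed
  have "\<epsilon> * \<epsilon> = 1"
    using iso[of e7] e7_Basis by (simp add: a7 inner_Basis)
  then have \<epsilon>: "\<epsilon> = 1 \<or> \<epsilon> = -1" by (metis square_eq_1_iff)
  have a_eq: "a x = x - ((1 - \<epsilon>) * (x \<bullet> e7)) *\<^sub>R e7" for x
  proof -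
    have l: "linear (\<lambda>x. x - ((1 - \<epsilon>) * (x \<bullet> e7)) *\<^sub>R e7)"
      by (rule linearI) (simp_all add: inner_add_left algebra_simps)
    show ?thesis
      by (rule linear_eq_stdbasis[OF lin(1) l, THEN fun_cong])
        (use a_Basis a7 e7_Basis in \<open>auto simp: inner_Basis algebra_simps\<close>)
  qed
  have a8: "a ((a0,a1,a2,a3),(a4,a5,a6,a7)) = ((a0,a1,a2,a3),(a4,a5,a6,\<epsilon> * a7))"
    for a0 a1 a2 a3 a4 a5 a6 a7
    by (simp add: a_eq e7_def inner_prod_def algebra_simps)
  have one: "oct_scalar (1 :: real) = ((1,0,0,0),(0,0,0,0))"
    by (simp add: oct_scalar_eq)
  define u where "u = b (oct_scalar 1)"
  \<comment> \<open>The triality relation at x = 1, where a 1 = 1.\<close>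
  have c'b: "oct_conj (c' (oct_conj y)) = b y" for y
    using prod[of "oct_scalar 1" y] a8[of 1 0 0 0 0 0 0 0] by (simp flip: one)
  have bu: "b x = oct_mult (a x) u" for x
    using prod[of x "oct_scalar 1"] by (simp add: c'b u_def)
  have assoc: "oct_mult (a x) (oct_mult (a y) u) = oct_mult (a (oct_mult x y)) u" for x y
    using prod[of x y] by (simp add: c'b bu)
  have u_real: "u = oct_scalar (oct_re u)"
    using assoc[of "((0,1,0,0),(0,0,0,0))" "((0,0,1,0),(0,0,0,0))"]
      assoc[of "((0,1,0,0),(0,0,0,0))" "((0,0,0,0),(1,0,0,0))"]
      assoc[of "((0,0,1,0),(0,0,0,0))" "((0,0,0,0),(1,0,0,0))"]
    by (intro oct_real_of_associating) (simp_all add: a8 zero_prod_def)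
  define \<mu> where "\<mu> = oct_re u"
  have bmu: "b x = \<mu> *\<^sub>R a x" for x
    unfolding bu by (subst u_real) (simp add: \<mu>_def oct_scaleR)
  have cmu: "c' z = oct_conj (b (oct_conj z))" for z
    using c'b[of "oct_conj z"] by (metis oct_conj_conj)
  have mu0: "\<mu> \<noteq> 0"
  proof
    assume "\<mu> = 0"
    then have "\<alpha> (herm_omat 0 0 0 0 e7 0) = 0"
      by (simp add: abc bmu cmu linear_0 lin herm_omat_0)
    then show False
      using F4_eq_0_iff[OF \<alpha> herm_omat_in_jordan3, of 0 0 0 0 e7 0] e7_Basis
      by (auto simp: herm_omat_eq_0_iff)
  qed
  \<comment> \<open>The product of e_1 and e_6 is -e_7. With u real and nonzero,
    \<open>assoc\<close> says that a is multiplicative on this pair, and a fixes both factors, so it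
    fixes e_7 as well.\<close>
  have "\<epsilon> = 1"
    using assoc[of "((0,1,0,0),(0,0,0,0))" "((0,0,0,0),(0,0,1,0))"] mu0 \<epsilon>
    by (subst (asm) (1 2) u_real) (auto simp: a8 oct_scaleR \<mu>_def zero_prod_def)
  then have aid: "a x = x" for x by (simp add: a_eq)
  have \<alpha>_eq: "\<alpha> (herm_omat r s t x y z) = herm_omat r s t x (oct_smult \<mu> y) (oct_smult \<mu> z)"
      for r s t x y z
    by (simp add: abc aid bmu cmu oct_scaleR)
  have "\<mu> * \<mu> = 1"
  proof -
    have "jordan_prod (herm_omat 0 0 0 0 e7 0) (herm_omat 0 0 0 0 e7 0) = herm_omat 1 0 1 0 0 0"
      using e7_Basis by (simp add: jordan_prod_herm inner_Basis)
    from arg_cong[OF this, of \<alpha>] show ?thesis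
      using e7_Basis by (simp add: F4_jordan_prod[OF \<alpha>] \<alpha>_eq)
        (simp add: jordan_prod_herm inner_Basis flip: oct_scaleR)
  qed
  then have "\<mu> = 1 \<or> \<mu> = -1" by (metis square_eq_1_iff)
  then show ?thesis
  proof
    assume "\<mu> = 1"
    then have "c \<alpha> = c id"
      by (intro cong \<alpha> id_in_F4) (auto elim!: jordan3_cases simp: \<alpha>_eq)
    then show ?thesis by (simp add: id_eq_1)
  next
    \<comment> \<open>Changing the signs of y and z while keeping x is the action of the unit
      octonion -1.\<close>
    assume m: "\<mu> = -1"
    have n: "oct_norm2 (oct_scalar (-1) :: real oct) = 1" by (simp add: oct_scalar_eq)
    have "c \<alpha> = c (unit_oct_action (oct_scalar (-1)))"
      by (intro cong \<alpha> unit_oct_action_in_F4 n) (auto elim!: jordan3_cases simp: \<alpha>_eq m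
          unit_oct_action_herm)
    then show ?thesis by (simp add: unit_oct_action_eq_1 n)
  qed
qed

theorem trivial:
  assumes \<alpha>: "\<alpha> \<in> F4"
  shows "c \<alpha> = 1"
proof -
  obtain g where g: "g \<in> ker" "g (\<alpha> (herm_omat 0 0 1 0 0 0)) = herm_omat 0 0 1 0 0 0"
    by (rule F4_fixing_E3[OF \<alpha>])
  have g\<alpha>: "g \<circ> \<alpha> \<in> F4" by (rule F4_comp[OF ker_F4[OF g(1)] \<alpha>])
  obtain h where h: "h \<in> ker" "h ((g \<circ> \<alpha>) (herm_omat 0 1 0 0 0 0)) = herm_omat 0 1 0 0 0 0"
    "h (herm_omat 0 0 1 0 0 0) = herm_omat 0 0 1 0 0 0"
    by (rule F4_fixing_E2[OF g\<alpha>]) (use g in auto)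
  have h\<alpha>: "h \<circ> (g \<circ> \<alpha>) \<in> F4" by (rule F4_comp[OF ker_F4[OF h(1)] g\<alpha>])
  have h2: "(h \<circ> (g \<circ> \<alpha>)) (herm_omat 0 1 0 0 0 0) = herm_omat 0 1 0 0 0 0"
    and h3: "(h \<circ> (g \<circ> \<alpha>)) (herm_omat 0 0 1 0 0 0) = herm_omat 0 0 1 0 0 0"
    using g h by simp_all
  obtain k where k: "k \<in> ker" "k ((h \<circ> (g \<circ> \<alpha>)) (herm_omat 0 1 0 0 0 0)) = herm_omat 0 1 0 0 0 0"
    "k ((h \<circ> (g \<circ> \<alpha>)) (herm_omat 0 0 1 0 0 0)) = herm_omat 0 0 1 0 0 0"
    "\<And>x. x \<in> Basis - {e7} \<Longrightarrow> k ((h \<circ> (g \<circ> \<alpha>)) (herm_omat 0 0 0 x 0 0)) = herm_omat 0 0 0 x 0 0"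
    by (rule peirce_fix[OF h\<alpha> h2 h3 order_refl]) blast
  have "c (k \<circ> (h \<circ> (g \<circ> \<alpha>))) = 1"
    by (rule trivial_of_fixing) (use k F4_comp[OF ker_F4[OF k(1)] h\<alpha>] in auto)
  then show ?thesis
    using ker_comp_iff[OF k(1) h\<alpha>] ker_comp_iff[OF h(1) g\<alpha>] ker_comp_iff[OF g(1) \<alpha>] by simp
qed

end

section \<open>Matrix coordinates on \<open>\<bbbX>\<^sub>\<bbbO>\<close>\<close>

text \<open>The inverse of \<open>quat_matrix\<close>. In these coordinates multiplication is the
  matrix product, conjugation the adjugate and the norm the determinant.\<close>

definition mat_quat :: "complex \<Rightarrow> complex \<Rightarrow> complex \<Rightarrow> complex \<Rightarrow> complex quat"
  where "mat_quat m1 m2 m3 m4 =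
    ((m1 + m4) / 2, - \<i> * (m1 - m4) / 2, (m2 - m3) / 2, - \<i> * (m2 + m3) / 2)"

definition mat_oct where "mat_oct m1 m2 m3 m4 n1 n2 n3 n4 = (mat_quat m1 m2 m3 m4, mat_quat n1 n2 n3
    n4)"

lemma quat_matrix_mat_quat [simp]:
  "quat_matrix (mat_quat m1 m2 m3 m4) = vector [vector [m1, m2], vector [m3, m4]]"
  by (simp add: mat_quat_def vec_eq_iff forall_2 vector_2 algebra_simps
      add_divide_distrib[symmetric] diff_divide_distrib[symmetric])

lemma mat_quat_cases: obtains m1 m2 m3 m4 where "q = mat_quat m1 m2 m3 m4"
proof -
  obtain h0 h1 h2 h3 where q: "q = (h0, h1, h2, h3)" by (metis surj_pair)
  show thesis
    by (rule that[of "h0 + \<i> * h1" "h2 + \<i> * h3" "- h2 + \<i> * h3" "h0 - \<i> * h1"])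
      (simp add: q mat_quat_def algebra_simps)
qed

lemma mat_oct_cases: obtains m1 m2 m3 m4 n1 n2 n3 n4 where "x = mat_oct m1 m2 m3 m4 n1 n2 n3 n4"
  unfolding mat_oct_def by (metis mat_quat_cases surj_pair)

lemma mat_quat_inject [simp]:
  "mat_quat m1 m2 m3 m4 = mat_quat n1 n2 n3 n4 \<longleftrightarrow> m1 = n1 \<and> m2 = n2 \<and> m3 = n3 \<and> m4 = n4"
proof
  assume "mat_quat m1 m2 m3 m4 = mat_quat n1 n2 n3 n4"
  from arg_cong[OF this, of quat_matrix] show "m1 = n1 \<and> m2 = n2 \<and> m3 = n3 \<and> m4 = n4"
    by (simp add: vec_eq_iff forall_2 vector_2)
qed simp

lemma mat_quat_mult: "quat_mult (mat_quat m1 m2 m3 m4) (mat_quat n1 n2 n3 n4) =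
    mat_quat (m1 * n1 + m2 * n3) (m1 * n2 + m2 * n4) (m3 * n1 + m4 * n3) (m3 * n2 + m4 * n4)"
  by (simp add: mat_quat_def field_simps)

lemma mat_quat_conj: "quat_conj (mat_quat m1 m2 m3 m4) = mat_quat m4 (- m2) (- m3) m1"
  by (simp add: mat_quat_def field_simps)

lemma mat_quat_add: "mat_quat m1 m2 m3 m4 + mat_quat n1 n2 n3 n4 = mat_quat (m1 + n1) (m2 +
    n2) (m3 + n3) (m4 + n4)"
  and mat_quat_diff: "mat_quat m1 m2 m3 m4 - mat_quat n1 n2 n3 n4 = mat_quat (m1 - n1) (m2 - n2) (m3
      - n3) (m4 - n4)"
  and mat_quat_minus: "- mat_quat n1 n2 n3 n4 = mat_quat (- n1) (- n2) (- n3) (- n4)"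
  by (simp_all add: mat_quat_def field_simps)

lemma mat_oct_inject [simp]:
  "mat_oct m1 m2 m3 m4 n1 n2 n3 n4 = mat_oct p1 p2 p3 p4 q1 q2 q3 q4 \<longleftrightarrow>
    m1 = p1 \<and> m2 = p2 \<and> m3 = p3 \<and> m4 = p4 \<and> n1 = q1 \<and> n2 = q2 \<and> n3 = q3 \<and> n4 = q4"
  by (auto simp: mat_oct_def)

lemma mat_oct_mult: "oct_mult (mat_oct m1 m2 m3 m4 n1 n2 n3 n4) (mat_oct p1 p2 p3 p4 q1 q2 q3 q4) =
    mat_oct (m1 * p1 + m2 * p3 - (q4 * n1 - q2 * n3)) (m1 * p2 + m2 * p4 - (q4 * n2 - q2 * n4))
     (m3 * p1 + m4 * p3 - (q1 * n3 - q3 * n1)) (m3 * p2 + m4 * p4 - (q1 * n4 - q3 * n2))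
     (q1 * m1 + q2 * m3 + (n1 * p4 - n2 * p3)) (q1 * m2 + q2 * m4 + (n2 * p1 - n1 * p2))
     (q3 * m1 + q4 * m3 + (n3 * p4 - n4 * p3)) (q3 * m2 + q4 * m4 + (n4 * p1 - n3 * p2))"
  by (simp add: mat_oct_def mat_quat_mult mat_quat_conj mat_quat_add mat_quat_diff)

lemma mat_oct_conj: "oct_conj (mat_oct m1 m2 m3 m4 n1 n2 n3 n4) =
    mat_oct m4 (- m2) (- m3) m1 (- n1) (- n2) (- n3) (- n4)"
  by (simp add: mat_oct_def mat_quat_conj mat_quat_minus)

lemma mat_oct_smult: "oct_smult r (mat_oct m1 m2 m3 m4 n1 n2 n3 n4) =
    mat_oct (r * m1) (r * m2) (r * m3) (r * m4) (r * n1) (r * n2) (r * n3) (r * n4)"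
  by (simp add: mat_oct_def mat_quat_def field_simps)

lemma mat_oct_norm2: "oct_norm2 (mat_oct m1 m2 m3 m4 n1 n2 n3 n4) = m1 * m4 - m2 * m3 +
    (n1 * n4 - n2 * n3)"
  by (simp add: mat_oct_def mat_quat_def field_simps)

lemma oct_smult_eq_0_iff: "oct_smult r x = 0 \<longleftrightarrow> r = 0 \<or> x = (0 :: 'a::idom oct)"
  by (cases x rule: oct_cases) (auto simp: zero_prod_def)

text \<open>A^2 = 0 directly gives the product relations only with -(b + c), -(a + c), -(a + b) in
  place of a, b, c. Cancelling z yields N(y) = (b + c)(a + b) and N(x) = (a + c)(a + b), and then
  the last diagonal entry of A^2 becomes (a + b + c)^2. So the trace vanishes and the relations take
  their rank-one form.\<close>

lemma jordan_null_relations: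
  assumes sq: "omat_mult (herm_omat a b c x y z) (herm_omat a b c x y z) = 0"
    and z: "z \<noteq> (0 :: complex oct)"
  shows "a + b + c = 0" "oct_mult y z = oct_smult a (oct_conj x)"
    "oct_mult z x = oct_smult b (oct_conj y)" "oct_mult x y = oct_smult c (oct_conj z)"
    "oct_norm2 x = b * c" "oct_norm2 y = a * c" "oct_norm2 z = a * b"
proof -
  from sq have d: "a * a + oct_norm2 z + oct_norm2 y = 0" "b * b + oct_norm2 z + oct_norm2 x = 0"
      "c * c + oct_norm2 x + oct_norm2 y = 0"
    and o: "oct_smult (b + c) x + oct_conj (oct_mult y z) = 0"
      "oct_smult (a + c) y + oct_conj (oct_mult z x) = 0"
      "oct_smult (a + b) z + oct_conj (oct_mult x y) = 0"
    by (simp_all add: omat_mult_herm_square herm_omat_eq_0_iff)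
  have neg: "v = oct_smult (- r) (oct_conj w)" if "oct_smult r w + oct_conj v = 0" for r and v w ::
      "complex oct"
    using that by (cases w rule: oct_cases, cases v rule: oct_cases)
      (auto simp: zero_prod_def neg_eq_iff_add_eq_0 eq_neg_iff_add_eq_0 add.commute)
  have yz: "oct_mult y z = oct_smult (- (b + c)) (oct_conj x)"
    and zx: "oct_mult z x = oct_smult (- (a + c)) (oct_conj y)"
    and xy: "oct_mult x y = oct_smult (- (a + b)) (oct_conj z)"
    using o by (intro neg; simp)+
  have "oct_smult (oct_norm2 y) z = oct_mult (oct_conj y) (oct_mult y z)"
    by (simp add: oct_mult_conj_cancel_left)
  also have "\<dots> = oct_smult (- (b + c)) (oct_conj (oct_mult x y))"
    by (simp add: yz oct_mult_smult_right oct_conj_mult)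
  also have "\<dots> = oct_smult ((b + c) * (a + b)) z"
    by (simp only: xy oct_conj_smult oct_conj_conj oct_smult_smult minus_mult_minus)
  finally have "oct_norm2 y = (b + c) * (a + b)"
    using z oct_smult_eq_0_iff[of "oct_norm2 y - (b + c) * (a + b)" z]
      oct_smult_add_left[of "oct_norm2 y - (b + c) * (a + b)" "(b + c) * (a + b)" z] by simp
  note ny = this
  have "oct_smult (oct_norm2 x) z = oct_mult (oct_mult z x) (oct_conj x)"
    by (simp add: oct_mult_conj_cancel_right)
  also have "\<dots> = oct_smult (- (a + c)) (oct_conj (oct_mult x y))"
    by (simp add: zx oct_mult_smult_left oct_conj_mult)
  also have "\<dots> = oct_smult ((a + c) * (a + b)) z"
    by (simp only: xy oct_conj_smult oct_conj_conj oct_smult_smult minus_mult_minus)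
  finally have "oct_norm2 x = (a + c) * (a + b)"
    using z oct_smult_eq_0_iff[of "oct_norm2 x - (a + c) * (a + b)" z]
      oct_smult_add_left[of "oct_norm2 x - (a + c) * (a + b)" "(a + c) * (a + b)" z] by simp
  note n = ny this
  have "(a + b + c) * (a + b + c) = 0"
    using d(3) unfolding n by algebra
  then show t: "a + b + c = 0" by simp
  then have s: "- (b + c) = a" "- (a + c) = b" "- (a + b) = c"
    by (simp_all add: algebra_simps eq_neg_iff_add_eq_0 neg_eq_iff_add_eq_0)
  show "oct_mult y z = oct_smult a (oct_conj x)" "oct_mult z x = oct_smult b (oct_conj y)"
    "oct_mult x y = oct_smult c (oct_conj z)"
    using yz zx xy unfolding s .
  show "oct_norm2 x = b * c" "oct_norm2 y = a * c" "oct_norm2 z = a * b"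
    using n d t by algebra+
qed

lemma jordan_null_of_relations:
  assumes "a + b + c = 0" "oct_mult y z = oct_smult a (oct_conj x)"
    "oct_mult z x = oct_smult b (oct_conj y)" "oct_mult x y = oct_smult c (oct_conj z)"
    "oct_norm2 x = b * c" "oct_norm2 y = a * c" "oct_norm2 z = a * (b :: 'a::idom)"
  shows "omat_mult (herm_omat a b c x y z) (herm_omat a b c x y z) = 0"
proof -
  have "a * a + a * b + a * c = 0" "b * b + a * b + b * c = 0" "c * c + b * c + a * c = 0"
    "b + c + a = 0" "a + c + b = 0"
    using assms(1) by algebra+
  with assms show ?thesis
    by (simp add: omat_mult_herm_square herm_omat_eq_0_iff flip: oct_smult_add_left)
qed

lemma z1_herm: "z1 (herm_omat a b c x y (mat_oct m1 m2 m3 m4 n1 n2 n3 n4)) = m1"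
  by (simp add: z1_def mat_oct_def vector_2)

text \<open>The eleven dependent entries solve the components of \<open>z x = \<xi>\<^sub>2 \<theta>(y)\<close>, \<open>y z = \<xi>\<^sub>1 \<theta>(x)\<close>,
  \<open>x y = \<xi>\<^sub>3 \<theta>(z)\<close> and \<open>N(z) = \<xi>\<^sub>1 \<xi>\<^sub>2\<close> in which they are multiplied by \<open>z\<^sub>1\<close> (called \<open>s1\<close>
  here), together with \<open>\<xi>\<^sub>1 + \<xi>\<^sub>2 + \<xi>\<^sub>3 = 0\<close>.\<close>

definition param :: "complex \<Rightarrow> complex \<Rightarrow> complex \<Rightarrow> complex \<Rightarrow> complex \<Rightarrow> complex \<Rightarrow> complex \<Rightarrow> complex \<Rightarrow>
    complex \<Rightarrow> complex \<Rightarrow> complex \<Rightarrow> complex \<Rightarrow> complex \<Rightarrow> complex \<Rightarrow> complex \<Rightarrow> complex \<Rightarrow> complex omat"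
  where "param \<xi>2 s1 z2 z3 w1 w2 w3 w4 y2 y4 v1 v3 x3 x4 u2 u4 =
   (let i = inverse s1;
      \<xi>3 = (x3 * y2 + x4 * y4 + v3 * u2 - v1 * u4) * i;
      \<xi>1 = - \<xi>2 - \<xi>3;
      z4 = (\<xi>1 * \<xi>2 + z2 * z3 - w1 * w4 + w2 * w3) * i;
      x1 = (\<xi>2 * y4 - z2 * x3 + u4 * w1 - u2 * w3) * i;
      x2 = (u4 * w2 - u2 * w4 - z2 * x4 - \<xi>2 * y2) * i;
      u1 = (w2 * x3 - w1 * x4 - u2 * z3 - \<xi>2 * v1) * i;
      u3 = (w4 * x3 - w3 * x4 - u4 * z3 - \<xi>2 * v3) * i;
      y1 = (\<xi>1 * x4 - y2 * z3 + w4 * v1 - w2 * v3) * i;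
      y3 = (w1 * v3 - w3 * v1 - y4 * z3 - \<xi>1 * x3) * i;
      v2 = (v1 * z2 - w1 * y2 - w2 * y4 - \<xi>1 * u2) * i;
      v4 = (v3 * z2 - w3 * y2 - w4 * y4 - \<xi>1 * u4) * i
    in herm_omat \<xi>1 \<xi>2 \<xi>3 (mat_oct x1 x2 x3 x4 u1 u2 u3 u4) (mat_oct y1 y2 y3 y4 v1 v2 v3 v4)
        (mat_oct s1 z2 z3 z4 w1 w2 w3 w4))"

lemma param_null:
  assumes "s1 \<noteq> 0"
  shows "omat_mult (param \<xi>2 s1 z2 z3 w1 w2 w3 w4 y2 y4 v1 v3 x3 x4 u2 u4)
    (param \<xi>2 s1 z2 z3 w1 w2 w3 w4 y2 y4 v1 v3 x3 x4 u2 u4) = 0"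
proof -
  \<comment> \<open>Treating 1/s1 as a variable i subject to s1 i = 1 makes all the identities
    polynomial.\<close>
  define i where "i = inverse s1"
  have i: "s1 * i = 1" using assms by (simp add: i_def)
  show ?thesis
    unfolding param_def i_def[symmetric] Let_def
    apply (rule jordan_null_of_relations)
    unfolding mat_oct_mult mat_oct_conj mat_oct_smult mat_oct_norm2 mat_oct_inject
    by (((intro conjI)?; (algebra | (insert i, algebra)))+)
qed

lemma X_O_eq_param:
  assumes "omat_mult (herm_omat \<xi>1 \<xi>2 \<xi>3 x y z) (herm_omat \<xi>1 \<xi>2 \<xi>3 x y z) = 0"
    "x = mat_oct x1 x2 x3 x4 u1 u2 u3 u4" "y = mat_oct y1 y2 y3 y4 v1 v2 v3 v4"
    "z = mat_oct s1 z2 z3 z4 w1 w2 w3 w4" "s1 \<noteq> 0"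
  shows "herm_omat \<xi>1 \<xi>2 \<xi>3 x y z = param \<xi>2 s1 z2 z3 w1 w2 w3 w4 y2 y4 v1 v3 x3 x4 u2 u4"
proof -
  have "z \<noteq> mat_oct 0 0 0 0 0 0 0 0"
    using assms by simp
  then have z0: "z \<noteq> 0"
    by (simp add: mat_oct_def mat_quat_def zero_prod_def)
  define i where "i = inverse s1"
  have i: "s1 * i = 1" using assms by (simp add: i_def)
  note r = jordan_null_relations[OF assms(1) z0, unfolded assms(2-4) mat_oct_mult mat_oct_conj
      mat_oct_smult mat_oct_norm2 mat_oct_inject]
  have 3: "\<xi>3 = (x3 * y2 + x4 * y4 + v3 * u2 - v1 * u4) * i"
    using r(4) i by algebra
  have 1: "\<xi>1 = - \<xi>2 - \<xi>3"
    using r(1) by algebra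
  have e: "z4 = (\<xi>1 * \<xi>2 + z2 * z3 - w1 * w4 + w2 * w3) * i"
      "x1 = (\<xi>2 * y4 - z2 * x3 + u4 * w1 - u2 * w3) * i"
      "x2 = (u4 * w2 - u2 * w4 - z2 * x4 - \<xi>2 * y2) * i"
      "u1 = (w2 * x3 - w1 * x4 - u2 * z3 - \<xi>2 * v1) * i"
      "u3 = (w4 * x3 - w3 * x4 - u4 * z3 - \<xi>2 * v3) * i"
      "y1 = (\<xi>1 * x4 - y2 * z3 + w4 * v1 - w2 * v3) * i"
      "y3 = (w1 * v3 - w3 * v1 - y4 * z3 - \<xi>1 * x3) * i"
      "v2 = (v1 * z2 - w1 * y2 - w2 * y4 - \<xi>1 * u2) * i"
      "v4 = (v3 * z2 - w3 * y2 - w4 * y4 - \<xi>1 * u4) * i"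
    using r i by algebra+
  show ?thesis
    unfolding param_def i_def[symmetric] Let_def assms(2-4) herm_omat_inject mat_oct_inject
    using e 1 3 by metis
qed

section \<open>Top-degree forms and symmetries\<close>

lemma clinear_add: "clinear f \<Longrightarrow> f (x + y) = f x + f y"
  and clinear_scaleC: "clinear f \<Longrightarrow> f (c *\<^sub>C x) = c *\<^sub>C f x"
  by (simp_all add: clinear_def)

lemma clinear_imp_linear: "clinear f \<Longrightarrow> linear f"
  by (rule linearI) (simp_all add: clinear_def scaleR_scaleC)

lemma clinear_imp_bounded_linear:
  fixes f :: "'a::{complex_vector,euclidean_space} \<Rightarrow> 'b::{complex_vector,real_normed_vector}"
  shows "clinear f \<Longrightarrow> bounded_linear f"
  using clinear_imp_linear linear_conv_bounded_linear by blast

lemma scaleC_zero_left [simp]: "0 *\<^sub>C x = 0"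
  using scaleR_scaleC[of 0 x] by simp

lemma clinear_0: "clinear f \<Longrightarrow> f 0 = 0"
  using clinear_scaleC[of f 0 0] by simp

lemma clinear_compose: "clinear f \<Longrightarrow> clinear g \<Longrightarrow> clinear (f \<circ> g)"
  by (simp add: clinear_def)

lemma clinear_scaleC_left: "clinear (\<lambda>t. t *\<^sub>C v)"
  by (simp add: clinear_def scaleC_add_left scaleC_scaleC scaleC_complex_def)

lemma clinear_scaleC_right: "clinear (\<lambda>v. c *\<^sub>C v)"
  by (simp add: clinear_def scaleC_add_right scaleC_scaleC mult.commute)

definition cdifferentiable ::
    "('a::{complex_vector,real_normed_vector} \<Rightarrow> 'b::{complex_vector,real_normed_vector}) \<Rightarrow> 'a \<Rightarrow>
        bool"
  where "cdifferentiable f u \<longleftrightarrow> (\<exists>D. clinear D \<and> (f has_derivative D) (at u))"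

lemma cholomorphic_on_iff: "f cholomorphic_on U \<longleftrightarrow> open U \<and> (\<forall>u\<in>U. cdifferentiable f u)"
  by (simp add: cholomorphic_on_def cdifferentiable_def)

lemma cdifferentiable_frechet:
  assumes "cdifferentiable f u"
  shows "clinear (frechet_derivative f (at u))" "(f has_derivative frechet_derivative f (at u)) (at
      u)"
  using assms frechet_derivative_at unfolding cdifferentiable_def by metis+

lemma cdifferentiable_clinear:
  fixes f :: "'a::{complex_vector,euclidean_space} \<Rightarrow> 'b::{complex_vector,real_normed_vector}"
  shows "clinear f \<Longrightarrow> cdifferentiable f u"
  unfolding cdifferentiable_def
  using clinear_imp_bounded_linear bounded_linear_imp_has_derivative by blast

lemma cdifferentiable_compose:
  assumes "cdifferentiable f (g u)" "cdifferentiable g u"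
  shows "cdifferentiable (\<lambda>x. f (g x)) u"
  using assms has_derivative_compose[of g _ u UNIV f] clinear_compose
  unfolding cdifferentiable_def o_def by blast

text \<open>Expand the vanishing value with x + y in both slots. Closure of T under addition keeps
  this argument inside the set on which f is alternating.\<close>

lemma alternating_swap:
  assumes f: "alternating_multilinear_on T f" and v: "\<forall>l. v l \<in> T"
    and T: "\<And>x y. x \<in> T \<Longrightarrow> y \<in> T \<Longrightarrow> x + y \<in> T" and ij: "i \<noteq> j"
  shows "f (v \<circ> Transposition.transpose i j) = - f v"
proof -
  define x where "x = v i"
  define y where "y = v j"
  define g where "g = (\<lambda>p q. f (v(i := p, j := q)))"
  have xy: "x \<in> T" "y \<in> T" "x + y \<in> T" using v T by (auto simp: x_def y_def)
  have lin: "f (w(k := p + q)) = f (w(k := p)) + f (w(k := q))"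
    if "\<forall>l. w l \<in> T" "p \<in> T" "q \<in> T" for w k p q
  proof -
    have "f (w(k := 1 *\<^sub>C p + 1 *\<^sub>C q)) = 1 * f (w(k := p)) + 1 * f (w(k := q))"
      using f that unfolding alternating_multilinear_on_def by blast
    then show ?thesis by (simp add: scaleC_one)
  qed
  have alt: "g p p = 0" if "p \<in> T" for p
    using f v that ij unfolding alternating_multilinear_on_def g_def
    by (smt (verit, best) fun_upd_apply)
  have g1: "g (p + q) r = g p r + g q r" if "p \<in> T" "q \<in> T" "r \<in> T" for p q r
  proof -
    have "v(i := z, j := r) = (v(j := r))(i := z)" for z using ij by (simp add: fun_upd_twist)
    then show ?thesis unfolding g_def using lin[of "v(j := r)" p q i] that v by simp
  qed
  have g2: "g r (p + q) = g r p + g r q" if "p \<in> T" "q \<in> T" "r \<in> T" for p q r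
    unfolding g_def using lin[of "v(i := r)" p q j] that v by simp
  have "g (x + y) (x + y) = 0" by (rule alt[OF xy(3)])
  then have "g x y + g y x = 0"
    using g1[OF xy] g2[OF xy(1,2,1)] g2[OF xy(1,2,2)] alt[OF xy(1)] alt[OF xy(2)] by simp
  moreover have "v(i := x, j := y) = v" by (simp add: x_def y_def)
  moreover have "v \<circ> Transposition.transpose i j = v(i := y, j := x)"
    by (auto simp: fun_eq_iff x_def y_def Transposition.transpose_def)
  ultimately show ?thesis unfolding g_def by (simp add: eq_neg_iff_add_eq_0 add.commute)
qed

text \<open>A top-degree alternating form is determined by its value on one frame: expanding in that
  frame leaves repeated vectors, which give 0, and permutations of the frame.\<close>

lemma alternating_eq_0:
  fixes D :: "complex ^ 'k::finite \<Rightarrow> 'e::complex_vector"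
  assumes f: "alternating_multilinear_on (range D) f" and D: "clinear D"
    and 0: "f (\<lambda>i. D (axis i 1)) = 0" and v: "\<forall>i. v i \<in> range D"
  shows "f v = 0"
proof -
  define b where "b = (\<lambda>i. D (axis i 1))"
  have bT: "b i \<in> range D" for i by (simp add: b_def)
  have T: "x + y \<in> range D" if "x \<in> range D" "y \<in> range D" for x y
    using that D by (auto simp flip: clinear_add)
  have perm: "f (b \<circ> p) = 0" if "p permutes UNIV" for p
    using finite_class.finite_UNIV that
  proof (induction rule: permutes_rev_induct)
    case id then show ?case using 0 by (simp add: b_def)
  next
    case (swap i j p)
    then show ?case
      using alternating_swap[OF f, of "b \<circ> p" i j] bT T
      by (cases "i = j") (auto simp: o_def)
  qed
  have base: "f (b \<circ> s) = 0" for s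
  proof (cases "inj s")
    case True
    then have "s permutes UNIV"
      by (simp add: permutes_def bij_def finite_UNIV_inj_surj flip: bij_iff)
    then show ?thesis by (rule perm)
  next
    case False
    then obtain i j where "i \<noteq> j" "s i = s j" by (auto simp: inj_def)
    then show ?thesis using f bT unfolding alternating_multilinear_on_def by (metis comp_apply)
  qed
  \<comment> \<open>Induction on the set I of slots with arbitrary entries; all other slots hold
    frame vectors.\<close>
  have "\<forall>v. (\<forall>i. v i \<in> range D) \<longrightarrow> (\<forall>i. i \<notin> I \<longrightarrow> v i \<in> range b) \<longrightarrow> f v = 0" if "finite I" for I
    using that
  proof (induction I)
    case empty
    show ?case
    proof (intro allI impI)
      fix v :: "'k \<Rightarrow> 'e" assume "\<forall>i. i \<notin> {} \<longrightarrow> v i \<in> range b"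
      then obtain s where "\<And>i. v i = b (s i)" by (auto simp: image_iff) metis
      then have "v = b \<circ> s" by auto
      then show "f v = 0" using base by simp
    qed
  next
    case (insert i I)
    show ?case
    proof (intro allI impI)
      fix v :: "'k \<Rightarrow> 'e"
      assume vD: "\<forall>i. v i \<in> range D" and vb: "\<forall>j. j \<notin> insert i I \<longrightarrow> v j \<in> range b"
      have lin: "f (v(i := a *\<^sub>C x + c *\<^sub>C y)) = a * f (v(i := x)) + c * f (v(i := y))"
        if "x \<in> range D" "y \<in> range D" for a c x y
        using f vD that unfolding alternating_multilinear_on_def by blast
      have bj: "f (v(i := b j)) = 0" for j
        using insert.IH vD vb bT by auto
      have z: "f (v(i := D 0)) = 0"
        using lin[OF rangeI rangeI, of 0 0 0 0] by (simp add: clinear_0[OF D])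
      have fin: "f (v(i := D (\<Sum>j\<in>J. c j *\<^sub>C axis j 1))) = 0" if "finite J" for J and c ::
          "'k \<Rightarrow> complex"
        using that
      proof (induction J)
        case empty show ?case using z by (simp only: sum.empty)
      next
        case (insert j J)
        have "D (\<Sum>j\<in>insert j J. c j *\<^sub>C axis j 1) = c j *\<^sub>C b j + 1 *\<^sub>C D (\<Sum>j\<in>J. c j *\<^sub>C axis j 1)"
          using insert.hyps by (simp add: clinear_add[OF D] clinear_scaleC[OF D] b_def scaleC_one)
        then have "f (v(i := D (\<Sum>j\<in>insert j J. c j *\<^sub>C axis j 1))) =
            c j * f (v(i := b j)) + 1 * f (v(i := D (\<Sum>j\<in>J. c j *\<^sub>C axis j 1)))"
          using lin[OF bT[of j] rangeI] by (simp only:)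
        then show ?case by (simp only: bj insert.IH mult_zero_right add_0)
      qed
      have ex: "w = (\<Sum>j\<in>UNIV. (w $ j) *\<^sub>C axis j 1)" for w :: "complex ^ 'k"
        by (simp add: vec_eq_iff scaleC_vec_def scaleC_complex_def axis_def if_distrib cong:
            if_cong)
      obtain w where "v i = D w" using vD by auto
      then have "f (v(i := v i)) = 0" using fin[of UNIV "\<lambda>j. w $ j"] ex[of w] by simp
      then show "f v = 0" by simp
    qed
  qed
  from this[OF finite_class.finite_UNIV] v show ?thesis by auto
qed


text \<open>A parametrization whose inverse is the restriction of a linear map of the ambient space.
  Differentiating \<psi> (\<phi> u) = u then shows that \<psi> inverts the derivative of \<phi>, and
  the image of \<phi> is the part of X where \<psi> lands in U.\<close>

definition linear_chart where
  "linear_chart X U \<phi> \<psi> \<longleftrightarrow> \<phi> cholomorphic_on U \<and> clinear \<psi> \<and> \<phi> ` U \<subseteq> X \<and>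
    (\<forall>u\<in>U. \<psi> (\<phi> u) = u) \<and> (\<forall>p\<in>X. \<psi> p \<in> U \<longrightarrow> \<phi> (\<psi> p) = p)"

context
  fixes X :: "'e::{complex_vector,euclidean_space} set"
    and U :: "(complex ^ 'k::finite) set" and \<phi> \<psi>
  assumes chart: "linear_chart X U \<phi> \<psi>"
begin

lemma chart_open: "open U"
  and chart_cdiff: "u \<in> U \<Longrightarrow> cdifferentiable \<phi> u"
  and chart_clinear: "clinear \<psi>"
  and chart_in: "u \<in> U \<Longrightarrow> \<phi> u \<in> X"
  and chart_inverse: "u \<in> U \<Longrightarrow> \<psi> (\<phi> u) = u"
  and chart_inverse': "p \<in> X \<Longrightarrow> \<psi> p \<in> U \<Longrightarrow> \<phi> (\<psi> p) = p"
  using chart by (auto simp: linear_chart_def cholomorphic_on_iff)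

lemma chart_bounded_linear: "bounded_linear \<psi>"
  by (rule clinear_imp_bounded_linear[OF chart_clinear])

lemma chart_derivative_inverse:
  assumes u: "u \<in> U"
  shows "\<psi> (frechet_derivative \<phi> (at u) w) = w"
proof -
  have "((\<lambda>x. \<psi> (\<phi> x)) has_derivative (\<lambda>w. \<psi> (frechet_derivative \<phi> (at u) w))) (at u)"
    by (rule bounded_linear.has_derivative[OF chart_bounded_linear
          cdifferentiable_frechet(2)[OF chart_cdiff[OF u]]])
  then have "((\<lambda>x. x) has_derivative (\<lambda>w. \<psi> (frechet_derivative \<phi> (at u) w))) (at u)"
    by (rule has_derivative_transform_within_open[OF _ chart_open u]) (simp add: chart_inverse)
  from has_derivative_unique[OF this has_derivative_ident] show ?thesis by meson
qed

lemma chart_holomorphic_chart: "holomorphic_chart X U \<phi>"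
proof -
  have "\<phi> cholomorphic_on U" using chart by (simp add: linear_chart_def)
  moreover have "inj (frechet_derivative \<phi> (at u))" if "u \<in> U" for u
    using chart_derivative_inverse[OF that] by (metis injI)
  moreover have im: "\<phi> ` U = X \<inter> \<psi> -` U"
    using chart_in chart_inverse chart_inverse' by (force simp: image_iff)
  have "openin (top_of_set X) (\<phi> ` U)"
    unfolding im
    by (intro continuous_openin_preimage_gen chart_open)
      (simp add: linear_continuous_on chart_bounded_linear)
  moreover have "homeomorphism U (\<phi> ` U) \<phi> \<psi>"
    unfolding homeomorphism_def
  proof (intro conjI)
    show "continuous_on U \<phi>"
      by (metis cdifferentiable_frechet(2) chart_cdiff continuous_at_imp_continuous_on
          has_derivative_continuous)
    show "continuous_on (\<phi> ` U) \<psi>"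
      by (simp add: linear_continuous_on chart_bounded_linear)
  qed (auto simp: chart_inverse image_image)
  ultimately show ?thesis unfolding holomorphic_chart_def by blast
qed

text \<open>Images of lines in U realize every vector of the range. Conversely a curve \<gamma> in X
  equals \<phi> \<circ> \<psi> \<circ> \<gamma> near 0, so the chain rule puts its velocity into the
  range.\<close>

lemma chart_tangent_space:
  assumes u: "u \<in> U"
  shows "tangent_space X (\<phi> u) = range (frechet_derivative \<phi> (at u))"
proof (intro equalityI subsetI)
  note D = cdifferentiable_frechet[OF chart_cdiff[OF u]]
  fix v assume "v \<in> range (frechet_derivative \<phi> (at u))"
  then obtain w where v: "v = frechet_derivative \<phi> (at u) w" by auto
  define l where "l = (\<lambda>t::complex. u + t *\<^sub>C w)"
  have ld: "(l has_derivative (\<lambda>t. t *\<^sub>C w)) (at t)" for t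
    unfolding l_def
    by (rule has_derivative_eq_rhs[OF has_derivative_add[OF has_derivative_const
            bounded_linear_imp_has_derivative[OF clinear_imp_bounded_linear[OF
                clinear_scaleC_left]]]]) simp
  have lc: "cdifferentiable l t" for t
    unfolding cdifferentiable_def using ld clinear_scaleC_left by blast
  have "continuous_on UNIV l"
    using ld by (meson continuous_at_imp_continuous_on has_derivative_continuous)
  then have "open (l -` U)" using chart_open by (metis continuous_on_open_vimage open_UNIV
      Int_UNIV_right)
  moreover have "0 \<in> l -` U" using u by (simp add: l_def)
  ultimately obtain r where r: "r > 0" "ball 0 r \<subseteq> l -` U" by (metis openE)
  have "holomorphic_curve X (\<lambda>t. \<phi> (l t)) (\<phi> u) v"
    unfolding holomorphic_curve_def
  proof (intro conjI exI[of _ r])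
    show "(\<lambda>t. \<phi> (l t)) cholomorphic_on ball 0 r"
      unfolding cholomorphic_on_iff using r by (auto intro!: cdifferentiable_compose[where f =
          \<phi> and g = l] lc chart_cdiff)
    show "(\<lambda>t. \<phi> (l t)) ` ball 0 r \<subseteq> X"
      using r chart_in by auto
    show "\<phi> (l 0) = \<phi> u" by (simp add: l_def)
    have "((\<lambda>t. \<phi> (l t)) has_derivative (\<lambda>t. frechet_derivative \<phi> (at u) (t *\<^sub>C w))) (at 0)"
      using has_derivative_compose[OF ld[of 0], of \<phi> "frechet_derivative \<phi> (at u)"] D(2)
          by (simp add: l_def)
    then show "((\<lambda>t. \<phi> (l t)) has_derivative (\<lambda>t. t *\<^sub>C v)) (at 0)"
      by (simp add: v clinear_scaleC[OF D(1)])
  qed (use r in auto)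
  then show "v \<in> tangent_space X (\<phi> u)" by (auto simp: tangent_space_def)
next
  note D = cdifferentiable_frechet[OF chart_cdiff[OF u]]
  fix v assume "v \<in> tangent_space X (\<phi> u)"
  then obtain \<gamma> r where r: "r > 0" "\<gamma> ` ball 0 r \<subseteq> X" and g0: "\<gamma> 0 = \<phi> u"
    and gd: "(\<gamma> has_derivative (\<lambda>t. t *\<^sub>C v)) (at 0)"
    by (auto simp: tangent_space_def holomorphic_curve_def)
  have \<psi>d: "((\<lambda>t. \<psi> (\<gamma> t)) has_derivative (\<lambda>t. \<psi> (t *\<^sub>C v))) (at 0)"
    by (rule bounded_linear.has_derivative[OF chart_bounded_linear gd])
  have p0: "\<psi> (\<gamma> 0) = u" using u by (simp add: g0 chart_inverse)
  have "isCont (\<lambda>t. \<psi> (\<gamma> t)) 0" using \<psi>d by (rule has_derivative_continuous)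
  then have "\<forall>\<^sub>F t in at 0. \<psi> (\<gamma> t) \<in> U"
    unfolding isCont_def p0 using chart_open u by (rule topological_tendstoD)
  moreover have "\<forall>\<^sub>F t in at 0. \<gamma> t \<in> X"
    using r unfolding eventually_at by (intro exI[of _ r]) auto
  ultimately have ev: "\<forall>\<^sub>F t in at 0. \<phi> (\<psi> (\<gamma> t)) = \<gamma> t"
    by eventually_elim (simp add: chart_inverse')
  have "((\<lambda>t. \<phi> (\<psi> (\<gamma> t))) has_derivative (\<lambda>t. frechet_derivative \<phi> (at u) (\<psi> (t *\<^sub>C v)))) (at 0)"
    using has_derivative_compose[OF \<psi>d, of \<phi> "frechet_derivative \<phi> (at u)"] D(2) by (simp add: p0)
  then have "(\<gamma> has_derivative (\<lambda>t. frechet_derivative \<phi> (at u) (\<psi> (t *\<^sub>C v)))) (at 0)"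
    by (rule has_derivative_transform_eventually[OF _ ev]) (auto simp: p0 g0 chart_inverse[OF u])
  from has_derivative_unique[OF this gd]
  have "frechet_derivative \<phi> (at u) (\<psi> (1 *\<^sub>C v)) = 1 *\<^sub>C v" by meson
  then show "v \<in> range (frechet_derivative \<phi> (at u))" by (metis rangeI scaleC_one)
qed

lemma chart_compose:
  assumes T: "clinear T" "clinear T'" "\<And>p. p \<in> X \<Longrightarrow> T p \<in> X" "\<And>p. p \<in> X \<Longrightarrow> T' p \<in> X"
    and inv: "\<And>p. p \<in> X \<Longrightarrow> T' (T p) = p" "\<And>p. p \<in> X \<Longrightarrow> T (T' p) = p"
  shows "linear_chart X U (\<lambda>u. T (\<phi> u)) (\<psi> \<circ> T')"
  unfolding linear_chart_def cholomorphic_on_iff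
  using assms chart_open chart_in chart_inverse chart_inverse' chart_clinear
  by (auto intro!: clinear_compose cdifferentiable_compose[where f = T, OF cdifferentiable_clinear]
      chart_cdiff)

lemma frechet_derivative_chart_compose:
  assumes T: "clinear T" and u: "u \<in> U"
  shows "frechet_derivative (\<lambda>u. T (\<phi> u)) (at u) w = T (frechet_derivative \<phi> (at u) w)"
  using frechet_derivative_at[OF bounded_linear.has_derivative[OF clinear_imp_bounded_linear[OF T]
      cdifferentiable_frechet(2)[OF chart_cdiff[OF u]]]] by metis

end

text \<open>The map f agrees with T only on X, but the curves stay in X. So every curve with
  velocity v yields the derivative T v, and the description in \<open>pushforward\<close> has
  exactly one solution.\<close>

lemma pushforward_eq:
  fixes X :: "'e::{complex_vector,euclidean_space} set"
  assumes T: "clinear T" and f: "\<And>p. p \<in> X \<Longrightarrow> f p = T p" and v: "v \<in> tangent_space X p"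
  shows "pushforward X f p v = T v"
proof -
  have *: "((f \<circ> \<gamma>) has_derivative (\<lambda>t. t *\<^sub>C T v)) (at 0)" if \<gamma>: "holomorphic_curve X \<gamma> p v" for \<gamma>
  proof -
    from \<gamma> obtain r where r: "r > 0" "\<gamma> ` ball 0 r \<subseteq> X" and gd: "(\<gamma> has_derivative (\<lambda>t. t *\<^sub>C v))
        (at 0)"
      by (auto simp: holomorphic_curve_def)
    have "((\<lambda>t. T (\<gamma> t)) has_derivative (\<lambda>t. t *\<^sub>C T v)) (at 0)"
      using bounded_linear.has_derivative[OF clinear_imp_bounded_linear[OF T] gd]
      by (simp add: clinear_scaleC[OF T])
    then show ?thesis
      by (rule has_derivative_transform_within_open[of _ _ _ _ "ball 0 r"]) (use r f in \<open>auto simp: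
          image_subset_iff\<close>)
  qed
  obtain \<gamma> where \<gamma>: "holomorphic_curve X \<gamma> p v" using v by (auto simp: tangent_space_def)
  show ?thesis
    unfolding pushforward_def
  proof (rule the_equality)
    show "\<exists>\<gamma>. holomorphic_curve X \<gamma> p v \<and> ((f \<circ> \<gamma>) has_derivative (\<lambda>t. t *\<^sub>C T v)) (at 0)"
      using \<gamma> * by blast
    fix w assume "\<exists>\<gamma>. holomorphic_curve X \<gamma> p v \<and> ((f \<circ> \<gamma>) has_derivative (\<lambda>t. t *\<^sub>C w)) (at 0)"
    then have "(\<lambda>t::complex. t *\<^sub>C w) = (\<lambda>t. t *\<^sub>C T v)"
      using * has_derivative_unique by blast
    then have "1 *\<^sub>C w = 1 *\<^sub>C T v" by meson
    then show "w = T v" by (simp add: scaleC_one)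
  qed
qed

text \<open>The inverse is required on X only: the extension \<open>cplx g\<close> used below
  factors through a projection and is not invertible on the ambient space.\<close>

definition csymmetry :: "'e::complex_vector set \<Rightarrow> ('e \<Rightarrow> 'e) \<Rightarrow> bool"
  where "csymmetry X T \<longleftrightarrow> clinear T \<and>
    (\<exists>T'. clinear T' \<and> (\<forall>p\<in>X. T p \<in> X \<and> T' p \<in> X \<and> T' (T p) = p \<and> T (T' p) = p))"

lemma csymmetry_clinear: "csymmetry X T \<Longrightarrow> clinear T"
  and csymmetry_in: "csymmetry X T \<Longrightarrow> p \<in> X \<Longrightarrow> T p \<in> X"
  by (auto simp: csymmetry_def)

lemma csymmetry_compose:
  assumes "csymmetry X S" "csymmetry X T"
  shows "csymmetry X (S \<circ> T)"
proof -
  from assms obtain S' T' where "clinear S'" "\<forall>p\<in>X. S p \<in> X \<and> S' p \<in> X \<and> S' (S p) = p \<and> S (S' p) =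
      p"
    "clinear T'" "\<forall>p\<in>X. T p \<in> X \<and> T' p \<in> X \<and> T' (T p) = p \<and> T (T' p) = p"
    unfolding csymmetry_def by blast
  then show ?thesis
    unfolding csymmetry_def using assms
    by (intro conjI exI[of _ "T' \<circ> S'"]) (auto simp: csymmetry_clinear clinear_compose)
qed

lemma csymmetry_chart:
  fixes \<phi> :: "complex ^ 'k::finite \<Rightarrow> 'e::{complex_vector,euclidean_space}"
  assumes T: "csymmetry X T" and chart: "linear_chart X U \<phi> \<psi>"
  obtains \<psi>' where "linear_chart X U (\<lambda>u. T (\<phi> u)) \<psi>'"
  using T chart_compose[OF chart, of T] unfolding csymmetry_def by blast

lemma alternating_multilinearD:
  assumes "alternating_multilinear_on T f" "\<forall>j. v j \<in> T" "x \<in> T" "y \<in> T"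
  shows "f (v(i := a *\<^sub>C x + b *\<^sub>C y)) = a * f (v(i := x)) + b * f (v(i := y))"
  using assms unfolding alternating_multilinear_on_def by blast

definition coef :: "('e::{complex_vector,real_normed_vector}, 'k::finite) form \<Rightarrow> (complex ^ 'k \<Rightarrow> 'e)
    \<Rightarrow> complex ^ 'k \<Rightarrow> complex"
  where "coef \<Omega> \<phi> u = \<Omega> (\<phi> u) (\<lambda>i. frechet_derivative \<phi> (at u) (axis i 1))"

text \<open>The ratio of the pulled back form to \<Omega> at p; it is a scalar because top-degree
  forms on a tangent space form a line.\<close>

definition factor :: "'e::{complex_vector,real_normed_vector} set \<Rightarrow> ('e, 'k) form \<Rightarrow> ('e \<Rightarrow> 'e) \<Rightarrow> 'e \<Rightarrow>
    complex"
  where "factor X \<Omega> T p = (THE c. \<forall>v. (\<forall>i. v i \<in> tangent_space X p) \<longrightarrow>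
    \<Omega> (T p) (\<lambda>i. T (v i)) = c * \<Omega> p v)"

locale charted_form =
  fixes X :: "'e::{complex_vector,euclidean_space} set" and \<Omega> :: "('e, 'k::finite) form"
  assumes holomorphic: "holomorphic_top_form X \<Omega>"
    and nowhere_vanishing: "nowhere_vanishing X \<Omega>"
    and atlas: "p \<in> X \<Longrightarrow> \<exists>U \<phi> \<psi> u. linear_chart X U (\<phi> :: complex ^ 'k \<Rightarrow> 'e) \<psi> \<and> u \<in> U \<and> \<phi> u = p"
begin

lemma coef_holomorphic:
  "linear_chart X U \<phi> \<psi> \<Longrightarrow> coef \<Omega> \<phi> cholomorphic_on U"
  using holomorphic chart_holomorphic_chart[of X U \<phi> \<psi>]
  unfolding holomorphic_top_form_def coef_def by blast

lemma alternating: "p \<in> X \<Longrightarrow> alternating_multilinear_on (tangent_space X p) (\<Omega> p)"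
  using holomorphic by (auto simp: holomorphic_top_form_def)

lemma coef_nonzero:
  assumes chart: "linear_chart X U \<phi> \<psi>" and u: "u \<in> U"
  shows "coef \<Omega> \<phi> u \<noteq> 0"
proof
  assume "coef \<Omega> \<phi> u = 0"
  then have 0: "\<Omega> (\<phi> u) (\<lambda>i. frechet_derivative \<phi> (at u) (axis i 1)) = 0"
    by (simp add: coef_def)
  have X: "\<phi> u \<in> X" by (rule chart_in[OF chart u])
  obtain v where "\<forall>i. v i \<in> tangent_space X (\<phi> u)" "\<Omega> (\<phi> u) v \<noteq> 0"
    using nowhere_vanishing X unfolding nowhere_vanishing_def by blast
  with alternating_eq_0[where f = "\<Omega> (\<phi> u)" and D = "frechet_derivative \<phi> (at u)", OF _ _ 0]
    alternating[OF X] cdifferentiable_frechet(1)[OF chart_cdiff[OF chart u]] show False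
    unfolding chart_tangent_space[OF chart u] by blast
qed

lemma csymmetry_tangent:
  assumes T: "csymmetry X T" and p: "p \<in> X" and v: "v \<in> tangent_space X p"
  shows "T v \<in> tangent_space X (T p)"
proof -
  obtain U \<phi> \<psi> u where chart: "linear_chart X U (\<phi> :: complex ^ 'k \<Rightarrow> 'e) \<psi>" and u: "u \<in> U" "\<phi> u = p"
    using atlas[OF p] by blast
  obtain \<psi>' where chart': "linear_chart X U (\<lambda>u. T (\<phi> u)) \<psi>'"
    by (rule csymmetry_chart[OF T chart])
  have "T v \<in> range (frechet_derivative (\<lambda>u. T (\<phi> u)) (at u))"
    using v chart_tangent_space[OF chart u(1)] csymmetry_clinear[OF T]
    by (auto simp: u(2) frechet_derivative_chart_compose[OF chart _ u(1)])
  then show ?thesis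
    using chart_tangent_space[OF chart' u(1)] by (simp add: u(2))
qed

text \<open>T \<circ> \<phi> is again a chart, so the factor is a quotient of two holomorphic
  coefficients. This is the source of its continuity and later of the entire functions on
  lines.\<close>

lemma factor_chart:
  assumes T: "csymmetry X T" and chart: "linear_chart X U (\<phi> :: complex ^ 'k \<Rightarrow> 'e) \<psi>" and u: "u \<in> U"
  shows "factor X \<Omega> T (\<phi> u) = coef \<Omega> (\<lambda>u. T (\<phi> u)) u / coef \<Omega> \<phi> u"
    and "\<forall>i. v i \<in> tangent_space X (\<phi> u) \<Longrightarrow>
      \<Omega> (T (\<phi> u)) (\<lambda>i. T (v i)) = factor X \<Omega> T (\<phi> u) * \<Omega> (\<phi> u) v"
proof -
  define c where "c = coef \<Omega> (\<lambda>u. T (\<phi> u)) u / coef \<Omega> \<phi> u"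
  define p where "p = \<phi> u"
  have p: "p \<in> X" unfolding p_def by (rule chart_in[OF chart u])
  have Tl: "clinear T" by (rule csymmetry_clinear[OF T])
  define D where "D = frechet_derivative \<phi> (at u)"
  have D: "clinear D" unfolding D_def by (rule cdifferentiable_frechet(1)[OF chart_cdiff[OF chart
      u]])
  have tan: "tangent_space X p = range D"
    unfolding p_def D_def by (rule chart_tangent_space[OF chart u])
  have nz: "coef \<Omega> \<phi> u \<noteq> 0" by (rule coef_nonzero[OF chart u])
  \<comment> \<open>The difference of the two forms is alternating and vanishes on the coordinate
    frame, hence vanishes.\<close>
  define F where "F = (\<lambda>v. \<Omega> (T p) (\<lambda>i. T (v i)) - c * \<Omega> p v)"
  have "alternating_multilinear_on (tangent_space X p) F"
    unfolding alternating_multilinear_on_def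
  proof (intro conjI allI impI)
    fix v :: "'k \<Rightarrow> 'e" and i x y a b
    assume v: "\<forall>j. v j \<in> tangent_space X p" and x: "x \<in> tangent_space X p" and y:
        "y \<in> tangent_space X p"
    have c: "(\<lambda>j. T ((v(i := z)) j)) = (\<lambda>j. T (v j))(i := T z)" for z by auto
    have "\<Omega> (T p) ((\<lambda>j. T (v j))(i := a *\<^sub>C T x + b *\<^sub>C T y)) =
        a * \<Omega> (T p) ((\<lambda>j. T (v j))(i := T x)) + b * \<Omega> (T p) ((\<lambda>j. T (v j))(i := T y))"
      using alternating_multilinearD[OF alternating[OF csymmetry_in[OF T p]], of "\<lambda>j. T (v j)" "T x"
          "T y"]
        csymmetry_tangent[OF T p] v x y by blast
    moreover have "\<Omega> p (v(i := a *\<^sub>C x + b *\<^sub>C y)) = a * \<Omega> p (v(i := x)) + b * \<Omega> p (v(i := y))"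
      using alternating[OF p] v x y unfolding alternating_multilinear_on_def by blast
    ultimately show "F (v(i := a *\<^sub>C x + b *\<^sub>C y)) = a * F (v(i := x)) + b * F (v(i := y))"
      unfolding F_def c by (simp add: clinear_add[OF Tl] clinear_scaleC[OF Tl] algebra_simps)
  next
    fix v :: "'k \<Rightarrow> 'e" and i j
    assume v: "\<forall>l. v l \<in> tangent_space X p" and ij: "i \<noteq> j" "v i = v j"
    have "\<Omega> (T p) (\<lambda>l. T (v l)) = 0"
      using alternating[OF csymmetry_in[OF T p]] csymmetry_tangent[OF T p] v ij
      unfolding alternating_multilinear_on_def by (metis (no_types, lifting))
    moreover have "\<Omega> p v = 0"
      using alternating[OF p] v ij unfolding alternating_multilinear_on_def by blast
    ultimately show "F v = 0" by (simp add: F_def)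
  qed
  moreover have "F (\<lambda>i. D (axis i 1)) = 0"
    using nz frechet_derivative_chart_compose[OF chart Tl u]
    by (simp add: F_def c_def coef_def D_def p_def)
  ultimately have F0: "F v = 0" if "\<forall>i. v i \<in> tangent_space X p" for v
    using alternating_eq_0[OF _ D] that unfolding tan by blast
  have fac: "factor X \<Omega> T p = c"
    unfolding factor_def
  proof (rule the_equality)
    show "\<forall>v. (\<forall>i. v i \<in> tangent_space X p) \<longrightarrow> \<Omega> (T p) (\<lambda>i. T (v i)) = c * \<Omega> p v"
      using F0 by (auto simp: F_def)
    fix c' assume c': "\<forall>v. (\<forall>i. v i \<in> tangent_space X p) \<longrightarrow> \<Omega> (T p) (\<lambda>i. T (v i)) = c' * \<Omega> p v"
    obtain v where v: "\<forall>i. v i \<in> tangent_space X p" "\<Omega> p v \<noteq> 0"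
      using nowhere_vanishing p unfolding nowhere_vanishing_def by blast
    then have "c' * \<Omega> p v = c * \<Omega> p v"
      using c' F0[OF v(1)] by (simp add: F_def)
    with v show "c' = c" by simp
  qed
  then show "factor X \<Omega> T (\<phi> u) = coef \<Omega> (\<lambda>u. T (\<phi> u)) u / coef \<Omega> \<phi> u"
    by (simp add: p_def c_def)
  show "\<Omega> (T (\<phi> u)) (\<lambda>i. T (v i)) = factor X \<Omega> T (\<phi> u) * \<Omega> (\<phi> u) v"
    if "\<forall>i. v i \<in> tangent_space X (\<phi> u)"
    using F0[of v] that fac by (simp add: F_def p_def)
qed

lemma factor_eq:
  assumes T: "csymmetry X T" and p: "p \<in> X" and v: "\<And>i. v i \<in> tangent_space X p"
  shows "\<Omega> (T p) (\<lambda>i. T (v i)) = factor X \<Omega> T p * \<Omega> p v"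
  using atlas[OF p] factor_chart(2)[OF T] v by metis

lemma factor_nonzero:
  assumes T: "csymmetry X T" and p: "p \<in> X"
  shows "factor X \<Omega> T p \<noteq> 0"
proof -
  obtain U \<phi> \<psi> u where chart: "linear_chart X U (\<phi> :: complex ^ 'k \<Rightarrow> 'e) \<psi>" and u: "u \<in> U" "\<phi> u = p"
    using atlas[OF p] by blast
  obtain \<psi>' where "linear_chart X U (\<lambda>u. T (\<phi> u)) \<psi>'"
    by (rule csymmetry_chart[OF T chart])
  with coef_nonzero[OF _ u(1)] chart show ?thesis
    unfolding u(2)[symmetric] factor_chart(1)[OF T chart u(1)] by fastforce
qed

lemma factor_unique:
  assumes T: "csymmetry X T" and p: "p \<in> X"
    and c: "\<And>v. (\<And>i. v i \<in> tangent_space X p) \<Longrightarrow> \<Omega> (T p) (\<lambda>i. T (v i)) = c * \<Omega> p v"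
  shows "factor X \<Omega> T p = c"
proof -
  obtain v where v: "\<And>i. v i \<in> tangent_space X p" "\<Omega> p v \<noteq> 0"
    using nowhere_vanishing p unfolding nowhere_vanishing_def by blast
  with factor_eq[OF T p, of v] c[of v] show ?thesis by simp
qed

lemma factor_compose:
  assumes S: "csymmetry X S" and T: "csymmetry X T" and p: "p \<in> X"
  shows "factor X \<Omega> (S \<circ> T) p = factor X \<Omega> S (T p) * factor X \<Omega> T p"
  using factor_eq[OF S csymmetry_in[OF T p] csymmetry_tangent[OF T p]] factor_eq[OF T p]
  by (intro factor_unique csymmetry_compose S T p) simp

lemma factor_cong:
  assumes S: "csymmetry X S" and T: "csymmetry X T" and p: "p \<in> X"
    and eq: "\<And>q. q \<in> X \<Longrightarrow> S q = T q"
  shows "factor X \<Omega> S p = factor X \<Omega> T p"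
proof (rule factor_unique[OF S p])
  fix v :: "'k \<Rightarrow> 'e" assume v: "\<And>i. v i \<in> tangent_space X p"
  \<comment> \<open>S and T may differ off X, but on tangent vectors both compute the pushforward of
    the same map on X.\<close>
  have "S w = T w" if "w \<in> tangent_space X p" for w
    using pushforward_eq[OF csymmetry_clinear[OF S] _ that, of S]
      pushforward_eq[OF csymmetry_clinear[OF T] eq that] by simp
  then have "(\<lambda>i. S (v i)) = (\<lambda>i. T (v i))" using v by auto
  then show "\<Omega> (S p) (\<lambda>i. S (v i)) = factor X \<Omega> T p * \<Omega> p v"
    using factor_eq[OF T p v] eq[OF p] by simp
qed

lemma continuous_factor:
  assumes T: "csymmetry X T"
  shows "continuous_on X (factor X \<Omega> T)"
  unfolding continuous_on
proof
  fix p assume p: "p \<in> X"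
  obtain U \<phi> \<psi> u where chart: "linear_chart X U (\<phi> :: complex ^ 'k \<Rightarrow> 'e) \<psi>" and u: "u \<in> U" "\<phi> u = p"
    using atlas[OF p] by blast
  obtain \<psi>' where chart': "linear_chart X U (\<lambda>u. T (\<phi> u)) \<psi>'"
    by (rule csymmetry_chart[OF T chart])
  have \<psi>p: "\<psi> p = u" using chart_inverse[OF chart u(1)] u(2) by simp
  have cont: "isCont (coef \<Omega> \<theta>) u" if "linear_chart X U \<theta> \<psi>''" for \<theta> \<psi>''
    using coef_holomorphic[OF that] u(1) has_derivative_continuous
    unfolding cholomorphic_on_def by blast
  define g where "g = (\<lambda>q. coef \<Omega> (\<lambda>u. T (\<phi> u)) (\<psi> q) / coef \<Omega> \<phi> (\<psi> q))"
  have \<psi>c: "isCont \<psi> p"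
    by (rule linear_continuous_at[OF chart_bounded_linear[OF chart]])
  have "isCont g p"
    unfolding g_def
    by (intro continuous_divide isCont_o2[OF \<psi>c])
      (auto simp: \<psi>p cont[OF chart] cont[OF chart'] coef_nonzero[OF chart u(1)])
  then have "(g \<longlongrightarrow> g p) (at p within X)"
    using continuous_at_imp_continuous_at_within continuous_within by blast
  moreover have gp: "g p = factor X \<Omega> T p"
    unfolding g_def \<psi>p using factor_chart(1)[OF T chart u(1)] u(2) by simp
  moreover have "\<forall>\<^sub>F q in at p within X. g q = factor X \<Omega> T q"
  proof -
    have "\<forall>\<^sub>F q in at p. \<psi> q \<in> U"
      using \<psi>c chart_open[OF chart] u(1) unfolding isCont_def \<psi>p by (rule topological_tendstoD)
    then have "\<forall>\<^sub>F q in at p within X. \<psi> q \<in> U"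
      by (rule filter_leD[OF at_le[OF subset_UNIV]])
    moreover have "\<forall>\<^sub>F q in at p within X. q \<in> X"
      by (simp add: eventually_at_filter)
    ultimately show ?thesis
    proof eventually_elim
      case (elim q)
      then show ?case
        using factor_chart(1)[OF T chart, of "\<psi> q"] chart_inverse'[OF chart, of q]
            by (simp add: g_def)
    qed
  qed
  ultimately show "(factor X \<Omega> T \<longlongrightarrow> factor X \<Omega> T p) (at p within X)"
    by (auto intro: Lim_transform_eventually)
qed

end

section \<open>The standard chart\<close>

lemma exhaust_16:
  fixes x :: 16
  shows "x = 0 \<or> x = 1 \<or> x = 2 \<or> x = 3 \<or> x = 4 \<or> x = 5 \<or> x = 6 \<or> x = 7 \<or> x = 8 \<or> x = 9 \<or>
    x = 10 \<or> x = 11 \<or> x = 12 \<or> x = 13 \<or> x = 14 \<or> x = 15"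
proof (induct x)
  case (of_int z)
  then have "0 \<le> z \<and> z < 16" by simp
  then have "z = 0 \<or> z = 1 \<or> z = 2 \<or> z = 3 \<or> z = 4 \<or> z = 5 \<or> z = 6 \<or> z = 7 \<or> z = 8 \<or> z = 9 \<or>
    z = 10 \<or> z = 11 \<or> z = 12 \<or> z = 13 \<or> z = 14 \<or> z = 15" by presburger
  then show ?case by (elim disjE) simp_all
qed

lemma forall_16: "(\<forall>i::16. P i) \<longleftrightarrow> P 0 \<and> P 1 \<and> P 2 \<and> P 3 \<and> P 4 \<and> P 5 \<and> P 6 \<and> P 7 \<and> P 8 \<and> P 9 \<and>
    P 10 \<and> P 11 \<and> P 12 \<and> P 13 \<and> P 14 \<and> P 15"
  by (metis exhaust_16)

lemma coord_nth:
  "coord A $ 1 = oct_re (A $ 2 $ 2)"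
  "coord A $ 2 = quat_matrix (fst (A $ 1 $ 2)) $ 1 $ 1"
  "coord A $ 3 = quat_matrix (fst (A $ 1 $ 2)) $ 1 $ 2"
  "coord A $ 4 = quat_matrix (fst (A $ 1 $ 2)) $ 2 $ 1"
  "coord A $ 5 = quat_matrix (snd (A $ 1 $ 2)) $ 1 $ 1"
  "coord A $ 6 = quat_matrix (snd (A $ 1 $ 2)) $ 1 $ 2"
  "coord A $ 7 = quat_matrix (snd (A $ 1 $ 2)) $ 2 $ 1"
  "coord A $ 8 = quat_matrix (snd (A $ 1 $ 2)) $ 2 $ 2"
  "coord A $ 9 = quat_matrix (fst (A $ 3 $ 1)) $ 1 $ 2"
  "coord A $ 10 = quat_matrix (fst (A $ 3 $ 1)) $ 2 $ 2"
  "coord A $ 11 = quat_matrix (snd (A $ 3 $ 1)) $ 1 $ 1"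
  "coord A $ 12 = quat_matrix (snd (A $ 3 $ 1)) $ 2 $ 1"
  "coord A $ 13 = quat_matrix (fst (A $ 2 $ 3)) $ 2 $ 1"
  "coord A $ 14 = quat_matrix (fst (A $ 2 $ 3)) $ 2 $ 2"
  "coord A $ 15 = quat_matrix (snd (A $ 2 $ 3)) $ 1 $ 2"
  "coord A $ 0 = quat_matrix (snd (A $ 2 $ 3)) $ 2 $ 2"
  unfolding coord_def Let_def vector_def by simp_all

lemma quat_matrix_add: "quat_matrix (p + q) = quat_matrix p + quat_matrix q"
  and quat_matrix_scaleC: "quat_matrix (c *\<^sub>C p) = c *\<^sub>C quat_matrix p"
  by (cases p; cases q; simp add: vec_eq_iff forall_2 vector_2 algebra_simps scaleC_prod_def
      scaleC_vec_def scaleC_complex_def)+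

lemma scaleC_fst: "fst (c *\<^sub>C p) = c *\<^sub>C fst p"
  and scaleC_snd: "snd (c *\<^sub>C p) = c *\<^sub>C snd p"
  and scaleC_nth: "(c *\<^sub>C v) $ i = c *\<^sub>C (v $ i)"
  by (simp_all add: scaleC_prod_def scaleC_vec_def)

lemma clinear_coord: "clinear coord"
proof -
  have "oct_re (c *\<^sub>C x) = c * oct_re x" for c and x :: "complex oct"
    by (simp add: oct_re_def scaleC_prod_def scaleC_complex_def)
  then show ?thesis
    unfolding clinear_def vec_eq_iff forall_16
    by (simp add: coord_nth quat_matrix_add oct_re_add scaleC_fst scaleC_snd scaleC_nth
        quat_matrix_scaleC) (simp add: scaleC_complex_def)
qed

lemma z1_eq_coord: "z1 A = coord A $ 2"
  by (simp add: z1_def coord_nth)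

definition Phi :: "complex ^ 16 \<Rightarrow> complex omat"
  where "Phi u = param (u $ 1) (u $ 2) (u $ 3) (u $ 4) (u $ 5) (u $ 6) (u $ 7) (u $ 8) (u $ 9)
      (u $ 10)
    (u $ 11) (u $ 12) (u $ 13) (u $ 14) (u $ 15) (u $ 0)"

lemma coord_Phi: "coord (Phi u) = u"
  unfolding vec_eq_iff forall_16
  by (simp add: Phi_def param_def Let_def coord_nth mat_oct_def vector_2)

lemma Phi_in_X_O: "u $ 2 \<noteq> 0 \<Longrightarrow> Phi u \<in> X_O"
proof -
  assume u: "u $ 2 \<noteq> 0"
  have "Phi u \<noteq> 0"
  proof
    assume "Phi u = 0"
    then have "u = coord 0" by (metis coord_Phi)
    then show False using u clinear_0[OF clinear_coord] by simp
  qed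
  moreover have "Phi u \<in> jordan3" by (simp add: Phi_def param_def Let_def)
  ultimately show ?thesis using param_null[OF u] by (simp add: X_O_def Phi_def)
qed

lemma Phi_coord:
  assumes "A \<in> X_O" "coord A $ 2 \<noteq> 0"
  shows "Phi (coord A) = A"
proof -
  obtain a b c x y z where A: "A = herm_omat a b c x y z"
    using assms(1) unfolding X_O_def by (blast elim: jordan3_cases)
  obtain x1 x2 x3 x4 u1 u2 u3 u4 where x: "x = mat_oct x1 x2 x3 x4 u1 u2 u3 u4"
      by (rule mat_oct_cases)
  obtain y1 y2 y3 y4 v1 v2 v3 v4 where y: "y = mat_oct y1 y2 y3 y4 v1 v2 v3 v4"
      by (rule mat_oct_cases)
  obtain s1 z2 z3 z4 w1 w2 w3 w4 where z: "z = mat_oct s1 z2 z3 z4 w1 w2 w3 w4"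
      by (rule mat_oct_cases)
  have "omat_mult A A = 0" using assms(1) by (simp add: X_O_def)
  moreover have "s1 \<noteq> 0" using assms(2) by (simp add: A coord_nth z mat_oct_def vector_2)
  ultimately have "A = param b s1 z2 z3 w1 w2 w3 w4 y2 y4 v1 v3 x3 x4 u2 u4"
    unfolding A by (rule X_O_eq_param[OF _ x y z])
  moreover have "Phi (coord A) = param b s1 z2 z3 w1 w2 w3 w4 y2 y4 v1 v3 x3 x4 u2 u4"
    unfolding Phi_def by (simp add: coord_nth A x y z mat_oct_def vector_2)
  ultimately show ?thesis by simp
qed

section \<open>Complex differentiability of the parametrization\<close>

lemma cdifferentiable_const: "cdifferentiable (\<lambda>_. c) u"
  unfolding cdifferentiable_def by (intro exI[of _ "\<lambda>_. 0"]) (auto simp: clinear_def zero_prod_def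
      scaleC_add_right[of _ 0 0, simplified])

lemma cdifferentiable_nth: "cdifferentiable (\<lambda>u :: complex ^ 'k::finite. u $ k) u"
  by (intro cdifferentiable_clinear) (simp add: clinear_def scaleC_vec_def)

lemma cdifferentiable_add: "cdifferentiable f u \<Longrightarrow> cdifferentiable g u \<Longrightarrow> cdifferentiable (\<lambda>u. f u +
    g u) u"
  unfolding cdifferentiable_def
  apply (elim exE conjE)
  subgoal for D E
    by (intro exI[of _ "\<lambda>h. D h + E h"] conjI has_derivative_add) (auto simp: clinear_def
        scaleC_add_right)
  done

lemma cdifferentiable_mult:
  fixes f g :: "'a::{complex_vector,real_normed_vector} \<Rightarrow> complex"
  shows "cdifferentiable f u \<Longrightarrow> cdifferentiable g u \<Longrightarrow> cdifferentiable (\<lambda>u. f u * g u) u"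
  unfolding cdifferentiable_def
  apply (elim exE conjE)
  subgoal for D E
    by (intro exI[of _ "\<lambda>h. f u * E h + D h * g u"] conjI has_derivative_mult)
      (auto simp: clinear_def scaleC_complex_def algebra_simps)
  done

lemma cdifferentiable_minus: "cdifferentiable f u \<Longrightarrow> cdifferentiable (\<lambda>u. - f u :: complex) u"
  using cdifferentiable_mult[OF cdifferentiable_const[of "-1"]] by fastforce

lemma cdifferentiable_diff:
  "cdifferentiable f u \<Longrightarrow> cdifferentiable g u \<Longrightarrow> cdifferentiable (\<lambda>u. f u - g u :: complex) u"
  using cdifferentiable_add[OF _ cdifferentiable_minus] by fastforce

lemma cdifferentiable_inverse:
  fixes f :: "'a::{complex_vector,real_normed_vector} \<Rightarrow> complex"
  assumes "cdifferentiable f u" "f u \<noteq> 0"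
  shows "cdifferentiable (\<lambda>u. inverse (f u)) u"
proof -
  obtain D where "clinear D" "(f has_derivative D) (at u)" using assms unfolding cdifferentiable_def
      by blast
  then show ?thesis
    unfolding cdifferentiable_def
    by (intro exI[of _ "\<lambda>h. - (inverse (f u) * D h * inverse (f u))"] conjI
        Deriv.has_derivative_inverse assms)
      (auto simp: clinear_def scaleC_complex_def algebra_simps)
qed

lemma cdifferentiable_divide_const: "cdifferentiable f u \<Longrightarrow> cdifferentiable (\<lambda>u. f u / c :: complex)
    u"
  unfolding divide_inverse by (intro cdifferentiable_mult cdifferentiable_const)

lemma cdifferentiable_Pair: "cdifferentiable f u \<Longrightarrow> cdifferentiable g u \<Longrightarrow> cdifferentiable (\<lambda>u. (f u,
    g u)) u"
  unfolding cdifferentiable_def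
  apply (elim exE conjE)
  subgoal for D E
    by (intro exI[of _ "\<lambda>h. (D h, E h)"] conjI has_derivative_Pair) (auto simp: clinear_def
        scaleC_prod_def)
  done

lemma scaleC_oct: "c *\<^sub>C x = oct_smult c (x :: complex oct)"
  by (cases x rule: oct_cases) (simp add: scaleC_prod_def scaleC_complex_def)

lemma herm_omat_scaleC: "e *\<^sub>C herm_omat a b c x y z =
    herm_omat (e * a) (e * b) (e * c) (e *\<^sub>C x) (e *\<^sub>C y) (e *\<^sub>C (z :: complex oct))"
  by (simp add: omat_eq_iff scaleC_vec_def scaleC_oct) (simp add: oct_scalar_eq)

lemma cdifferentiable_herm_omat:
  fixes a b c :: "'a::{complex_vector,real_normed_vector} \<Rightarrow> complex"
  assumes "cdifferentiable a u" "cdifferentiable b u" "cdifferentiable c u" "cdifferentiable x u"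
    "cdifferentiable y u" "cdifferentiable z u"
  shows "cdifferentiable (\<lambda>u. herm_omat (a u) (b u) (c u) (x u) (y u) (z u)) u"
proof -
  define H :: "complex \<times> complex \<times> complex \<times> complex oct \<times> complex oct \<times> complex oct \<Rightarrow> complex omat"
    where "H = (\<lambda>(a, b, c, x, y, z). herm_omat a b c x y z)"
  have "clinear H"
    by (simp add: clinear_def H_def case_prod_unfold herm_omat_add herm_omat_scaleC)
      (simp add: scaleC_prod_def scaleC_complex_def)
  then have "cdifferentiable (\<lambda>v. H (a v, b v, c v, x v, y v, z v)) u"
    by (intro cdifferentiable_compose[of H "\<lambda>v. (a v, b v, c v, x v, y v, z v)"]
        cdifferentiable_clinear
        cdifferentiable_Pair assms)
  then show ?thesis by (simp add: H_def)
qed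

text \<open>The entries of \<open>Phi\<close> are polynomials in the coordinates and the inverse of
  z_1.\<close>

lemma linear_chart_Phi: "linear_chart X_O {u. u $ 2 \<noteq> 0} Phi coord"
proof -
  have "cdifferentiable Phi u" if "u $ 2 \<noteq> 0" for u
    unfolding Phi_def[abs_def] param_def Let_def mat_oct_def mat_quat_def using that
    by (intro cdifferentiable_herm_omat cdifferentiable_Pair cdifferentiable_divide_const
        cdifferentiable_add cdifferentiable_diff cdifferentiable_minus cdifferentiable_mult
        cdifferentiable_inverse cdifferentiable_const cdifferentiable_nth)
  moreover have "open {u :: complex ^ 16. u $ 2 \<noteq> 0}"
    by (intro open_Collect_neq continuous_intros)
  ultimately show ?thesis
    unfolding linear_chart_def cholomorphic_on_iff
    by (auto simp: clinear_coord Phi_in_X_O coord_Phi Phi_coord)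
qed

section \<open>The action of \<open>F\<^sub>4\<close> on \<open>\<bbbX>\<^sub>\<bbbO>\<close>\<close>

text \<open>The imaginary unit here is the scalar one, not the octonion e_1. Splitting into real and
  imaginary parts reduces statements about \<open>complexify g\<close> to statements about
  g.\<close>

definition oct_cplx :: "real oct \<Rightarrow> real oct \<Rightarrow> complex oct"
  where "oct_cplx p q = oct_map of_real p + \<i> *\<^sub>C oct_map of_real q"

definition omat_cplx :: "real omat \<Rightarrow> real omat \<Rightarrow> complex omat"
  where "omat_cplx P Q = omat_map of_real P + \<i> *\<^sub>C omat_map of_real Q"

lemma oct_cplx_simps:
  "oct_cplx ((p0,p1,p2,p3),(p4,p5,p6,p7)) ((q0,q1,q2,q3),(q4,q5,q6,q7)) =
    ((Complex p0 q0, Complex p1 q1, Complex p2 q2, Complex p3 q3),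
     (Complex p4 q4, Complex p5 q5, Complex p6 q6, Complex p7 q7))"
  by (simp add: oct_cplx_def scaleC_oct complex_eq_iff)

lemma omat_cplx_nth: "omat_cplx P Q $ i $ j = oct_cplx (P $ i $ j) (Q $ i $ j)"
  by (simp add: omat_cplx_def oct_cplx_def omat_map_def scaleC_nth)

lemma oct_cplx_mult:
  "oct_mult (oct_cplx p q) (oct_cplx r s) = oct_cplx (oct_mult p r - oct_mult q s) (oct_mult p s +
      oct_mult q r)"
  by (cases p rule: oct_cases, cases q rule: oct_cases, cases r rule: oct_cases, cases s rule:
      oct_cases)
    (simp add: oct_cplx_simps complex_eq_iff algebra_simps)

lemma oct_cplx_add: "oct_cplx p q + oct_cplx r s = oct_cplx (p + r) (q + s)"
  by (cases p rule: oct_cases, cases q rule: oct_cases, cases r rule: oct_cases, cases s rule: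
      oct_cases)
    (simp add: oct_cplx_simps complex_eq_iff)

lemma oct_cplx_scaleC: "c *\<^sub>C oct_cplx p q = oct_cplx (Re c *\<^sub>R p - Im c *\<^sub>R q) (Im c *\<^sub>R p +
    Re c *\<^sub>R q)"
  by (cases p rule: oct_cases, cases q rule: oct_cases)
    (simp add: oct_cplx_simps complex_eq_iff scaleC_oct)

lemma oct_cplx_inject: "oct_cplx p q = oct_cplx r s \<longleftrightarrow> p = r \<and> q = s"
  by (cases p rule: oct_cases, cases q rule: oct_cases, cases r rule: oct_cases, cases s rule:
      oct_cases)
    (auto simp: oct_cplx_simps)

lemma oct_cplx_0: "oct_cplx 0 0 = 0"
  by (simp add: zero_prod_def oct_cplx_simps Complex_eq)

lemma oct_map_Re_cplx: "oct_map Re (oct_cplx p q) = p" and oct_map_Im_cplx: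
    "oct_map Im (oct_cplx p q) = q"
  by (cases p rule: oct_cases, cases q rule: oct_cases, simp add: oct_cplx_simps)+

lemma oct_cplx_Re_Im: "oct_cplx (oct_map Re x) (oct_map Im x) = x"
  by (cases x rule: oct_cases) (simp add: oct_cplx_simps)

lemma omat_eqI: "(\<And>i j. A $ i $ j = B $ i $ j) \<Longrightarrow> A = (B :: 'a omat)"
  by (simp add: vec_eq_iff)

lemma omat_cplx_square:
  "omat_mult (omat_cplx P Q) (omat_cplx P Q) = omat_cplx (omat_mult P P - omat_mult Q Q) (2 *\<^sub>R
      jordan_prod P Q)"
proof (rule omat_eqI)
  fix i j
  have s: "(\<Sum>k\<in>UNIV. oct_cplx (f k) (g k)) = oct_cplx (\<Sum>k\<in>UNIV. f k) (\<Sum>k\<in>UNIV. g k)" for f g ::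
      "3 \<Rightarrow> real oct"
    by (simp add: sum_3 oct_cplx_add)
  show "omat_mult (omat_cplx P Q) (omat_cplx P Q) $ i $ j =
      omat_cplx (omat_mult P P - omat_mult Q Q) (2 *\<^sub>R jordan_prod P Q) $ i $ j"
    by (simp add: jordan_prod_def omat_mult_def omat_cplx_nth oct_cplx_mult s sum_subtractf
        sum.distrib)
qed

lemma omat_cplx_add: "omat_cplx P Q + omat_cplx R S = omat_cplx (P + R) (Q + S)"
  by (rule omat_eqI) (simp add: omat_cplx_nth oct_cplx_add)

lemma omat_cplx_scaleC: "c *\<^sub>C omat_cplx P Q = omat_cplx (Re c *\<^sub>R P - Im c *\<^sub>R Q) (Im c *\<^sub>R P +
    Re c *\<^sub>R Q)"
  by (rule omat_eqI) (simp add: omat_cplx_nth oct_cplx_scaleC scaleC_nth)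

lemma omat_cplx_eq_0_iff: "omat_cplx P Q = 0 \<longleftrightarrow> P = 0 \<and> Q = 0"
proof -
  have "omat_cplx P Q = omat_cplx 0 0 \<longleftrightarrow> P = 0 \<and> Q = 0"
    by (auto simp: vec_eq_iff omat_cplx_nth oct_cplx_inject)
  moreover have "omat_cplx 0 0 = 0" by (rule omat_eqI) (simp add: omat_cplx_nth oct_cplx_0)
  ultimately show ?thesis by simp
qed

lemma omat_map_Re_cplx: "omat_map Re (omat_cplx P Q) = P" and omat_map_Im_cplx:
    "omat_map Im (omat_cplx P Q) = Q"
  by (rule omat_eqI, simp add: omat_map_def omat_cplx_nth oct_map_Re_cplx oct_map_Im_cplx)+

lemma complexify_cplx: "complexify g (omat_cplx P Q) = omat_cplx (g P) (g Q)"
  by (simp add: complexify_def omat_map_Re_cplx omat_map_Im_cplx) (simp add: omat_cplx_def)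

lemma herm_omat_cplx:
  "omat_cplx (herm_omat a b c x y z) (herm_omat a' b' c' x' y' z') =
    herm_omat (Complex a a') (Complex b b') (Complex c c') (oct_cplx x x') (oct_cplx y y') (oct_cplx
        z z')"
proof -
  have "oct_cplx (oct_conj p) (oct_conj q) = oct_conj (oct_cplx p q)" for p q
    by (cases p rule: oct_cases, cases q rule: oct_cases) (simp add: oct_cplx_simps complex_eq_iff)
  moreover have "oct_cplx (oct_scalar r) (oct_scalar s) = oct_scalar (Complex r s)" for r s
    by (simp add: oct_scalar_eq oct_cplx_simps Complex_eq)
  ultimately show ?thesis by (simp add: omat_eq_iff omat_cplx_nth)
qed

lemma jordan3_cplx_cases:
  assumes "A \<in> jordan3"
  obtains P Q where "P \<in> jordan3" "Q \<in> jordan3" "A = omat_cplx P Q"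
proof -
  obtain a b c x y z where A: "A = herm_omat a b c x y z" using assms by (rule jordan3_cases)
  show thesis
    by (rule that[of "herm_omat (Re a) (Re b) (Re c) (oct_map Re x) (oct_map Re y) (oct_map Re z)"
          "herm_omat (Im a) (Im b) (Im c) (oct_map Im x) (oct_map Im y) (oct_map Im z)"])
      (simp_all add: A herm_omat_cplx oct_cplx_Re_Im)
qed

lemma omat_cplx_in_jordan3: "P \<in> jordan3 \<Longrightarrow> Q \<in> jordan3 \<Longrightarrow> omat_cplx P Q \<in> jordan3"
  by (elim jordan3_cases) (simp add: herm_omat_cplx)

text \<open>The real and imaginary parts of (P + iQ)^2 = 0 are equations in the real Jordan algebra,
  so F_4 preserves them.\<close>

lemma omat_cplx_in_X_O_iff:
  assumes "P \<in> jordan3" "Q \<in> jordan3"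
  shows "omat_cplx P Q \<in> X_O \<longleftrightarrow> (P \<noteq> 0 \<or> Q \<noteq> 0) \<and> jordan_prod P P = jordan_prod Q Q \<and>
      jordan_prod P Q = 0"
  using assms
  by (simp add: X_O_def omat_cplx_in_jordan3 omat_cplx_square omat_cplx_eq_0_iff jordan_prod_self)

text \<open>The projection makes the extension linear on all matrices, also outside \<open>jordan3\<close>, where
  \<open>complexify g\<close> carries no information.\<close>

definition cplx :: "(real omat \<Rightarrow> real omat) \<Rightarrow> complex omat \<Rightarrow> complex omat"
  where "cplx g = complexify g \<circ> herm_proj"

lemma cplx_eq: "A \<in> jordan3 \<Longrightarrow> cplx g A = complexify g A"
  by (simp add: cplx_def herm_proj_id)

lemma cplx_omat_cplx: "P \<in> jordan3 \<Longrightarrow> Q \<in> jordan3 \<Longrightarrow> cplx g (omat_cplx P Q) = omat_cplx (g P) (g Q)"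
  by (simp add: cplx_eq omat_cplx_in_jordan3 complexify_cplx)

lemma X_O_in_jordan3: "A \<in> X_O \<Longrightarrow> A \<in> jordan3"
  by (simp add: X_O_def)

lemma cplx_compose: "h \<in> F4 \<Longrightarrow> A \<in> jordan3 \<Longrightarrow> cplx (g \<circ> h) A = cplx g (cplx h A)"
  by (elim jordan3_cplx_cases) (simp add: cplx_omat_cplx F4_in)

lemma cplx_cong: "(\<And>A. A \<in> jordan3 \<Longrightarrow> g A = h A) \<Longrightarrow> A \<in> jordan3 \<Longrightarrow> cplx g A = cplx h A"
  by (elim jordan3_cplx_cases) (simp add: cplx_omat_cplx)

lemma cplx_in_X_O:
  assumes g: "g \<in> F4" and A: "A \<in> X_O"
  shows "cplx g A \<in> X_O"
proof -
  obtain P Q where PQ: "P \<in> jordan3" "Q \<in> jordan3" "A = omat_cplx P Q"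
    using X_O_in_jordan3[OF A] by (rule jordan3_cplx_cases)
  with A show ?thesis
    by (simp add: cplx_omat_cplx omat_cplx_in_X_O_iff F4_in[OF g] F4_eq_0_iff[OF g] F4_0[OF g]
        flip: F4_jordan_prod[OF g])
qed

lemma herm_proj_clinear: "clinear (herm_proj :: complex omat \<Rightarrow> complex omat)"
proof -
  have "oct_re (c *\<^sub>C x) = c * oct_re x" for c and x :: "complex oct"
    by (simp add: oct_re_def scaleC_prod_def scaleC_complex_def)
  then show ?thesis
    by (simp add: clinear_def herm_proj_def herm_omat_add herm_omat_scaleC oct_re_add scaleC_nth)
qed

lemma cplx_clinear:
  assumes g: "g \<in> F4"
  shows "clinear (cplx g)"
proof -
  have add: "complexify g (A + B) = complexify g A + complexify g B" if "A \<in> jordan3" "B \<in> jordan3"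
      for A B
    using that by (elim jordan3_cplx_cases) (simp add: omat_cplx_add complexify_cplx F4_add[OF g])
  have mult: "complexify g (c *\<^sub>C A) = c *\<^sub>C complexify g A" if "A \<in> jordan3" for c A
    using that by (elim jordan3_cplx_cases)
      (simp add: omat_cplx_scaleC complexify_cplx F4_add[OF g] F4_diff[OF g] F4_scaleR[OF g]
          jordan3_scaleR)
  show ?thesis
    unfolding clinear_def cplx_def
    by (simp add: clinear_add[OF herm_proj_clinear] clinear_scaleC[OF herm_proj_clinear] add mult)
qed

lemma csymmetry_cplx:
  assumes g: "g \<in> F4"
  shows "csymmetry X_O (cplx g)"
proof -
  obtain h where h: "h \<in> F4" "\<And>A. A \<in> jordan3 \<Longrightarrow> h (g A) = A" "\<And>A. A \<in> jordan3 \<Longrightarrow> g (h A) = A"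
    using F4_inverse[OF g] by blast
  have inv: "cplx h (cplx g A) = A" "cplx g (cplx h A) = A" if "A \<in> jordan3" for A
    using that by (elim jordan3_cplx_cases, simp add: cplx_omat_cplx F4_in h g)+
  show ?thesis
    unfolding csymmetry_def using cplx_clinear[OF g] cplx_clinear[OF h(1)]
    by (intro conjI exI[of _ "cplx h"]) (auto simp: cplx_in_X_O g h inv X_O_in_jordan3)
qed

lemma cplx_herm:
  "cplx g (herm_omat a b c x y z) =
    omat_cplx (g (herm_omat (Re a) (Re b) (Re c) (oct_map Re x) (oct_map Re y) (oct_map Re z)))
      (g (herm_omat (Im a) (Im b) (Im c) (oct_map Im x) (oct_map Im y) (oct_map Im z)))"
proof -
  have "herm_omat a b c x y z =
    omat_cplx (herm_omat (Re a) (Re b) (Re c) (oct_map Re x) (oct_map Re y) (oct_map Re z))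
      (herm_omat (Im a) (Im b) (Im c) (oct_map Im x) (oct_map Im y) (oct_map Im z))"
    by (simp add: herm_omat_cplx oct_cplx_Re_Im)
  then show ?thesis by (simp add: cplx_omat_cplx)
qed

lemma cplx_cycle3: "cplx (ortho_conj cycle3) (herm_omat a b c x y z) = herm_omat b c a y z x"
  by (simp add: cplx_herm ortho_conj_cycle3 herm_omat_cplx oct_cplx_Re_Im)

lemma cplx_oct_dil: "\<exists>x'. cplx (unit_oct_action e) (herm_omat a b c x y z) =
    herm_omat a b c x' (oct_mult (oct_cplx (oct_conj e) 0) y) (oct_mult z (oct_cplx (oct_conj e)
        0))"
proof -
  have "oct_cplx (oct_mult e (oct_map Re v)) (oct_mult e (oct_map Im v)) =
      oct_mult (oct_cplx e 0) v"
    "oct_cplx (oct_mult (oct_map Re v) e) (oct_mult (oct_map Im v) e) = oct_mult v (oct_cplx e 0)"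
        for e v
    using oct_cplx_mult[of e 0 "oct_map Re v" "oct_map Im v"] oct_cplx_mult[of "oct_map Re v"
        "oct_map Im v" e 0]
    by (simp_all add: oct_cplx_Re_Im)
  then show ?thesis
    by (simp add: cplx_herm unit_oct_action_herm herm_omat_cplx del: split_paired_Ex)
qed

text \<open>\<open>jordan_null_relations\<close> asks for z \<noteq> 0; a cyclic permutation brings
  any nonzero off-diagonal entry there. A diagonal matrix of square 0 is 0.\<close>

lemma null_trace:
  assumes "herm_omat a b c x y z \<in> X_O"
  shows "a + b + c = 0"
proof -
  have n: "omat_mult (herm_omat a b c x y z) (herm_omat a b c x y z) = 0"
    using assms by (simp add: X_O_def)
  have n1: "omat_mult (herm_omat b c a y z x) (herm_omat b c a y z x) = 0"
    and n2: "omat_mult (herm_omat c a b z x y) (herm_omat c a b z x y) = 0"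
    using n by (auto simp: omat_mult_herm_square herm_omat_eq_0_iff ac_simps)
  show ?thesis
  proof (cases "x = 0 \<and> y = 0 \<and> z = 0")
    case True
    then show ?thesis using n by (simp add: omat_mult_herm_square herm_omat_eq_0_iff)
  next
    case False
    then show ?thesis
      using jordan_null_relations(1)[OF n] jordan_null_relations(1)[OF n1]
          jordan_null_relations(1)[OF n2]
      by (auto simp: ac_simps)
  qed
qed

text \<open>The points on whose whole orbit z_1 vanishes form an F_4-stable set. Unit octonions move
  every matrix coordinate of z into the place of z_1, and the cyclic permutation moves x and y into
  the place of z; so such a point has no off-diagonal entries, and A^2 = 0 makes it 0.\<close>

lemma exists_z1_nonzero:
  assumes p: "p \<in> X_O"
  obtains g where "g \<in> F4" "z1 (cplx g p) \<noteq> 0"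
proof (rule ccontr)
  assume "\<not> thesis"
  with that have bad: "\<forall>g\<in>F4. z1 (cplx g p) = 0" by blast
  define Bad where "Bad q \<longleftrightarrow> q \<in> X_O \<and> (\<forall>g\<in>F4. z1 (cplx g q) = 0)" for q
  have Bp: "Bad p" using bad p by (simp add: Bad_def)
  have Bg: "Bad (cplx g q)" if "Bad q" "g \<in> F4" for g q
    using that cplx_compose[OF that(2) X_O_in_jordan3] F4_comp[OF _ that(2)]
    by (auto simp: Bad_def cplx_in_X_O) metis
  have cyc: "ortho_conj cycle3 \<in> F4" by (rule ortho_conj_in_F4[OF orthogonal_cycle3])
  have Bc: "Bad (herm_omat b c a y z x)" if "Bad (herm_omat a b c x y z)" for a b c x y z
    using Bg[OF that cyc] by (simp add: cplx_cycle3)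
  have Br: "\<exists>x' y'. Bad (herm_omat a b c x' y' (oct_mult z (oct_cplx e 0)))"
    and Bl: "\<exists>x' y'. Bad (herm_omat a b c x' y' (oct_mult (oct_cplx e 0) z))"
    if B: "Bad (herm_omat a b c x y z)" and e: "oct_norm2 e = 1" for a b c x y z e
  proof -
    have eF: "unit_oct_action (oct_conj e) \<in> F4" using e by (intro unit_oct_action_in_F4) simp
    show "\<exists>x' y'. Bad (herm_omat a b c x' y' (oct_mult z (oct_cplx e 0)))"
      using cplx_oct_dil[of "oct_conj e" a b c x y z] Bg[OF B eF] by (metis oct_conj_conj)
    obtain x' z' where "Bad (herm_omat b c a x' (oct_mult (oct_cplx e 0) z) z')"
      using cplx_oct_dil[of "oct_conj e" b c a y z x] Bg[OF Bc[OF B] eF] by (metis oct_conj_conj)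
    from Bc[OF Bc[OF this]] show "\<exists>x' y'. Bad (herm_omat a b c x' y' (oct_mult (oct_cplx e 0) z))"
      by blast
  qed
  have id: "m1 = 0" if "Bad (herm_omat a b c x y (mat_oct m1 m2 m3 m4 n1 n2 n3 n4))"
      for a b c x y m1 m2 m3 m4 n1 n2 n3 n4
  proof -
    have "cplx id (herm_omat a b c x y (mat_oct m1 m2 m3 m4 n1 n2 n3 n4)) =
        herm_omat a b c x y (mat_oct m1 m2 m3 m4 n1 n2 n3 n4)"
      by (rule jordan3_cplx_cases[OF herm_omat_in_jordan3[of a b c x y "mat_oct m1 m2 m3 m4 n1 n2 n3
          n4"]])
        (simp add: cplx_omat_cplx)
    with that id_in_F4 show ?thesis unfolding Bad_def by (metis z1_herm)
  qed
  \<comment> \<open>Multiplication by these units from either side permutes the matrix coordinates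
    up to sign.\<close>
  have e2: "oct_cplx ((0,0,1,0),(0,0,0,0)) 0 = mat_oct 0 1 (-1) 0 0 0 0 0"
    and e4: "oct_cplx ((0,0,0,0),(1,0,0,0)) 0 = mat_oct 0 0 0 0 1 0 0 1"
    and e6: "oct_cplx ((0,0,0,0),(0,0,1,0)) 0 = mat_oct 0 0 0 0 0 1 (-1) 0"
    by (simp_all add: oct_cplx_simps zero_prod_def mat_oct_def mat_quat_def complex_eq_iff)
  have m: "m2 = 0 \<and> m3 = 0 \<and> n1 = 0 \<and> n2 = 0 \<and> n3 = 0 \<and> n4 = 0"
    if B: "Bad (herm_omat a b c x y (mat_oct m1 m2 m3 m4 n1 n2 n3 n4))" for a b c x y m1 m2 m3 m4 n1
        n2 n3 n4
    using Br[OF B, of "((0,0,1,0),(0,0,0,0))"] Bl[OF B, of "((0,0,1,0),(0,0,0,0))"]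
      Br[OF B, of "((0,0,0,0),(1,0,0,0))"] Bl[OF B, of "((0,0,0,0),(1,0,0,0))"]
      Br[OF B, of "((0,0,0,0),(0,0,1,0))"] Bl[OF B, of "((0,0,0,0),(0,0,1,0))"]
    by (auto simp: e2 e4 e6 mat_oct_mult simp del: split_paired_Ex dest!: id)
  have z0: "z = 0" if B: "Bad (herm_omat a b c x y z)" for a b c x y z
  proof -
    obtain m1 m2 m3 m4 n1 n2 n3 n4 where z: "z = mat_oct m1 m2 m3 m4 n1 n2 n3 n4"
        by (rule mat_oct_cases)
    note B' = B[unfolded z]
    \<comment> \<open>None of the six multiplications above brings m4 to the first place; right
      multiplication by e_2 brings it, up to sign, to the third, where \<open>m\<close>
      applies.\<close>
    have "\<exists>x' y'. Bad (herm_omat a b c x' y' (oct_mult z (oct_cplx ((0,0,1,0),(0,0,0,0)) 0)))"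
      by (rule Br[OF B]) simp
    then have "m4 = 0"
      by (auto simp: e2 z mat_oct_mult simp del: split_paired_Ex dest!: m)
    with m[OF B'] id[OF B'] show ?thesis
      by (simp add: z mat_oct_def mat_quat_def zero_prod_def)
  qed
  obtain a b c x y z where p': "p = herm_omat a b c x y z"
    using X_O_in_jordan3[OF p] by (rule jordan3_cases)
  note B = Bp[unfolded p']
  have "z = 0" "x = 0" "y = 0"
    using z0[OF B] z0[OF Bc[OF B]] z0[OF Bc[OF Bc[OF B]]] by auto
  then show False
    using p by (auto simp: p' X_O_def omat_mult_herm_square herm_omat_eq_0_iff)
qed

text \<open>Otherwise the linear form \<open>z\<^sub>1 \<circ> g\<close> would vanish at all points of \<open>\<bbbX>\<^sub>\<bbbO>\<close> with \<open>z\<^sub>1 \<noteq> 0\<close>,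
  which span the matrices of trace 0, and hence on all of \<open>\<bbbX>\<^sub>\<bbbO>\<close>.\<close>

lemma z1_meets:
  assumes g: "g \<in> F4"
  obtains q where "q \<in> X_O" "z1 q \<noteq> 0" "z1 (cplx g q) \<noteq> 0"
proof (rule ccontr)
  assume "\<not> thesis"
  with that have bad: "z1 (cplx g q) = 0" if "q \<in> X_O" "z1 q \<noteq> 0" for q
    using that by blast
  define l where "l = (\<lambda>q. z1 (cplx g q))"
  have l: "clinear l"
    using clinear_compose[OF clinear_coord cplx_clinear[OF g]]
    by (simp add: l_def z1_eq_coord clinear_def scaleC_nth)
  note l_add = clinear_add[OF l] and l_mult = clinear_scaleC[OF l, unfolded scaleC_complex_def]
  define m where "m x = quat_matrix (fst x) $ 1 $ 1" for x :: "complex oct"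
  have m_add: "m (x + y) = m x + m y" for x y
    by (simp add: m_def quat_matrix_add)
  have z1m: "z1 (herm_omat a b c x y z) = m z" for a b c x y z
    by (simp add: z1_def m_def)
  define L where "L a b c x y z = l (herm_omat a b c x y z)" for a b c x y z
  have La: "L (a + a') (b + b') (c + c') (x + x') (y + y') (z + z') = L a b c x y z +
      L a' b' c' x' y' z'"
    for a b c x y z a' b' c' x' y' z'
    by (simp add: L_def flip: herm_omat_add l_add)
  have Ls: "L (r * a) (r * b) (r * c) (oct_smult r x) (oct_smult r y) (oct_smult r z) =
      r * L a b c x y z"
    for r a b c x y z
    by (simp add: L_def herm_omat_scaleC[unfolded scaleC_oct, symmetric] l_mult)
  have ne: "herm_omat a b c x y z \<noteq> 0" if "m z \<noteq> 0" for a b c x y z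
    using that by (auto simp: herm_omat_eq_0_iff m_def zero_prod_def vector_2)
  have N: "oct_norm2 (oct_scalar r) = r * r" for r :: complex by (simp add: oct_scalar_eq)
  \<comment> \<open>Explicit points of \<open>X_O\<close> with z essentially free, in three
    families. Adding the points for \<xi> and -\<xi> cancels the diagonal, which shows in turn that
    l vanishes on the z-, y- and x-entries.\<close>
  have 1: "L \<xi> (- \<xi>) 0 0 0 z = 0" if "\<xi> * \<xi> = - oct_norm2 z" "m z \<noteq> 0" for \<xi> z
    unfolding L_def l_def using that ne[OF that(2)]
    by (intro bad) (simp_all add: X_O_def omat_mult_herm_square z1m herm_omat_0)
  have 2: "L \<xi> (- \<xi> / 2) (- \<xi> / 2) (oct_scalar (- \<xi> / 2)) (oct_conj z) z = 0"
    if "\<xi> * \<xi> = - 2 * oct_norm2 z" "m z \<noteq> 0" for \<xi> z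
    unfolding L_def l_def using that ne[OF that(2)]
    by (intro bad) (simp_all add: X_O_def omat_mult_herm_square z1m herm_omat_eq_0_iff N
        oct_scalar_add[symmetric] oct_smult_add_left[symmetric], simp_all add: oct_scalar_eq
            field_simps zero_prod_def)
  have 3: "L (- \<xi> / 2) \<xi> (- \<xi> / 2) (oct_conj z) (oct_scalar (- \<xi> / 2)) z = 0"
    if "\<xi> * \<xi> = - 2 * oct_norm2 z" "m z \<noteq> 0" for \<xi> z
    unfolding L_def l_def using that ne[OF that(2)]
    by (intro bad) (simp_all add: X_O_def omat_mult_herm_square z1m herm_omat_eq_0_iff N
        oct_scalar_add[symmetric] oct_smult_add_left[symmetric], simp_all add: oct_scalar_eq
            field_simps zero_prod_def)
  have sq: "\<exists>\<xi>. \<xi> * \<xi> = w" for w :: complex by (metis power2_csqrt power2_eq_square)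
  \<comment> \<open>An additive function that vanishes off the hyperplane m = 0 vanishes on it too:
    shift by an element n with m n = 1.\<close>
  have all: "f z = (0::complex)"
    if "\<And>z. m z \<noteq> 0 \<Longrightarrow> f z = 0" "\<And>x y. f (x + y) = f x + f y" for f z
  proof (cases "m z = 0")
    case True
    define n :: "complex oct" where "n = oct_scalar 1"
    have "m n = 1" by (simp add: n_def m_def oct_scalar_eq vector_2)
    then have "f (z + n) = 0" "f n = 0" using that(1) True by (simp_all add: m_add)
    then show ?thesis using that(2)[of z n] by simp
  qed (use that in auto)
  have Lz: "L 0 0 0 0 0 z = 0" for z
  proof (rule all[of "\<lambda>z. L 0 0 0 0 0 z" z])
    fix z assume z: "m z \<noteq> 0"
    obtain \<xi> where "\<xi> * \<xi> = - oct_norm2 z" using sq by blast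
    then have "L (\<xi> + (- \<xi>)) (- \<xi> + \<xi>) (0 + 0) (0 + 0) (0 + 0) (z + z) = 0"
      unfolding La using 1[of \<xi> z] 1[of "- \<xi>" z] z by simp
    then have "L (0 + 0) (0 + 0) (0 + 0) (0 + 0) (0 + 0) (z + z) = 0" by simp
    then show "L 0 0 0 0 0 z = 0" unfolding La by simp
  qed (use La[of 0 0 0 0 0 0 0 0 0 0] in auto)
  have Ly: "L 0 0 0 0 (oct_conj z) 0 = 0" for z
  proof (rule all[of "\<lambda>z. L 0 0 0 0 (oct_conj z) 0" z])
    fix z assume z: "m z \<noteq> 0"
    obtain \<xi> where x: "\<xi> * \<xi> = - 2 * oct_norm2 z" using sq by blast
    have "L (\<xi> + (- \<xi>)) (- \<xi> / 2 + - (- \<xi>) / 2) (- \<xi> / 2 + - (- \<xi>) / 2) (oct_scalar (- \<xi> / 2) +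
        oct_scalar (- (- \<xi>) / 2))
       (oct_conj z + oct_conj z) (z + z) = 0"
      unfolding La using 2[of \<xi> z] 2[of "- \<xi>" z] z x by simp
    then have "L (0 + 0) (0 + 0) (0 + 0) (0 + 0) (oct_conj z + oct_conj z) (z + z) = 0"
      by (simp flip: oct_scalar_add)
    then have "L 0 0 0 0 (oct_conj z) z = 0" unfolding La by simp
    then show "L 0 0 0 0 (oct_conj z) 0 = 0"
      using La[of 0 0 0 0 0 0 0 0 "oct_conj z" 0 0 z] Lz[of z] by simp
  qed (use La[of 0 0 0 0 0 0 0 0 _ _ 0 0] in \<open>auto simp: oct_conj_add\<close>)
  have Lx: "L 0 0 0 (oct_conj z) 0 0 = 0" for z
  proof (rule all[of "\<lambda>z. L 0 0 0 (oct_conj z) 0 0" z])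
    fix z assume z: "m z \<noteq> 0"
    obtain \<xi> where x: "\<xi> * \<xi> = - 2 * oct_norm2 z" using sq by blast
    have "L (- \<xi> / 2 + - (- \<xi>) / 2) (\<xi> + (- \<xi>)) (- \<xi> / 2 + - (- \<xi>) / 2) (oct_conj z +
        oct_conj z) (oct_scalar (- \<xi> / 2) + oct_scalar (- (- \<xi>) / 2))
       (z + z) = 0"
      unfolding La using 3[of \<xi> z] 3[of "- \<xi>" z] z x by simp
    then have "L (0 + 0) (0 + 0) (0 + 0) (oct_conj z + oct_conj z) (0 + 0) (z + z) = 0"
      by (simp flip: oct_scalar_add)
    then have "L 0 0 0 (oct_conj z) 0 z = 0" unfolding La by simp
    then show "L 0 0 0 (oct_conj z) 0 0 = 0"
      using La[of 0 0 0 0 0 0 "oct_conj z" 0 0 0 0 z] Lz[of z] by simp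
  qed (use La[of 0 0 0 0 0 0 _ _ 0 0 0 0] in \<open>auto simp: oct_conj_add\<close>)
  have Lxyz: "L a b c x y z = L a b c 0 0 0" for a b c x y z
    using La[of a 0 b 0 c 0 0 x 0 y 0 z] La[of 0 0 0 0 0 0 x 0 0 y 0 z] La[of 0 0 0 0 0 0 0 0 y 0 0
        z]
      Lx[of "oct_conj x"] Ly[of "oct_conj y"] Lz[of z] by simp
  have m1: "m (oct_scalar 1) \<noteq> 0" by (simp add: m_def oct_scalar_eq vector_2)
  \<comment> \<open>One point of the first family and one of the second now show that l is a
    multiple of the trace on diagonal matrices.\<close>
  obtain \<xi> :: complex where x: "\<xi> * \<xi> = -1" using sq by blast
  then have x0: "\<xi> \<noteq> 0" by auto
  have E12: "L \<xi> (- \<xi>) 0 0 0 0 = 0"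
    using 1[of \<xi> "oct_scalar 1"] m1 x Lxyz[of \<xi> "- \<xi>" 0 0 0 "oct_scalar 1"] by (simp add: N)
  obtain \<eta> :: complex where y: "\<eta> * \<eta> = -2" using sq by blast
  then have y0: "\<eta> \<noteq> 0" by auto
  have E123: "L \<eta> (- \<eta> / 2) (- \<eta> / 2) 0 0 0 = 0"
    using 2[of \<eta> "oct_scalar 1"] m1 y Lxyz[of \<eta> "- \<eta> / 2" "- \<eta> / 2" "oct_scalar (- \<eta> / 2)"
        "oct_scalar 1" "oct_scalar 1"] by (simp add: N)
  have Labc: "L a b c 0 0 0 = a * L 1 0 0 0 0 0 + b * L 0 1 0 0 0 0 + c * L 0 0 1 0 0 0" for a b c
    using La[of a 0 0 b 0 c 0 0 0 0 0 0] La[of 0 0 b 0 0 c 0 0 0 0 0 0] Ls[of a 1 0 0 0 0 0]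
      Ls[of b 0 1 0 0 0 0] Ls[of c 0 0 1 0 0 0] by simp
  have E: "L 0 1 0 0 0 0 = L 1 0 0 0 0 0"
    using E12 x0 unfolding Labc[of \<xi>] by (simp add: algebra_simps)
  have E': "L 0 0 1 0 0 0 = L 1 0 0 0 0 0"
    using E123 y0 unfolding Labc[of \<eta>] E by (simp add: field_simps)
  have l0: "l p = 0" if pX: "p \<in> X_O" for p
  proof -
    obtain a b c x y z where p: "p = herm_omat a b c x y z"
      using X_O_in_jordan3[OF pX] by (rule jordan3_cases)
    have "l p = L a b c 0 0 0" using Lxyz[of a b c x y z] by (simp add: L_def p)
    also have "\<dots> = (a + b + c) * L 1 0 0 0 0 0" unfolding Labc[of a b c] E E'
        by (simp add: algebra_simps)
    also have "\<dots> = 0" using null_trace pX p by simp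
    finally show ?thesis .
  qed
  obtain h where h: "h \<in> F4" "\<And>A. A \<in> jordan3 \<Longrightarrow> h (g A) = A" "\<And>A. A \<in> jordan3 \<Longrightarrow> g (h A) = A"
    using F4_inverse[OF g] by blast
  \<comment> \<open>Any point with z_1 \<noteq> 0 contradicts the vanishing of l on
    \<open>X_O\<close>, since l takes the value z_1 of q at the image of q under the inverse of
    g.\<close>
  define q where "q = Phi (\<chi> i. 1)"
  have q: "q \<in> X_O" "z1 q \<noteq> 0"
    unfolding q_def z1_eq_coord coord_Phi by (rule Phi_in_X_O; simp) simp
  have "cplx g (cplx h q) = q"
    using X_O_in_jordan3[OF q(1)] by (elim jordan3_cplx_cases) (simp add: cplx_omat_cplx F4_in h)
  then show False using l0[OF cplx_in_X_O[OF h(1) q(1)]] q(2) by (simp add: l_def)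
qed

section \<open>Invariance of \<open>\<Omega>\<^sub>\<bbbO>\<close>\<close>

lemma omat_mult_scaleC: "omat_mult (c *\<^sub>C A) (c *\<^sub>C A) = (c * c) *\<^sub>C omat_mult A (A :: complex
    omat)"
  by (rule omat_eqI) (simp add: omat_mult_def scaleC_nth sum_3 scaleC_oct oct_mult_smult_left
      oct_mult_smult_right oct_smult_add_right)

lemma scaleC_in_X_O:
  assumes "A \<in> X_O" "c \<noteq> 0"
  shows "c *\<^sub>C A \<in> X_O"
proof -
  have "c *\<^sub>C A \<in> jordan3"
    using X_O_in_jordan3[OF assms(1)] by (elim jordan3_cases) (simp add: herm_omat_scaleC)
  moreover have "c *\<^sub>C A \<noteq> 0"
  proof
    assume "c *\<^sub>C A = 0"
    then have "(inverse c * c) *\<^sub>C A = inverse c *\<^sub>C 0" by (simp flip: scaleC_scaleC)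
    then have "A = inverse c *\<^sub>C 0" using assms(2) by (simp add: scaleC_one)
    also have "\<dots> = 0" by (rule clinear_0[OF clinear_scaleC_right])
    finally show False using assms(1) by (simp add: X_O_def)
  qed
  ultimately show ?thesis
    using assms(1) clinear_0[OF clinear_scaleC_right, of "c * c"]
        by (simp add: X_O_def omat_mult_scaleC)
qed

lemma csymmetry_scaleC: "c \<noteq> 0 \<Longrightarrow> csymmetry X_O (\<lambda>A. c *\<^sub>C A)"
  unfolding csymmetry_def
  by (intro conjI exI[of _ "\<lambda>A. inverse c *\<^sub>C A"])
    (auto simp: clinear_scaleC_right scaleC_in_X_O scaleC_scaleC scaleC_one)

lemma X_O_chart:
  assumes p: "p \<in> X_O"
  obtains h u \<psi> where "h \<in> F4" "linear_chart X_O {u. u $ 2 \<noteq> 0} (\<lambda>u. cplx h (Phi u)) \<psi>"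
    "u $ 2 \<noteq> 0" "cplx h (Phi u) = p"
proof -
  obtain g where g: "g \<in> F4" "z1 (cplx g p) \<noteq> 0"
    using exists_z1_nonzero[OF p] .
  obtain h where h: "h \<in> F4" "\<And>A. A \<in> jordan3 \<Longrightarrow> h (g A) = A" "\<And>A. A \<in> jordan3 \<Longrightarrow> g (h A) = A"
    using F4_inverse[OF g(1)] by blast
  have hg: "cplx h (cplx g p) = p"
    using X_O_in_jordan3[OF p] by (elim jordan3_cplx_cases) (simp add: cplx_omat_cplx F4_in g h)
  obtain \<psi> where "linear_chart X_O {u. u $ 2 \<noteq> 0} (\<lambda>u. cplx h (Phi u)) \<psi>"
    using csymmetry_chart[OF csymmetry_cplx[OF h(1)] linear_chart_Phi] .
  then show thesis
    using g h(1) hg Phi_coord[OF cplx_in_X_O[OF g(1) p]]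
    by (intro that[of h \<psi> "coord (cplx g p)"]) (simp_all add: z1_eq_coord)
qed

lemma holomorphic_along_line:
  fixes f :: "complex ^ 'k::finite \<Rightarrow> complex"
  assumes "\<And>t. cdifferentiable f (u + t *\<^sub>C v)"
  shows "(\<lambda>t. f (u + t *\<^sub>C v)) holomorphic_on UNIV"
proof -
  have "\<exists>f'. ((\<lambda>t. f (u + t *\<^sub>C v)) has_field_derivative f') (at t)" for t
  proof -
    obtain D where D: "clinear D" "(f has_derivative D) (at (u + t *\<^sub>C v))"
      using assms unfolding cdifferentiable_def by blast
    have "((\<lambda>t. u + t *\<^sub>C v) has_derivative (\<lambda>t. t *\<^sub>C v)) (at t)"
      by (rule has_derivative_eq_rhs[OF has_derivative_add[OF has_derivative_const
            bounded_linear_imp_has_derivative[OF clinear_imp_bounded_linear[OF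
                clinear_scaleC_left]]]]) simp
    from has_derivative_compose[OF this D(2)]
    have "((\<lambda>t. f (u + t *\<^sub>C v)) has_derivative (\<lambda>t. t * D v)) (at t)"
      by (simp add: clinear_scaleC[OF D(1)] scaleC_complex_def)
    moreover have "(*) (D v) = (\<lambda>t. t * D v)" by auto
    ultimately show ?thesis
      unfolding has_field_derivative_def by metis
  qed
  then show ?thesis by (simp add: holomorphic_on_open)
qed

text \<open>\<open>Phi\<close> inverts the linear map \<open>coord\<close> on the cone
  \<open>X_O\<close>, so it is homogeneous of degree 1.\<close>

lemma Phi_scaleC: 
  assumes "u $ 2 \<noteq> 0" "c \<noteq> 0"
  shows "Phi (c *\<^sub>C u) = c *\<^sub>C Phi u"
  using Phi_coord[OF scaleC_in_X_O[OF Phi_in_X_O[OF assms(1)] assms(2)]] assms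
  by (simp add: clinear_scaleC[OF clinear_coord] coord_Phi scaleC_nth scaleC_complex_def)

text \<open>The set where \<open>z\<^sub>1\<close> does not vanish is dense: along a suitable line in a chart, \<open>z\<^sub>1\<close> is
  an entire function that is not identically zero.\<close>

lemma X_O_continuous_constant:
  fixes F :: "complex omat \<Rightarrow> 'a::t1_space"
  assumes F: "continuous_on X_O F" and k: "\<And>q. q \<in> X_O \<Longrightarrow> z1 q \<noteq> 0 \<Longrightarrow> F q = k" and p: "p \<in> X_O"
  shows "F p = k"
proof (rule ccontr)
  assume ne: "F p \<noteq> k"
  obtain h u0 \<psi> where h: "h \<in> F4" and chart: "linear_chart X_O {u. u $ 2 \<noteq> 0} (\<lambda>u. cplx h (Phi u))
      \<psi>"
    and u0: "u0 $ 2 \<noteq> 0" "cplx h (Phi u0) = p"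
    by (rule X_O_chart[OF p])
  obtain q where q: "q \<in> X_O" "z1 q \<noteq> 0" "z1 (cplx h q) \<noteq> 0"
    by (rule z1_meets[OF h])
  \<comment> \<open>Rescaling q gives it the same z_1-coordinate as u0, so the whole complex line
    through u0 and u1 stays in the chart domain.\<close>
  define \<kappa> where "\<kappa> = u0 $ 2 / coord q $ 2"
  have \<kappa>0: "\<kappa> \<noteq> 0" using u0 q by (simp add: \<kappa>_def z1_eq_coord)
  define u1 where "u1 = \<kappa> *\<^sub>C coord q"
  have u12: "u1 $ 2 = u0 $ 2"
    using q by (simp add: u1_def scaleC_nth scaleC_complex_def \<kappa>_def z1_eq_coord)
  have "Phi u1 = \<kappa> *\<^sub>C q"
    unfolding u1_def using Phi_scaleC[OF _ \<kappa>0, of "coord q"] q Phi_coord[OF q(1)]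
        by (simp add: z1_eq_coord)
  then have z1u1: "z1 (cplx h (Phi u1)) \<noteq> 0"
    using q(3) \<kappa>0 by (simp add: z1_eq_coord clinear_scaleC[OF clinear_coord]
        clinear_scaleC[OF cplx_clinear[OF h]] scaleC_nth scaleC_complex_def)
  define l where "l t = u0 + t *\<^sub>C (u1 - u0)" for t :: complex
  have l2: "l t $ 2 \<noteq> 0" for t
    using u0(1) u12 by (simp add: l_def scaleC_nth scaleC_complex_def)
  have cd: "cdifferentiable (\<lambda>u. cplx h (Phi u)) (l t)" for t
    using chart_cdiff[OF chart] l2 by simp
  have "cdifferentiable (\<lambda>u. z1 (cplx h (Phi u))) (l t)" for t
    unfolding z1_eq_coord
    by (rule cdifferentiable_compose[where f = "\<lambda>A. coord A $ 2" and g = "\<lambda>u. cplx h (Phi u)", OF _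
        cd])
      (intro cdifferentiable_clinear, use clinear_coord in \<open>simp add: clinear_def scaleC_nth\<close>)
  then have hol: "(\<lambda>t. z1 (cplx h (Phi (l t)))) holomorphic_on UNIV"
    unfolding l_def by (rule holomorphic_along_line)
  have l_cont: "isCont l t" for t
    unfolding l_def by (intro continuous_intros linear_continuous_at clinear_imp_bounded_linear
        clinear_scaleC_left)
  have "isCont (\<lambda>u. cplx h (Phi u)) (l t)" for t
    using cd has_derivative_continuous unfolding cdifferentiable_def by blast
  then have "continuous_on UNIV (\<lambda>t. cplx h (Phi (l t)))"
    by (intro continuous_at_imp_continuous_on ballI isCont_o2[OF l_cont])
  moreover have inX: "cplx h (Phi (l t)) \<in> X_O" for t
    using chart_in[OF chart] l2 by simp
  ultimately have Fc: "continuous_on UNIV (\<lambda>t. F (cplx h (Phi (l t))))"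
    by (intro continuous_on_compose2[OF F]) auto
  \<comment> \<open>At parameters where F differs from k, z_1 vanishes. They form an open set
    containing 0, so by the identity theorem z_1 would vanish along the whole line, but it does not
    at u1.\<close>
  define S where "S = (\<lambda>t. F (cplx h (Phi (l t)))) -` (- {k})"
  have "open S"
    unfolding S_def using Fc by (intro open_vimage) auto
  moreover have "0 \<in> S" using ne u0 by (simp add: S_def l_def)
  moreover have "z1 (cplx h (Phi (l t))) = 0" if "t \<in> S" for t
    using that k[OF inX[of t]] by (auto simp: S_def)
  ultimately have "z1 (cplx h (Phi (l 1))) = 0"
    using analytic_continuation_open[of S UNIV "\<lambda>t. z1 (cplx h (Phi (l t)))" "\<lambda>_. 0" 1] hol
    by (auto intro: holomorphic_intros)
  with z1u1 show False by (simp add: l_def scaleC_one)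
qed

lemma continuous_omat_square: "continuous_on UNIV (\<lambda>A :: complex omat. omat_mult A A)"
proof -
  have s: "r *\<^sub>R x = oct_smult (of_real r) x" for r and x :: "complex oct"
    by (simp add: scaleR_scaleC scaleC_oct)
  have "bilinear (oct_mult :: complex oct \<Rightarrow> _)"
    unfolding bilinear_def
    by (intro conjI allI linearI) (simp_all add: oct_mult_add_left oct_mult_add_right s
        oct_mult_smult_left oct_mult_smult_right)
  then have "bounded_bilinear (oct_mult :: complex oct \<Rightarrow> _)"
    by (simp add: bilinear_conv_bounded_bilinear)
  note cont = bounded_bilinear.continuous_on[OF this]
  show ?thesis
    unfolding omat_mult_def
    by (intro continuous_on_vec_lambda continuous_on_sum cont continuous_intros)
qed

lemma compact_X_O_sphere: "compact {A \<in> X_O. norm A = 1}"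
proof -
  have eq: "{A \<in> X_O. norm A = 1} = {A. herm_proj A = A} \<inter> {A. omat_mult A A = 0} \<inter> sphere 0 1"
    using herm_proj_id by (auto simp: X_O_def) (metis herm_proj_in)
  moreover have "closed {A :: complex omat. herm_proj A = A}"
    by (intro closed_Collect_eq continuous_on_id linear_continuous_on clinear_imp_bounded_linear
        herm_proj_clinear)
  moreover have "closed {A :: complex omat. omat_mult A A = 0}"
    by (intro closed_Collect_eq continuous_omat_square continuous_on_const)
  ultimately show ?thesis
    unfolding eq by (intro closed_Int_compact closed_Int compact_sphere)
qed

section \<open>The factor by which F_4 multiplies \<Omega>\<close>

context
  fixes \<Omega> :: "(complex omat, 16) form"
  assumes Omega: "is_Omega_O \<Omega>"
begin

interpretation charted_form X_O \<Omega>
proof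
  show "holomorphic_top_form X_O \<Omega>" "nowhere_vanishing X_O \<Omega>"
    using Omega by (simp_all add: is_Omega_O_def)
  fix p assume p: "p \<in> X_O"
  obtain h u \<psi> where "linear_chart X_O {u. u $ 2 \<noteq> 0} (\<lambda>u. cplx h (Phi u)) \<psi>" "u $ 2 \<noteq> 0"
      "cplx h (Phi u) = p"
    by (rule X_O_chart[OF p])
  then show "\<exists>U \<phi> \<psi> u. linear_chart X_O U (\<phi> :: complex ^ 16 \<Rightarrow> complex omat) \<psi> \<and> u \<in> U \<and> \<phi> u = p"
    by blast
qed

text \<open>The value is c^(-5) c^16 = c^11. Only its independence of p matters below, so the
  determinant stays unevaluated.\<close>

lemma factor_scaleC:
  assumes c: "c \<noteq> 0" and p: "p \<in> X_O"
  shows "factor X_O \<Omega> (\<lambda>A. c *\<^sub>C A) p = c powi (- 5) * det (\<chi> i j. if i = j then c else 0 :: complex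
      ^ 16 ^ 16)"
proof (rule X_O_continuous_constant[OF continuous_factor[OF csymmetry_scaleC[OF c]] _ p])
  fix q assume q: "q \<in> X_O" "z1 q \<noteq> 0"
  define u where "u = coord q"
  have u: "u \<in> {u. u $ 2 \<noteq> 0}" using q by (simp add: u_def z1_eq_coord)
  have qu: "Phi u = q" using q by (simp add: u_def Phi_coord z1_eq_coord)
  obtain \<psi> where chart: "linear_chart X_O {u. u $ 2 \<noteq> 0} (\<lambda>u. c *\<^sub>C Phi u) \<psi>"
    using csymmetry_chart[OF csymmetry_scaleC[OF c] linear_chart_Phi] .
  define D where "D = frechet_derivative Phi (at u)"
  have tan: "D w \<in> tangent_space X_O q" for w
    using chart_tangent_space[OF linear_chart_Phi u] by (simp add: D_def qu)
  have cD: "coord (D w) = w" for w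
    unfolding D_def by (rule chart_derivative_inverse[OF linear_chart_Phi u])
  have wedge: "wedge_differentials coord r v = det (\<chi> i j. coord (v j) $ i)" for r v
  proof -
    have "frechet_derivative (\<lambda>q. coord q $ i) (at r) w = coord w $ i" for i w
    proof -
      have "clinear (\<lambda>q. coord q $ i)" using clinear_coord by (simp add: clinear_def scaleC_nth)
      from frechet_derivative_at[OF bounded_linear_imp_has_derivative[OF
          clinear_imp_bounded_linear[OF this]], of r]
      show ?thesis by metis
    qed
    then show ?thesis by (simp add: wedge_differentials_def)
  qed
  have form: "\<Omega> r v = z1 r powi (- 5) * det (\<chi> i j. coord (v j) $ i)"
    if "r \<in> X_O" "z1 r \<noteq> 0" "\<And>i. v i \<in> tangent_space X_O r" for r v
    using Omega that unfolding is_Omega_O_def form_eq_on_def wedge by blast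
  have z1c: "z1 (c *\<^sub>C q) = c * z1 q"
    by (simp add: z1_eq_coord clinear_scaleC[OF clinear_coord] scaleC_nth scaleC_complex_def)
  \<comment> \<open>\<open>coord\<close> inverts D, so this frame has the identity as its coordinate
    matrix.\<close>
  have "\<Omega> q (\<lambda>i. D (axis i 1)) = z1 q powi (- 5)"
    using form[OF q tan] by (simp add: cD axis_def) (simp add: det_diagonal)
  moreover have "\<Omega> (c *\<^sub>C q) (\<lambda>i. c *\<^sub>C D (axis i 1)) = (c * z1 q) powi (- 5) * det (\<chi> i j. if i =
      j then c else 0 :: complex ^ 16 ^ 16)"
  proof -
    have "\<Omega> (c *\<^sub>C q) (\<lambda>i. c *\<^sub>C D (axis i 1)) = z1 (c *\<^sub>C q) powi (- 5) * det (\<chi> i j. coord (c *\<^sub>C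
        D (axis j 1)) $ i)"
      by (rule form) (use q c in \<open>simp_all add: z1c scaleC_in_X_O csymmetry_tangent[OF
          csymmetry_scaleC] tan\<close>)
    also have "(\<chi> i j. coord (c *\<^sub>C D (axis j 1)) $ i) = (\<chi> i j. if i = j then c else 0 :: complex ^
        16 ^ 16)"
      by (simp add: vec_eq_iff clinear_scaleC[OF clinear_coord] cD scaleC_nth scaleC_complex_def
          axis_def)
    finally show ?thesis by (simp add: z1c)
  qed
  moreover have "\<Omega> (c *\<^sub>C q) (\<lambda>i. c *\<^sub>C D (axis i 1)) = factor X_O \<Omega> (\<lambda>A. c *\<^sub>C A) q * \<Omega> q (\<lambda>i. D
      (axis i 1))"
    by (rule factor_eq[OF csymmetry_scaleC[OF c] q(1) tan])
  ultimately show "factor X_O \<Omega> (\<lambda>A. c *\<^sub>C A) q = c powi (- 5) * det (\<chi> i j. if i =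
      j then c else 0 :: complex ^ 16 ^ 16)"
    using q(2) by (simp add: power_int_mult_distrib)
qed

text \<open>\<open>cplx g\<close> commutes with scaling, and the scaling has the same nonzero factor
  at p and at its image, so comparing the two orders of composition cancels it.\<close>

lemma factor_homogeneous:
  assumes g: "g \<in> F4" and c: "c \<noteq> 0" and p: "p \<in> X_O"
  shows "factor X_O \<Omega> (cplx g) (c *\<^sub>C p) = factor X_O \<Omega> (cplx g) p"
proof -
  note S = csymmetry_scaleC[OF c] and T = csymmetry_cplx[OF g]
  have "cplx g \<circ> (\<lambda>A. c *\<^sub>C A) = (\<lambda>A. c *\<^sub>C A) \<circ> cplx g"
    by (auto simp: clinear_scaleC[OF cplx_clinear[OF g]])
  then have "factor X_O \<Omega> (cplx g) (c *\<^sub>C p) * factor X_O \<Omega> (\<lambda>A. c *\<^sub>C A) p =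
      factor X_O \<Omega> (\<lambda>A. c *\<^sub>C A) (cplx g p) * factor X_O \<Omega> (cplx g) p"
    using factor_compose[OF T S p] factor_compose[OF S T p] by simp
  then show ?thesis
    using factor_nonzero[OF S p] factor_scaleC[OF c p] factor_scaleC[OF c cplx_in_X_O[OF g p]]
        by simp
qed

lemma factor_bounded:
  assumes g: "g \<in> F4"
  obtains M where "\<And>p. p \<in> X_O \<Longrightarrow> norm (factor X_O \<Omega> (cplx g) p) \<le> M"
proof -
  have "compact (factor X_O \<Omega> (cplx g) ` {A \<in> X_O. norm A = 1})"
    by (intro compact_continuous_image compact_X_O_sphere
        continuous_on_subset[OF continuous_factor[OF csymmetry_cplx[OF g]]]) auto
  then obtain M where M: "\<And>p. p \<in> X_O \<Longrightarrow> norm p = 1 \<Longrightarrow> norm (factor X_O \<Omega> (cplx g) p) \<le> M"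
    using compact_imp_bounded bounded_iff by (metis (mono_tags, lifting) imageI mem_Collect_eq)
  show thesis
  proof (rule that)
    fix p assume p: "p \<in> X_O"
    define c where "c = complex_of_real (1 / norm p)"
    have p0: "norm p \<noteq> 0" using p by (simp add: X_O_def)
    then have c: "c \<noteq> 0" by (simp add: c_def)
    have "norm (c *\<^sub>C p) = 1" unfolding c_def scaleR_scaleC[symmetric] using p0 by simp
    then show "norm (factor X_O \<Omega> (cplx g) p) \<le> M"
      using M[OF scaleC_in_X_O[OF p c]] factor_homogeneous[OF g c p] by simp
  qed
qed

text \<open>On an affine line of the chart along which \<open>z\<^sub>1\<close> is constant the factor is a bounded
  entire function, and homogeneity takes care of the remaining direction.\<close>

lemma factor_constant:
  assumes g: "g \<in> F4" and p: "p \<in> X_O" and q: "q \<in> X_O"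
  shows "factor X_O \<Omega> (cplx g) p = factor X_O \<Omega> (cplx g) q"
proof -
  define F where "F = factor X_O \<Omega> (cplx g)"
  note T = csymmetry_cplx[OF g]
  obtain \<psi> where chart: "linear_chart X_O {u. u $ 2 \<noteq> 0} (\<lambda>u. cplx g (Phi u)) \<psi>"
    using csymmetry_chart[OF T linear_chart_Phi] .
  obtain M where M: "\<And>p. p \<in> X_O \<Longrightarrow> norm (F p) \<le> M"
    unfolding F_def by (rule factor_bounded[OF g]) blast
  have Fu: "F (Phi u) = coef \<Omega> (\<lambda>u. cplx g (Phi u)) u * inverse (coef \<Omega> Phi u)" if "u $ 2 \<noteq> 0" for u
    unfolding F_def using factor_chart(1)[OF T linear_chart_Phi] that by (simp add: divide_inverse)
  have line: "F (Phi (u + v)) = F (Phi u)" if u: "u $ 2 \<noteq> 0" and v: "v $ 2 = 0" for u v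
  proof -
    define G where "G u = coef \<Omega> (\<lambda>u. cplx g (Phi u)) u * inverse (coef \<Omega> Phi u)" for u
    have in_U: "(u + t *\<^sub>C v) $ 2 \<noteq> 0" for t
      using u v by (simp add: scaleC_nth scaleC_complex_def)
    have "cdifferentiable G (u + t *\<^sub>C v)" for t
      unfolding G_def
      using coef_holomorphic[OF chart] coef_holomorphic[OF linear_chart_Phi]
        coef_nonzero[OF linear_chart_Phi, of "u + t *\<^sub>C v"] in_U[of t]
      by (intro cdifferentiable_mult cdifferentiable_inverse) (auto simp: cholomorphic_on_iff)
    then have hol: "(\<lambda>t. G (u + t *\<^sub>C v)) holomorphic_on UNIV"
      by (rule holomorphic_along_line)
    have "norm (G (u + t *\<^sub>C v)) \<le> M" for t
      using M[OF Phi_in_X_O[OF in_U[of t]]] Fu[OF in_U[of t]] by (simp add: G_def)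
    then have "bounded (range (\<lambda>t. G (u + t *\<^sub>C v)))"
      unfolding bounded_iff by blast
    from Liouville_theorem[OF hol this] have "G (u + 1 *\<^sub>C v) = G (u + 0 *\<^sub>C v)"
      unfolding constant_on_def by (metis UNIV_I)
    then show ?thesis
      using Fu[OF in_U[of 1]] Fu[OF u] by (simp add: scaleC_one G_def)
  qed
  define u0 :: "complex ^ 16" where "u0 = (\<chi> i. 1)"
  have u0: "u0 $ 2 = 1" by (simp add: u0_def)
  have "F r = F (Phi u0)" if r: "r \<in> X_O" for r
  proof (rule X_O_continuous_constant[OF _ _ r])
    show "continuous_on X_O F" unfolding F_def by (rule continuous_factor[OF T])
    fix r assume r: "r \<in> X_O" "z1 r \<noteq> 0"
    define c where "c = z1 r"
    have c: "c \<noteq> 0" using r by (simp add: c_def)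
    have "F r = F (Phi (coord r))" using r by (simp add: Phi_coord z1_eq_coord)
    \<comment> \<open>The second coordinate of u0 is 1, so the difference has second coordinate 0
      and \<open>line\<close> applies.\<close>
    also have "coord r = c *\<^sub>C u0 + (coord r - c *\<^sub>C u0)" by simp
    also have "F (Phi \<dots>) = F (Phi (c *\<^sub>C u0))"
      by (rule line) (use c u0 in \<open>simp_all add: scaleC_nth scaleC_complex_def c_def z1_eq_coord\<close>)
    also have "\<dots> = F (c *\<^sub>C Phi u0)" using u0 c by (simp add: Phi_scaleC)
    also have "\<dots> = F (Phi u0)"
      unfolding F_def by (rule factor_homogeneous[OF g c Phi_in_X_O]) (simp add: u0)
    finally show "F r = F (Phi u0)" .
  qed
  from this[OF p] this[OF q] show ?thesis by (simp add: F_def)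
qed

text \<open>In general \<open>factor_compose\<close> only gives a cocycle, with the first factor
  evaluated at the moved point; constancy in the point turns it into a character.\<close>

lemma factor_eq_1:
  assumes g: "g \<in> F4" and p: "p \<in> X_O"
  shows "factor X_O \<Omega> (cplx g) p = 1"
proof -
  have "F4_character (\<lambda>g. factor X_O \<Omega> (cplx g) p)"
  proof
    fix g h assume gh: "g \<in> F4" "h \<in> F4"
    have "factor X_O \<Omega> (cplx (g \<circ> h)) p = factor X_O \<Omega> (cplx g \<circ> cplx h) p"
      using gh by (intro factor_cong[OF csymmetry_cplx csymmetry_compose[OF csymmetry_cplx
          csymmetry_cplx] p])
        (simp_all add: F4_comp cplx_compose X_O_in_jordan3)
    also have "\<dots> = factor X_O \<Omega> (cplx g) (cplx h p) * factor X_O \<Omega> (cplx h) p"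
      by (rule factor_compose[OF csymmetry_cplx[OF gh(1)] csymmetry_cplx[OF gh(2)] p])
    also have "factor X_O \<Omega> (cplx g) (cplx h p) = factor X_O \<Omega> (cplx g) p"
      by (rule factor_constant[OF gh(1) cplx_in_X_O[OF gh(2) p] p])
    finally show "factor X_O \<Omega> (cplx (g \<circ> h)) p = factor X_O \<Omega> (cplx g) p * factor X_O \<Omega> (cplx h) p"
        .
  next
    fix g h assume gh: "g \<in> F4" "h \<in> F4" "\<And>A. A \<in> jordan3 \<Longrightarrow> g A = h A"
    then show "factor X_O \<Omega> (cplx g) p = factor X_O \<Omega> (cplx h) p"
      by (intro factor_cong[OF csymmetry_cplx csymmetry_cplx p] cplx_cong) (simp_all add:
          X_O_in_jordan3)
  next
    fix g assume "g \<in> F4"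
    then show "factor X_O \<Omega> (cplx g) p \<noteq> 0" by (intro factor_nonzero csymmetry_cplx p)
  qed
  from F4_character.trivial[OF this g] show ?thesis .
qed

lemma Omega_invariant:
  assumes g: "g \<in> F4"
  shows "form_eq_on X_O X_O (pullback X_O (complexify g) \<Omega>) \<Omega>"
  unfolding form_eq_on_def
proof (intro ballI allI impI)
  fix p and v :: "16 \<Rightarrow> complex omat"
  assume p: "p \<in> X_O" and v: "\<forall>i. v i \<in> tangent_space X_O p"
  have eq: "complexify g q = cplx g q" if "q \<in> X_O" for q
    using X_O_in_jordan3[OF that] by (simp add: cplx_eq)
  have "pullback X_O (complexify g) \<Omega> p v = \<Omega> (cplx g p) (\<lambda>i. cplx g (v i))"
    using pushforward_eq[OF cplx_clinear[OF g] eq] v eq[OF p] by (simp add: pullback_def)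
  also have "\<dots> = \<Omega> p v"
    using factor_eq[OF csymmetry_cplx[OF g] p] v factor_eq_1[OF g p] by simp
  finally show "pullback X_O (complexify g) \<Omega> p v = \<Omega> p v" .
qed

end

theorem proposition6p3:
  fixes \<Omega> :: "(complex omat, 16) form"
    and \<alpha> :: "real omat \<Rightarrow> real omat"
  assumes "is_Omega_O \<Omega>"
    and "\<alpha> \<in> F4"
  shows "form_eq_on X_O X_O (pullback X_O (complexify \<alpha>) \<Omega>) \<Omega>"
  using assms by (rule Omega_invariant)

end
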